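(* Let $\gamma>0$, $\omega>0$, $n\ge 1$, and let $\tau_1,\dots,\tau_n>0$. Assume that $f:\mathbb{R}^n\to\mathbb{R}$ is locally Lipschitz continuous, that $g:\mathbb{R}\times[0,1]\to\mathbb{R}$ is Hölder continuous, and that $g(t,x)$ is $\omega$-periodic in $t$. Suppose that there exist positive constants $\beta_1,\dots,\beta_n$ and $K$ such that $$|f(\xi_1,\dots,\xi_n)+g(t,x)|\le \sum_{k=1}^n\beta_k|\xi_k|+K\qquad\text{for all } t\in\mathbb{R},\ x\in[0,1],\ (\xi_1,\dots,\xi_n)\in\mathbb{R}^n,$$ and $$\sum_{k=1}^n\beta_k<\gamma\pi^4+\pi^2-1.$$ Then the delayed extended Fisher-Kolmogorov problem $$\begin{cases}\dfrac{\partial}{\partial t}u(t,x)+\gamma\dfrac{\partial^4}{\partial x^4}u(t,x)-\dfrac{\partial^2}{\partial x^2}u(t,x)-u(t,x)=g(t,x)+f(u(t-\tau_1,x),\dots,u(t-\tau_n,x)) & \text{in }\mathbb{R}\times(0,1),\\[4pt] u(t,0)=u(t,1)=0,\quad u_{xx}(t,0)=u_{xx}(t,1)=0, & t\in\mathbb{R},\end{cases}$$ has at least one time $\omega$-periodic classical solution $u\in C^{1,2}(\mathbb{R}\times[0,1])$.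
   Context: $C^{1,2}(\mathbb{R}\times[0,1])$ denotes the functions $u(t,x)$ that are continuously differentiable once in $t$ and twice in $x$ on $\mathbb{R}\times[0,1]$. A classical solution is a function for which all derivatives appearing in the equation exist and which satisfies the equation and the boundary conditions pointwise. Time $\omega$-periodic means $u(t+\omega,x)=u(t,x)$ for all $t,x$. *)

theory Defs
  imports "HOL-Analysis.Analysis"
begin

definition locally_lipschitz :: "('a::metric_space \<Rightarrow> 'b::metric_space) \<Rightarrow> bool" where
  "locally_lipschitz f \<longleftrightarrow> (\<forall>x. \<exists>r>0. \<exists>L. L-lipschitz_on (ball x r) f)"

definition hoelder_continuous_on ::
    "'a::metric_space set \<Rightarrow> ('a \<Rightarrow> 'b::metric_space) \<Rightarrow> bool" where
  "hoelder_continuous_on S g \<longleftrightarrow>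
     (\<exists>\<alpha> C. 0 < \<alpha> \<and> \<alpha> \<le> 1 \<and>
        (\<forall>p\<in>S. \<forall>q\<in>S. dist (g p) (g q) \<le> C * dist p q powr \<alpha>))"

text \<open>
  A function \<open>u(t,x)\<close> on \<open>\<real> \<times> [0,1]\<close> is represented by a total curried function whose
  values for \<open>x\<close> outside \<open>[0,1]\<close> are irrelevant. Accordingly the \<open>x\<close>-derivative is taken
  within \<open>[0,1]\<close>: it is one-sided at the endpoints and the usual derivative
  at interior points.
\<close>

definition dt :: "(real \<Rightarrow> real \<Rightarrow> real) \<Rightarrow> real \<Rightarrow> real \<Rightarrow> real" where
  "dt u t x = deriv (\<lambda>s. u s x) t"

definition dx :: "(real \<Rightarrow> real \<Rightarrow> real) \<Rightarrow> real \<Rightarrow> real \<Rightarrow> real" where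
  "dx u t x = vector_derivative (u t) (at x within {0..1})"

definition dt_exists :: "(real \<Rightarrow> real \<Rightarrow> real) \<Rightarrow> real \<Rightarrow> real \<Rightarrow> bool" where
  "dt_exists u t x \<longleftrightarrow> (\<lambda>s. u s x) differentiable (at t)"

definition dx_exists :: "(real \<Rightarrow> real \<Rightarrow> real) \<Rightarrow> real \<Rightarrow> real \<Rightarrow> bool" where
  "dx_exists u t x \<longleftrightarrow> u t differentiable (at x within {0..1})"

definition C12 :: "(real \<Rightarrow> real \<Rightarrow> real) \<Rightarrow> bool" where
  "C12 u \<longleftrightarrow>
     (\<forall>t. \<forall>x\<in>{0..1}. dt_exists u t x \<and> dx_exists u t x \<and> dx_exists (dx u) t x) \<and>
     (\<forall>v\<in>{u, dt u, dx u, dx (dx u)}. continuous_on (UNIV \<times> {0..1}) (\<lambda>(t, x). v t x))"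

definition time_periodic :: "real \<Rightarrow> (real \<Rightarrow> real \<Rightarrow> real) \<Rightarrow> bool" where
  "time_periodic \<omega> u \<longleftrightarrow> (\<forall>t. \<forall>x\<in>{0..1}. u (t + \<omega>) x = u t x)"

text \<open>
  The derivatives in the equation are only required to exist for \<open>0 < x < 1\<close>; the boundary
  conditions additionally need the one-sided second \<open>x\<close>-derivative at the endpoints.
\<close>

definition classical_solution ::
    "real \<Rightarrow> ('n::finite \<Rightarrow> real) \<Rightarrow> (real ^ 'n \<Rightarrow> real) \<Rightarrow> (real \<Rightarrow> real \<Rightarrow> real) \<Rightarrow>
     (real \<Rightarrow> real \<Rightarrow> real) \<Rightarrow> bool" where
  "classical_solution \<gamma> \<tau> f g u \<longleftrightarrow>
     (\<forall>t. \<forall>x\<in>{0<..<1}.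
        dt_exists u t x \<and> (\<forall>j<4. dx_exists ((dx ^^ j) u) t x) \<and>
        dt u t x + \<gamma> * (dx ^^ 4) u t x - (dx ^^ 2) u t x - u t x
          = g t x + f (\<chi> k. u (t - \<tau> k) x)) \<and>
     (\<forall>t. \<forall>x\<in>{0, 1}.
        dx_exists u t x \<and> dx_exists (dx u) t x \<and>
        u t x = 0 \<and> (dx ^^ 2) u t x = 0)"

end

theory Submission
  imports Defs "HOL-Complex_Analysis.Great_Picard"
begin

text \<open>
  The operator \<open>A = \<gamma> \<partial>\<^sub>x\<^sup>4 - \<partial>\<^sub>x\<^sup>2 - 1\<close> with the boundary conditions \<open>v = v'' = 0\<close> is diagonal
  in the basis \<open>sin (n \<pi> x)\<close>, with eigenvalues \<open>\<gamma> (n \<pi>)^4 + (n \<pi>)\<^sup>2 - 1\<close>, the smallest of which is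
  the bound on \<open>\<Sum> \<beta>\<^sub>k\<close> in the theorem. For a given continuous periodic right-hand side
  \<open>h\<close>, the equation \<open>u\<^sub>t + A u = h\<close> decouples into scalar equations for the sine coefficients of
  \<open>u\<close>, each of which has exactly one \<open>\<omega>\<close>-periodic solution, given by an integral over one period.

  Existence comes from a fixed point of the map \<open>solve\<close> that sends \<open>u\<close> to the periodic solution with
  right-hand side \<open>g + f (u(\<cdot> - \<tau>\<^sub>1), \<dots>, u(\<cdot> - \<tau>\<^sub>n))\<close>. The growth condition enters through the norm
  \<open>sup\<^sub>t \<parallel>u(t)\<parallel>\<close> with \<open>\<parallel>\<cdot>\<parallel>\<close> the norm of \<open>L\<^sup>2(0,1)\<close>: there the linear solution operator has norm at most the
  reciprocal of the smallest eigenvalue (\<open>sol_L2_bound\<close>), delays do not change the norm, and so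
  a ball of radius \<open>K / (\<lambda> - \<Sum> \<beta>\<^sub>k)\<close>, where \<open>\<lambda>\<close> is that eigenvalue, is mapped into itself. The eigenvalues
  grow like \<open>n^4\<close>, so an \<open>L\<^sup>2\<close> bound on \<open>h\<close> already bounds the maximum of \<open>u\<close>, its Lipschitz constant in
  \<open>x\<close> and its Hoelder constant of exponent \<open>1/2\<close> in \<open>t\<close> (\<open>sol_bound\<close>, \<open>sol_modulus\<close>). The functions
  that satisfy all these bounds form a convex set that is compact in the maximum norm
  (\<open>compact_candidates\<close>), and Schauder's theorem applies. It is derived from Brouwer's theorem for
  cubes of arbitrary dimension, which in turn rests on Kuhn's combinatorial lemma.

  It remains to see that the fixed point is a classical solution. The series for \<open>u\<close>, \<open>u\<^sub>x\<close> and
  \<open>u\<^sub>x\<^sub>x\<close> converge absolutely. The series for \<open>u\<^sub>t\<close> does not converge absolutely for an arbitrary Hoelder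
  exponent; its uniform convergence is the core of the regularity proof (\<open>time_derivative_converges\<close>).
  The coefficients of \<open>u\<^sub>t\<close> are, up to a summable error, integrals over \<open>s\<close> of
  \<open>\<lambda>\<^sub>n exp (- \<lambda>\<^sub>n s)\<close> times the coefficients of \<open>h(t) - h(t - s)\<close>. Partial sums of sine series are bounded
  in the maximum norm up to a factor \<open>n^\<epsilon>\<close>, since the Dirichlet kernels have
  \<open>L\<^sup>1\<close> norms of that size, and summation by parts turns this into the bound \<open>s^(\<theta> - 1 - \<epsilon>)\<close> for the integrand when \<open>h\<close> is Hoelder
  continuous in \<open>t\<close> with exponent \<open>\<theta>\<close>. This is integrable for \<open>\<epsilon> < \<theta>\<close>. Here \<open>h\<close> is Hoelder continuous
  because \<open>g\<close> is and because \<open>u\<close> has exponent \<open>1/2\<close> by construction. Finally,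
  \<open>\<gamma> u\<^sub>x\<^sub>x\<close> has the same sine coefficients as the solution \<open>P\<close> of
  \<open>P'' = h - u\<^sub>t + u\<^sub>x\<^sub>x + u\<close> with \<open>P(0) = P(1) = 0\<close>, so both agree by completeness of the sine system, and
  the fourth derivative exists and satisfies the equation.
\<close>

section \<open>Fixed points in arbitrary finite dimension and in normed spaces\<close>

lemma compact_cube:
  "compact {z :: nat \<Rightarrow> real. (\<forall>i<n. 0 \<le> z i \<and> z i \<le> 1) \<and> (\<forall>i\<ge>n. z i = 0)}"
proof -
  have eq: "{z :: nat \<Rightarrow> real. (\<forall>i<n. 0 \<le> z i \<and> z i \<le> 1) \<and> (\<forall>i\<ge>n. z i = 0)} =
      PiE UNIV (\<lambda>i. if i < n then {0..1} else {0})" (is "?L = ?R")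
  proof (rule set_eqI)
    fix z :: "nat \<Rightarrow> real"
    show "z \<in> ?L \<longleftrightarrow> z \<in> ?R"
      by (simp add: PiE_def Pi_def) (metis atLeastAtMost_iff not_le singletonD singletonI)
  qed
  have "compactin (product_topology (\<lambda>i. euclidean) UNIV) ?R"
    by (subst compactin_PiE) auto
  then show ?thesis
    unfolding eq by (metis compactin_euclidean_iff euclidean_product_topology)
qed

text \<open>
  Brouwer's theorem in a dimension \<open>n\<close> that is a variable of the logic, not a type: points are
  sequences that vanish from index \<open>n\<close> on. Colour the grid of mesh \<open>1/p\<close> by the sign of
  \<open>F z i - z i\<close> in each coordinate. Kuhn's lemma gives a grid cell in which every coordinate
  shows both signs, and a limit of such cells for \<open>p \<longlonglongrightarrow> \<infinity>\<close> is a fixed point.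
\<close>

theorem brouwer_cube:
  fixes F :: "(nat \<Rightarrow> real) \<Rightarrow> nat \<Rightarrow> real" and n :: nat
  defines "C \<equiv> {z. (\<forall>i<n. 0 \<le> z i \<and> z i \<le> 1) \<and> (\<forall>i\<ge>n. z i = 0)}"
  assumes cont: "continuous_on C F" and into: "F ` C \<subseteq> C"
  obtains z where "z \<in> C" "F z = z"
proof -
  have cell: "\<exists>q. (\<lambda>i. if i < n then real (q i) / real (Suc m) else 0) \<in> C \<and>
      (\<forall>i<n. \<exists>a b. a \<in> C \<and> b \<in> C \<and> a i \<le> F a i \<and> F b i \<le> b i \<and>
         (\<forall>j<n. \<bar>a j - real (q j) / real (Suc m)\<bar> \<le> 1 / real (Suc m) \<and>
                \<bar>b j - real (q j) / real (Suc m)\<bar> \<le> 1 / real (Suc m)))" for m :: nat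
  proof -
    define p where "p = Suc m"
    have p: "0 < p" by (simp add: p_def)
    define pt where "pt x = (\<lambda>i. if i < n then real (x i) / real p else 0)" for x :: "nat \<Rightarrow> nat"
    \<comment> \<open>Label 0 implies that \<open>F\<close> does not decrease coordinate \<open>i\<close>, label 1 that \<open>F\<close> does not increase it;
      on the upper face the label is forced to be 1, which is consistent as \<open>F\<close> maps into the cube.\<close>
    define label where "label x i = (if x i < p \<and> pt x i \<le> F (pt x) i then 0 else 1 :: nat)" for x i
    have ptC: "pt x \<in> C" if "\<forall>i<n. x i \<le> p" for x
      using that p by (auto simp: C_def pt_def divide_le_eq_1)
    have FC: "0 \<le> F (pt x) i" "F (pt x) i \<le> 1" if "\<forall>i<n. x i \<le> p" "i < n" for x i
      using into ptC[OF that(1)] that(2) by (auto simp: C_def image_subset_iff)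
    obtain q where q: "\<forall>i<n. q i < p"
      and rs: "\<forall>i<n. \<exists>r s. (\<forall>j<n. q j \<le> r j \<and> r j \<le> q j + 1) \<and>
          (\<forall>j<n. q j \<le> s j \<and> s j \<le> q j + 1) \<and> label r i \<noteq> label s i"
    proof (rule kuhn_lemma[OF p, of n label])
      show "\<forall>x. (\<forall>i<n. x i \<le> p) \<longrightarrow> (\<forall>i<n. x i = 0 \<longrightarrow> label x i = 0)"
        using FC p by (auto simp: label_def pt_def)
    qed (auto simp: label_def)
    have low: "pt x i \<le> F (pt x) i" if "label x i = 0" for x i
      using that by (auto simp: label_def split: if_splits)
    have high: "F (pt x) i \<le> pt x i" if "label x i \<noteq> 0" "\<forall>i<n. x i \<le> p" "i < n" for x i
    proof (cases "x i < p")
      case True then show ?thesis using that by (auto simp: label_def split: if_splits)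
    next
      case False
      then have "x i = p" using that by (simp add: le_antisym)
      then show ?thesis using FC[OF that(2,3)] p that by (simp add: pt_def)
    qed
    have close: "\<bar>pt x j - real (q j) / real p\<bar> \<le> 1 / real p"
      if "\<forall>j<n. q j \<le> x j \<and> x j \<le> q j + 1" "j < n" for x j
    proof -
      have "real (q j) \<le> real (x j)" "real (x j) \<le> real (q j) + 1"
        using that by (metis of_nat_le_iff, metis of_nat_le_iff of_nat_Suc Suc_eq_plus1 add.commute)
      then have "\<bar>real (x j) - real (q j)\<bar> \<le> 1" by linarith
      then show ?thesis
        using that(2) p by (simp add: pt_def diff_divide_distrib[symmetric] abs_divide divide_right_mono)
    qed
    have "\<exists>a b. a \<in> C \<and> b \<in> C \<and> a i \<le> F a i \<and> F b i \<le> b i \<and>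
         (\<forall>j<n. \<bar>a j - real (q j) / real p\<bar> \<le> 1 / real p \<and>
                \<bar>b j - real (q j) / real p\<bar> \<le> 1 / real p)" if i: "i < n" for i
    proof -
      obtain r s where r: "\<forall>j<n. q j \<le> r j \<and> r j \<le> q j + 1"
        and s: "\<forall>j<n. q j \<le> s j \<and> s j \<le> q j + 1" and ne: "label r i \<noteq> label s i"
        using rs i by blast
      have rp: "\<forall>j<n. r j \<le> p" and sp: "\<forall>j<n. s j \<le> p"
        using r s q by (metis Suc_eq_plus1 Suc_leI le_trans)+
      show ?thesis
      proof (cases "label r i = 0")
        case True
        then have "label s i \<noteq> 0" using ne by simp
        with True show ?thesis
          using ptC[OF rp] ptC[OF sp] low[of r i] high[of s i, OF _ sp i] close[OF r] close[OF s]
          by (intro exI[of _ "pt r"] exI[of _ "pt s"]) simp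
      next
        case False
        then have "label s i = 0" using ne by (auto simp: label_def split: if_splits)
        with False show ?thesis
          using ptC[OF rp] ptC[OF sp] low[of s i] high[of r i, OF _ rp i] close[OF r] close[OF s]
          by (intro exI[of _ "pt s"] exI[of _ "pt r"]) simp
      qed
    qed
    moreover have "pt q \<in> C" using ptC q by (simp add: less_imp_le)
    ultimately show ?thesis unfolding pt_def p_def by blast
  qed
  obtain q where qq: "\<forall>m. (\<lambda>i. if i < n then real (q m i) / real (Suc m) else 0) \<in> C \<and>
      (\<forall>i<n. \<exists>a b. a \<in> C \<and> b \<in> C \<and> a i \<le> F a i \<and> F b i \<le> b i \<and>
         (\<forall>j<n. \<bar>a j - real (q m j) / real (Suc m)\<bar> \<le> 1 / real (Suc m) \<and>
                \<bar>b j - real (q m j) / real (Suc m)\<bar> \<le> 1 / real (Suc m)))"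
    using choice[OF allI[OF cell]] by (rule exE)
  have qC: "(\<lambda>i. if i < n then real (q m i) / real (Suc m) else 0) \<in> C" for m
    using qq[THEN spec, of m] by (rule conjunct1)
  have q: "\<forall>i<n. \<exists>a b. a \<in> C \<and> b \<in> C \<and> a i \<le> F a i \<and> F b i \<le> b i \<and>
         (\<forall>j<n. \<bar>a j - real (q m j) / real (Suc m)\<bar> \<le> 1 / real (Suc m) \<and>
                \<bar>b j - real (q m j) / real (Suc m)\<bar> \<le> 1 / real (Suc m))" for m
    using qq[THEN spec, of m] by (rule conjunct2)
  define z where "z m = (\<lambda>i. if i < n then real (q m i) / real (Suc m) else 0)" for m
  have "seq_compact C"
    using compact_cube[of n] unfolding C_def[symmetric] by (simp add: compact_imp_seq_compact)
  then obtain x r where xC: "x \<in> C" and r: "strict_mono r" and zx: "(z \<circ> r) \<longlonglongrightarrow> x"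
    using qC unfolding z_def[symmetric] by (elim seq_compactE) auto
  have coord: "(\<lambda>k. y k i) \<longlonglongrightarrow> w i" if "y \<longlonglongrightarrow> w" for y :: "nat \<Rightarrow> nat \<Rightarrow> real" and w i
    using continuous_on_tendsto_compose[OF continuous_on_product_coordinates[of i] that] by simp
  have fin: "y \<longlonglongrightarrow> w" if "\<And>i. (\<lambda>k. y k i) \<longlonglongrightarrow> w i" for y :: "nat \<Rightarrow> nat \<Rightarrow> real" and w
  proof -
    have "limitin (product_topology (\<lambda>i. euclidean) UNIV) y w sequentially"
      using that by (simp add: limitin_componentwise)
    then show ?thesis by (simp add: euclidean_product_topology)
  qed
  have inv: "(\<lambda>k. 1 / real (Suc (r k))) \<longlonglongrightarrow> 0"
    using LIMSEQ_subseq_LIMSEQ[OF LIMSEQ_inverse_real_of_nat r] by (simp add: o_def inverse_eq_divide)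
  have near: "a \<longlonglongrightarrow> x"
    if aC: "\<And>k. a k \<in> C" and "\<And>k j. j < n \<Longrightarrow> \<bar>a k j - z (r k) j\<bar> \<le> 1 / real (Suc (r k))"
    for a :: "nat \<Rightarrow> nat \<Rightarrow> real"
  proof (rule fin)
    fix i
    show "(\<lambda>k. a k i) \<longlonglongrightarrow> x i"
    proof (cases "i < n")
      case True
      have "(\<lambda>k. a k i - z (r k) i) \<longlonglongrightarrow> 0"
        by (rule Lim_null_comparison[OF _ inv]) (use that True in auto)
      from tendsto_add[OF this coord[OF zx, of i]] show ?thesis by (simp add: o_def)
    next
      case False
      then show ?thesis using aC xC by (simp add: C_def)
    qed
  qed
  have zr: "z (r k) j = real (q (r k) j) / real (Suc (r k))" if "j < n" for k j
    using that by (simp add: z_def)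
  have "F x i = x i" for i
  proof (cases "i < n")
    case False
    then show ?thesis using xC into by (auto simp: C_def image_subset_iff)
  next
    case True
    have "\<forall>k. \<exists>a b. a \<in> C \<and> b \<in> C \<and> a i \<le> F a i \<and> F b i \<le> b i \<and>
         (\<forall>j<n. \<bar>a j - z (r k) j\<bar> \<le> 1 / real (Suc (r k)) \<and> \<bar>b j - z (r k) j\<bar> \<le> 1 / real (Suc (r k)))"
      using q True by (simp add: zr)
    then obtain a b where ab: "\<And>k. a k \<in> C" "\<And>k. b k \<in> C"
        "\<And>k. a k i \<le> F (a k) i" "\<And>k. F (b k) i \<le> b k i"
        "\<And>k j. j < n \<Longrightarrow> \<bar>a k j - z (r k) j\<bar> \<le> 1 / real (Suc (r k))"
        "\<And>k j. j < n \<Longrightarrow> \<bar>b k j - z (r k) j\<bar> \<le> 1 / real (Suc (r k))"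
      by metis
    have ax: "a \<longlonglongrightarrow> x" and bx: "b \<longlonglongrightarrow> x" by (rule near; use ab in simp)+
    have Fa: "(\<lambda>k. F (a k) i) \<longlonglongrightarrow> F x i"
      by (rule coord) (rule continuous_on_tendsto_compose[OF cont ax xC], use ab in simp)
    have Fb: "(\<lambda>k. F (b k) i) \<longlonglongrightarrow> F x i"
      by (rule coord) (rule continuous_on_tendsto_compose[OF cont bx xC], use ab in simp)
    have "x i \<le> F x i"
      by (rule LIMSEQ_le[OF coord[OF ax] Fa]) (use ab in auto)
    moreover have "F x i \<le> x i"
      by (rule LIMSEQ_le[OF Fb coord[OF bx]]) (use ab in auto)
    ultimately show ?thesis by simp
  qed
  then have "F x = x" by auto
  with xC show ?thesis by (rule that)
qed

text \<open>
  For a finite \<open>e\<close>-net \<open>c 0, \<dots>, c (n - 1)\<close> of \<open>S\<close>, the Schauder projection replaces a point by the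
  average of the net points at distance less than \<open>e\<close>, and moves it by less than \<open>e\<close>. Written in the
  weights of that average, the projection composed with \<open>f\<close> is a self-map of a cube. A fixed point
  of it is moved by \<open>f\<close> by less than \<open>e\<close>, and compactness of \<open>S\<close> removes \<open>e\<close>.
\<close>

theorem schauder_fixed_point:
  fixes S :: "'a::real_normed_vector set" and f :: "'a \<Rightarrow> 'a"
  assumes S: "compact S" "convex S" "S \<noteq> {}"
    and cont: "continuous_on S f" and into: "f ` S \<subseteq> S"
  obtains x where "x \<in> S" "f x = x"
proof -
  have approx: "\<exists>x\<in>S. norm (f x - x) < e" if e: "e > 0" for e :: real
  proof -
    obtain K where K: "finite K" "K \<subseteq> S" "S \<subseteq> (\<Union>c\<in>K. ball c e)"
      using seq_compact_imp_totally_bounded[OF compact_imp_seq_compact[OF S(1)], rule_format, OF e] by auto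
    obtain c :: "nat \<Rightarrow> 'a" and n where cn: "K = c ` {i. i < n}"
      using finite_imp_nat_seg_image_inj_on[OF K(1)] by blast
    have n0: "0 < n" using cn K(3) S(3) by (cases n) auto
    have cS: "c i \<in> S" if "i < n" for i using K(2) cn that by auto
    define C where "C = {z :: nat \<Rightarrow> real. (\<forall>i<n. 0 \<le> z i \<and> z i \<le> 1) \<and> (\<forall>i\<ge>n. z i = 0)}"
    define s where "s z = (\<Sum>i<n. z i)" for z :: "nat \<Rightarrow> real"
    \<comment> \<open>Weights in the cube need not have sum 1. A missing part is given to \<open>c 0\<close> and an excess is
      divided out, so that \<open>X\<close> is continuous on the cube and equals the plain combination when the sum is 1.\<close>
    define X where "X z = (1 / max 1 (s z)) *\<^sub>R ((\<Sum>i<n. z i *\<^sub>R c i) + max 0 (1 - s z) *\<^sub>R c 0)"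
      for z :: "nat \<Rightarrow> real"
    have s0: "0 \<le> s z" if "z \<in> C" for z
      using that by (auto simp: C_def s_def intro!: sum_nonneg)
    have X: "X z \<in> S" if z: "z \<in> C" for z
    proof -
      define a where "a i = (1 / max 1 (s z)) * (z i + (if i = 0 then max 0 (1 - s z) else 0))" for i
      have "(\<Sum>i<n. a i) = (1 / max 1 (s z)) * (s z + max 0 (1 - s z))"
        unfolding a_def sum_distrib_left[symmetric] sum.distrib using n0 by (simp add: s_def)
      also have "\<dots> = 1" using s0[OF z] by (auto simp: max_def)
      finally have "(\<Sum>i<n. a i) = 1" .
      moreover have "0 \<le> a i" if "i < n" for i
        using z that by (auto simp: a_def C_def max_def)
      ultimately have "(\<Sum>i<n. a i *\<^sub>R c i) \<in> S"
        by (intro convex_sum S(2)) (auto simp: cS)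
      also have "(\<Sum>i<n. a i *\<^sub>R c i) = X z"
      proof -
        have "(\<Sum>i<n. a i *\<^sub>R c i) = (1 / max 1 (s z)) *\<^sub>R
            (\<Sum>i<n. z i *\<^sub>R c i + (if i = 0 then max 0 (1 - s z) *\<^sub>R c 0 else 0))"
          unfolding scaleR_right.sum by (rule sum.cong) (auto simp: a_def scaleR_left_distrib scaleR_right_distrib add_divide_distrib)
        also have "\<dots> = X z" unfolding sum.distrib X_def using n0 by simp
        finally show ?thesis .
      qed
      finally show ?thesis .
    qed
    have cs: "continuous_on C s"
      unfolding s_def by (intro continuous_intros continuous_on_subset[OF continuous_on_product_coordinates]) auto
    have cX: "continuous_on C X"
      unfolding X_def
      by (intro continuous_intros cs continuous_on_subset[OF continuous_on_product_coordinates]) auto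
    define w where "w y i = max 0 (e - dist y (c i))" for y i
    define W where "W y = (\<Sum>i<n. w y i)" for y
    have w0: "0 \<le> w y i" for y i by (simp add: w_def)
    have W: "0 < W y" if yS: "y \<in> S" for y
    proof -
      obtain i where "i < n" "dist y (c i) < e"
        using K(3) cn yS by (auto simp: dist_commute subset_iff)
      then have "0 < w y i" by (simp add: w_def)
      also have "w y i \<le> W y" unfolding W_def
        using \<open>i < n\<close> by (intro member_le_sum) (auto simp: w0)
      finally show ?thesis .
    qed
    define F where "F z = (\<lambda>i. if i < n then w (f (X z)) i / W (f (X z)) else 0)" for z
    have fX: "f (X z) \<in> S" if "z \<in> C" for z using X[OF that] into by auto
    have cfX: "continuous_on C (\<lambda>z. f (X z))"
      by (rule continuous_on_compose2[OF cont cX]) (use X in auto)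
    have cF: "continuous_on C F"
    proof (rule continuous_on_coordinatewise_then_product)
      fix i
      show "continuous_on C (\<lambda>z. F z i)"
      proof (cases "i < n")
        case True
        have "continuous_on C (\<lambda>z. w (f (X z)) i / W (f (X z)))"
          unfolding W_def w_def
          by (intro continuous_intros cfX) (use W[OF fX] in \<open>force simp: W_def w_def\<close>)
        then show ?thesis using True by (simp add: F_def)
      qed (simp add: F_def)
    qed
    have sumF: "s (F z) = 1" if "z \<in> C" for z
      using W[OF fX[OF that]] by (simp add: s_def F_def sum_divide_distrib[symmetric] W_def)
    have "F ` C \<subseteq> C"
    proof (clarsimp simp: image_subset_iff)
      fix z assume z: "z \<in> C"
      have "w (f (X z)) i \<le> W (f (X z))" if "i < n" for i
        unfolding W_def using that by (intro member_le_sum) (auto simp: w0)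
      then show "F z \<in> C"
        using W[OF fX[OF z]] w0 by (auto simp: C_def F_def divide_le_eq_1)
    qed
    then obtain z where z: "z \<in> C" "F z = z"
      by (rule brouwer_cube[of n F, folded C_def, OF cF])
    have sz: "s z = 1" using sumF[OF z(1)] z(2) by simp
    define y where "y = f (X z)"
    have yS: "y \<in> S" using fX z by (simp add: y_def)
    have Wy: "W y > 0" using W yS by simp
    have zi: "z i = w y i / W y" if "i < n" for i
      using fun_cong[OF z(2), of i] that by (simp add: F_def y_def)
    have Xz: "X z = (\<Sum>i<n. z i *\<^sub>R c i)" by (simp add: X_def sz)
    have "y - X z = (\<Sum>i<n. z i *\<^sub>R (y - c i))"
      using sz by (simp add: Xz scaleR_right_diff_distrib sum_subtractf scaleR_left.sum[symmetric] s_def)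
    then have "norm (y - X z) \<le> (\<Sum>i<n. norm (z i *\<^sub>R (y - c i)))" by (simp only: norm_sum)
    also have "\<dots> < (\<Sum>i<n. z i * e)"
    proof (rule sum_strict_mono_ex1)
      have *: "z i \<noteq> 0 \<Longrightarrow> dist y (c i) < e" "z i \<ge> 0" if "i < n" for i
        using zi[OF that] Wy w0[of y i] by (auto simp: w_def max_def split: if_splits)
      have le: "norm (z i *\<^sub>R (y - c i)) \<le> z i * e" and
        lt: "0 < z i \<Longrightarrow> norm (z i *\<^sub>R (y - c i)) < z i * e" if "i < n" for i
        using *[OF that] by (cases "z i = 0"; simp add: dist_norm mult_left_mono)+
      show "\<forall>i\<in>{..<n}. norm (z i *\<^sub>R (y - c i)) \<le> z i * e"
        using le by simp
      have "\<exists>i<n. z i > 0"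
      proof (rule ccontr)
        assume "\<not> ?thesis"
        then have "s z \<le> 0" unfolding s_def by (intro sum_nonpos) auto
        then show False using sz by simp
      qed
      then obtain i where "i < n" "z i > 0" by blast
      then show "\<exists>i\<in>{..<n}. norm (z i *\<^sub>R (y - c i)) < z i * e"
        using lt by (intro bexI[of _ i]) simp_all
    qed simp
    also have "\<dots> = e" using sz by (simp add: sum_distrib_right[symmetric] s_def)
    finally show ?thesis using X[OF z(1)] by (auto simp: y_def)
  qed
  have "compact ((\<lambda>x. norm (f x - x)) ` S)"
    by (intro compact_continuous_image S continuous_intros cont)
  moreover have "(\<lambda>x. norm (f x - x)) ` S \<noteq> {}" using S by simp
  ultimately obtain m where "m \<in> S" and m: "\<And>x. x \<in> S \<Longrightarrow> norm (f m - m) \<le> norm (f x - x)"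
    using compact_attains_inf[of "(\<lambda>x. norm (f x - x)) ` S"] by (auto simp: image_iff Ball_def Bex_def)
  have "norm (f m - m) \<le> 0"
  proof (rule ccontr)
    assume "\<not> ?thesis"
    then obtain x where "x \<in> S" "norm (f x - x) < norm (f m - m)"
      using approx[of "norm (f m - m)"] by auto
    then show False using m[of x] by simp
  qed
  then show ?thesis using that \<open>m \<in> S\<close> by simp
qed

section \<open>Sine coefficients on the unit interval\<close>

text \<open>
  Indices start at 0, so that \<open>freq n\<close> belongs to the sine with \<open>n + 1\<close> half waves and no index
  stands for the zero function.
\<close>

definition freq :: "nat \<Rightarrow> real" where
  "freq n = real (Suc n) * pi"

definition sine_coef :: "(real \<Rightarrow> real) \<Rightarrow> nat \<Rightarrow> real" where
  "sine_coef h n = 2 * integral {0..1} (\<lambda>y. h y * sin (freq n * y))"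

lemma freq_pos: "0 < freq n"
  by (simp add: freq_def)

lemma sin_freq_0_1: "sin (freq n * 0) = 0" "sin (freq n * 1) = 0"
  using sin_npi[of "Suc n"] by (simp_all add: freq_def)

lemma integral_cos_pi:
  "((\<lambda>x. cos (of_int k * pi * x)) has_integral (if k = 0 then 1 else 0)) {0..1::real}"
proof (cases "k = 0")
  case True
  then show ?thesis using has_integral_const_real[of "1::real" 0 1] by simp
next
  case False
  have "((\<lambda>x. cos (of_int k * pi * x)) has_integral
      (sin (of_int k * pi * 1) / (of_int k * pi) - sin (of_int k * pi * 0) / (of_int k * pi))) {0..1}"
    using False
    by (intro fundamental_theorem_of_calculus)
       (auto intro!: derivative_eq_intros simp: has_real_derivative_iff_has_vector_derivative[symmetric])
  moreover have "sin (of_int k * pi) = 0" by (simp add: sin_int_2pin sin_zero_iff_int2)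
  ultimately show ?thesis using False by simp
qed

lemma sin_orthogonal:
  "((\<lambda>x. sin (freq n * x) * sin (freq m * x)) has_integral (if n = m then 1 / 2 else 0)) {0..1}"
proof -
  define k l where "k = int n - int m" and "l = int n + int m + 2"
  have eq: "sin (freq n * x) * sin (freq m * x) = (cos (of_int k * pi * x) - cos (of_int l * pi * x)) / 2" for x
  proof -
    have "freq n * x - freq m * x = of_int k * pi * x" "freq n * x + freq m * x = of_int l * pi * x"
      by (simp_all add: freq_def k_def l_def algebra_simps)
    then show ?thesis by (simp only: sin_times_sin)
  qed
  have "((\<lambda>x. (cos (of_int k * pi * x) - cos (of_int l * pi * x)) / 2) has_integral
     ((if k = 0 then 1 else 0) - (if l = 0 then 1 else 0)) / 2) {0..1}"
    by (intro has_integral_divide has_integral_diff integral_cos_pi)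
  moreover have "k = 0 \<longleftrightarrow> n = m" "l \<noteq> 0" by (auto simp: k_def l_def)
  ultimately show ?thesis unfolding eq by (cases "n = m") simp_all
qed

lemma sine_coef_integrable:
  assumes "continuous_on {0..1} h"
  shows "(\<lambda>y. h y * sin (freq n * y)) integrable_on {0..1}"
  by (intro integrable_continuous_interval continuous_intros assms)

lemma sine_coef_has_integral:
  assumes "continuous_on {0..1} h"
  shows "((\<lambda>y. h y * sin (freq n * y)) has_integral (sine_coef h n / 2)) {0..1}"
  using integrable_integral[OF sine_coef_integrable[OF assms]] by (simp add: sine_coef_def)

lemma sine_coef_diff:
  assumes "continuous_on {0..1} h" "continuous_on {0..1} k"
  shows "sine_coef (\<lambda>x. h x - k x) n = sine_coef h n - sine_coef k n"
  unfolding sine_coef_def left_diff_distrib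
  by (simp add: integral_diff sine_coef_integrable assms right_diff_distrib)

lemma sine_coef_add:
  assumes "continuous_on {0..1} h" "continuous_on {0..1} k"
  shows "sine_coef (\<lambda>x. h x + k x) n = sine_coef h n + sine_coef k n"
  unfolding sine_coef_def distrib_right
  by (simp add: integral_add sine_coef_integrable assms distrib_left)

lemma sine_coef_cmult: "sine_coef (\<lambda>x. c * h x) n = c * sine_coef h n"
  unfolding sine_coef_def by (simp add: mult.assoc)

lemma sine_coef_cong: "(\<And>x. x \<in> {0..1} \<Longrightarrow> h x = k x) \<Longrightarrow> sine_coef h n = sine_coef k n"
  unfolding sine_coef_def by (intro arg_cong[where f = "(*) 2"] integral_cong) simp

lemma sine_coef_bound:
  assumes "continuous_on {0..1} h" and b: "\<And>x. x \<in> {0..1} \<Longrightarrow> \<bar>h x\<bar> \<le> B"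
  shows "\<bar>sine_coef h n\<bar> \<le> 2 * B"
proof -
  have "norm (integral {0..1} (\<lambda>y. h y * sin (freq n * y))) \<le> integral {0..1} (\<lambda>y::real. B)"
  proof (rule integral_norm_bound_integral[OF sine_coef_integrable[OF assms(1)]])
    fix x :: real assume "x \<in> {0..1}"
    then have "\<bar>h x\<bar> * \<bar>sin (freq n * x)\<bar> \<le> B * 1"
      by (intro mult_mono b) (auto intro: order_trans[OF abs_ge_zero b])
    then show "norm (h x * sin (freq n * x)) \<le> B" by (simp add: abs_mult)
  qed auto
  then show ?thesis by (simp add: sine_coef_def)
qed

lemma integral_sine_poly_squared:
  "((\<lambda>x. (\<Sum>n<N. a n * sin (freq n * x))\<^sup>2) has_integral (\<Sum>n<N. (a n)\<^sup>2) / 2) {0..1}"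
proof -
  have "((\<lambda>x. \<Sum>n<N. \<Sum>m<N. a n * a m * (sin (freq n * x) * sin (freq m * x))) has_integral
      (\<Sum>n<N. \<Sum>m<N. a n * a m * (if n = m then 1 / 2 else 0))) {0..1}"
    by (intro has_integral_sum has_integral_mult_right sin_orthogonal) auto
  moreover have "(\<Sum>n<N. a n * sin (freq n * x))\<^sup>2 =
      (\<Sum>n<N. \<Sum>m<N. a n * a m * (sin (freq n * x) * sin (freq m * x)))" for x
    by (simp add: power2_eq_square sum_product mult_ac)
  moreover have "(\<Sum>n<N. \<Sum>m<N. a n * a m * (if n = m then 1 / 2 else 0)) = (\<Sum>n<N. (a n)\<^sup>2) / 2"
    by (simp add: sum.delta' power2_eq_square sum_divide_distrib if_distrib cong: if_cong)
  ultimately show ?thesis by simp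
qed

text \<open>
  The integral of the square of \<open>h\<close> minus its partial sine sum is nonnegative. The factor 2
  is there because the sines have squared norm \<open>1/2\<close>.
\<close>

lemma bessel:
  assumes h: "continuous_on {0..1} h"
  shows "(\<Sum>n<N. (sine_coef h n)\<^sup>2) \<le> 2 * integral {0..1} (\<lambda>x. (h x)\<^sup>2)"
proof -
  let ?s = "\<lambda>x. \<Sum>n<N. sine_coef h n * sin (freq n * x)"
  have "((\<lambda>x. (h x)\<^sup>2) has_integral integral {0..1} (\<lambda>x. (h x)\<^sup>2)) {0..1}"
    by (intro integrable_integral integrable_continuous_interval continuous_intros h)
  moreover have "((\<lambda>x. \<Sum>n<N. 2 * sine_coef h n * (h x * sin (freq n * x))) has_integral
      (\<Sum>n<N. 2 * sine_coef h n * (sine_coef h n / 2))) {0..1}"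
    by (intro has_integral_sum has_integral_mult_right sine_coef_has_integral h) auto
  ultimately have "((\<lambda>x. (h x)\<^sup>2 - (\<Sum>n<N. 2 * sine_coef h n * (h x * sin (freq n * x))) + (?s x)\<^sup>2) has_integral
      integral {0..1} (\<lambda>x. (h x)\<^sup>2) - (\<Sum>n<N. 2 * sine_coef h n * (sine_coef h n / 2)) + (\<Sum>n<N. (sine_coef h n)\<^sup>2) / 2) {0..1}"
    by (intro has_integral_add has_integral_diff integral_sine_poly_squared)
  moreover have "(h x)\<^sup>2 - (\<Sum>n<N. 2 * sine_coef h n * (h x * sin (freq n * x))) + (?s x)\<^sup>2 = (h x - ?s x)\<^sup>2" for x
    by (simp add: power2_diff sum_distrib_left mult_ac)
  ultimately have "((\<lambda>x. (h x - ?s x)\<^sup>2) has_integral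
      integral {0..1} (\<lambda>x. (h x)\<^sup>2) - (\<Sum>n<N. 2 * sine_coef h n * (sine_coef h n / 2)) + (\<Sum>n<N. (sine_coef h n)\<^sup>2) / 2) {0..1}"
    by simp
  then have "0 \<le> integral {0..1} (\<lambda>x. (h x)\<^sup>2) - (\<Sum>n<N. 2 * sine_coef h n * (sine_coef h n / 2)) + (\<Sum>n<N. (sine_coef h n)\<^sup>2) / 2"
    by (rule has_integral_nonneg) simp
  then show ?thesis by (simp add: power2_eq_square)
qed

lemma sine_coef_sine_poly:
  assumes "n < N"
  shows "sine_coef (\<lambda>x. \<Sum>m<N. a m * sin (freq m * x)) n = a n"
proof -
  have "((\<lambda>x. \<Sum>m<N. a m * (sin (freq m * x) * sin (freq n * x))) has_integral
      (\<Sum>m<N. a m * (if m = n then 1 / 2 else 0))) {0..1}"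
    by (intro has_integral_sum has_integral_mult_right sin_orthogonal) auto
  moreover have "(\<Sum>m<N. a m * (if m = n then 1 / 2 else 0)) = a n / 2"
    using assms by (simp add: if_distrib cong: if_cong)
  ultimately show ?thesis
    unfolding sine_coef_def sum_distrib_right mult.assoc by (simp add: integral_unique)
qed

text \<open>
  The coefficients are continuous for uniform convergence, by \<open>sine_coef_bound\<close>, and those of a partial
  sum are known.
\<close>

lemma sine_coef_uniform_limit:
  assumes lim: "uniform_limit {0..1} (\<lambda>N x. \<Sum>m<N. a m * sin (freq m * x)) v sequentially"
  shows "sine_coef v n = a n"
proof -
  have v: "continuous_on {0..1} v"
  proof (rule uniform_limit_theorem[OF _ lim])
    show "\<forall>\<^sub>F N in sequentially. continuous_on {0..1} (\<lambda>x. \<Sum>m<N. a m * sin (freq m * x))"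
      by (intro always_eventually allI continuous_intros)
  qed simp
  have "\<bar>sine_coef v n - a n\<bar> \<le> e" if "e > 0" for e :: real
  proof -
    have "\<forall>\<^sub>F N in sequentially. \<forall>x\<in>{0..1}. dist (\<Sum>m<N. a m * sin (freq m * x)) (v x) < e / 2"
      using uniform_limitD[OF lim, of "e / 2"] that by simp
    then have "\<forall>\<^sub>F N in sequentially. n < N \<and> (\<forall>x\<in>{0..1}. dist (\<Sum>m<N. a m * sin (freq m * x)) (v x) < e / 2)"
      by (intro eventually_conj eventually_gt_at_top)
    then have "\<exists>N. n < N \<and> (\<forall>x\<in>{0..1}. dist (\<Sum>m<N. a m * sin (freq m * x)) (v x) < e / 2)"
      by (rule eventually_happens'[OF sequentially_bot])
    then obtain N where N: "n < N" "\<And>x. x \<in> {0..1} \<Longrightarrow> dist (\<Sum>m<N. a m * sin (freq m * x)) (v x) < e / 2"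
      by auto
    have c: "continuous_on {0..1} (\<lambda>x. \<Sum>m<N. a m * sin (freq m * x))" by (intro continuous_intros)
    have "\<bar>sine_coef (\<lambda>x. v x - (\<Sum>m<N. a m * sin (freq m * x))) n\<bar> \<le> 2 * (e / 2)"
    proof (rule sine_coef_bound)
      show "continuous_on {0..1} (\<lambda>x. v x - (\<Sum>m<N. a m * sin (freq m * x)))"
        by (intro continuous_intros v)
      show "\<bar>v x - (\<Sum>m<N. a m * sin (freq m * x))\<bar> \<le> e / 2" if "x \<in> {0..1}" for x
        using N(2)[OF that] by (simp add: dist_real_def abs_minus_commute)
    qed
    then show ?thesis using sine_coef_diff[OF v c, of n] sine_coef_sine_poly[OF N(1), of a] by simp
  qed
  then have "\<bar>sine_coef v n - a n\<bar> \<le> 0" by (rule field_le_epsilon) simp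
  then show ?thesis by simp
qed

text \<open>
  The combination \<open>(q + f\<^sup>2 P) sin (f x)\<close> is the derivative of \<open>P' sin (f x) - f P cos (f x)\<close>, which
  vanishes at both ends.
\<close>

lemma sine_coef_second_derivative:
  assumes P: "\<And>x. x \<in> {0..1} \<Longrightarrow> (P has_real_derivative P' x) (at x within {0..1})"
    and P': "\<And>x. x \<in> {0..1} \<Longrightarrow> (P' has_real_derivative q x) (at x within {0..1})"
    and q: "continuous_on {0..1} q" and bc: "P 0 = 0" "P 1 = 0"
  shows "sine_coef q n = - (freq n)\<^sup>2 * sine_coef P n"
proof -
  define f where "f = freq n"
  have cP: "continuous_on {0..1} P" using P by (intro DERIV_continuous_on)
  have A: "((\<lambda>x. q x * sin (f * x) + f\<^sup>2 * (P x * sin (f * x))) has_integral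
      ((P' 1 * sin (f * 1) - f * P 1 * cos (f * 1)) - (P' 0 * sin (f * 0) - f * P 0 * cos (f * 0)))) {0..1}"
    by (intro fundamental_theorem_of_calculus)
       (auto intro!: derivative_eq_intros P P' simp: has_real_derivative_iff_has_vector_derivative[symmetric]
          algebra_simps power2_eq_square)
  have Z: "(P' 1 * sin (f * 1) - f * P 1 * cos (f * 1)) - (P' 0 * sin (f * 0) - f * P 0 * cos (f * 0)) = 0"
    using sin_freq_0_1[of n] bc by (simp add: f_def)
  have B: "((\<lambda>x. q x * sin (f * x) + f\<^sup>2 * (P x * sin (f * x))) has_integral
      (sine_coef q n / 2 + f\<^sup>2 * (sine_coef P n / 2))) {0..1}"
    unfolding f_def by (intro has_integral_add has_integral_mult_right sine_coef_has_integral q cP)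
  have "sine_coef q n / 2 + f\<^sup>2 * (sine_coef P n / 2) = 0"
    using has_integral_unique[OF B A] Z by simp
  then show ?thesis unfolding f_def by linarith
qed

lemma dirichlet_kernel_telescopes:
  "2 * sin (pi * z / 2) * (\<Sum>j<n. cos (freq j * z)) = sin ((real n + 1 / 2) * pi * z) - sin (pi * z / 2)"
proof (induction n)
  case (Suc n)
  have "2 * sin (pi * z / 2) * cos (freq n * z) = sin (pi * z / 2 + freq n * z) + sin (pi * z / 2 - freq n * z)"
    by (simp add: sin_add sin_diff)
  also have "\<dots> = sin ((real (Suc n) + 1 / 2) * pi * z) - sin ((real n + 1 / 2) * pi * z)"
  proof -
    have "pi * z / 2 + freq n * z = (real (Suc n) + 1 / 2) * pi * z"
      "pi * z / 2 - freq n * z = - ((real n + 1 / 2) * pi * z)"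
      by (simp_all add: freq_def algebra_simps)
    then show ?thesis by (simp only: sin_minus)
  qed
  finally show ?case using Suc by (simp add: distrib_left)
qed simp

text \<open>
  The kernel is at most \<open>n\<close> and, after telescoping, at most \<open>1 / r\<close>. The bound is a geometric mean
  of the two; unlike \<open>1 / r\<close> it is integrable in \<open>z\<close> near 0, at the price of a power \<open>n^\<epsilon>\<close>.
\<close>

lemma dirichlet_kernel_bound:
  assumes eps: "0 < \<epsilon>" "\<epsilon> < 1" and r: "0 < r" "r \<le> \<bar>sin (pi * z / 2)\<bar>"
  shows "\<bar>\<Sum>j<n. cos (freq j * z)\<bar> \<le> real n powr \<epsilon> * r powr (\<epsilon> - 1)"
proof -
  define D where "D = \<bar>\<Sum>j<n. cos (freq j * z)\<bar>"
  have "D \<le> (\<Sum>j<n. \<bar>cos (freq j * z)\<bar>)" unfolding D_def by (rule sum_abs)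
  also have "\<dots> \<le> (\<Sum>j<n. 1)" by (intro sum_mono) simp
  finally have Dn: "D \<le> real n" by simp
  have "2 * (\<bar>sin (pi * z / 2)\<bar> * D) = \<bar>sin ((real n + 1 / 2) * pi * z) - sin (pi * z / 2)\<bar>"
    unfolding D_def dirichlet_kernel_telescopes[symmetric] by (simp add: abs_mult)
  also have "\<dots> \<le> 1 + 1"
    by (intro order_trans[OF abs_triangle_ineq4] add_mono) auto
  finally have "\<bar>sin (pi * z / 2)\<bar> * D \<le> 1" by simp
  moreover have "r * D \<le> \<bar>sin (pi * z / 2)\<bar> * D"
    using r by (intro mult_right_mono) (auto simp: D_def)
  ultimately have "D \<le> 1 / r" using r by (simp add: pos_le_divide_eq mult.commute)
  show ?thesis
  proof (cases "D = 0")
    case True then show ?thesis by (simp add: D_def)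
  next
    case False
    then have D0: "0 < D" by (simp add: D_def)
    have "D = D powr \<epsilon> * D powr (1 - \<epsilon>)" using D0 by (simp add: powr_add[symmetric])
    also have "\<dots> \<le> real n powr \<epsilon> * (1 / r) powr (1 - \<epsilon>)"
      using eps D0 Dn \<open>D \<le> 1 / r\<close> by (intro mult_mono powr_mono2) auto
    also have "(1 / r) powr (1 - \<epsilon>) = r powr (\<epsilon> - 1)"
      using r by (simp add: powr_divide powr_minus_divide[symmetric] )
    finally show ?thesis by (simp add: D_def)
  qed
qed

text \<open>
  Jordan's inequality: the sine is concave on \<open>[0, \<pi>/2]\<close> and so lies above its chord.
\<close>

lemma abs_sin_half_pi_ge:
  assumes "\<bar>z\<bar> \<le> 1"
  shows "\<bar>z\<bar> \<le> \<bar>sin (pi * z / 2)\<bar>"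
proof -
  have pos: "w \<le> sin (pi * w / 2)" if w: "0 \<le> w" "w \<le> 1" for w :: real
  proof -
    have "concave_on {0..pi/2} sin"
    proof (rule f''_le0_imp_concave[where f' = cos and f'' = "\<lambda>x. - sin x"])
      show "- sin x \<le> 0" if "x \<in> {0..pi/2}" for x
      proof -
        have "x \<le> pi" using that pi_gt_zero unfolding atLeastAtMost_iff by linarith
        then show ?thesis using that sin_ge_zero[of x] by simp
      qed
    qed (auto intro!: derivative_eq_intros)
    from concave_onD[OF this, of w 0 "pi / 2"] show ?thesis using w by (simp add: mult.commute)
  qed
  have "\<bar>sin (pi * z / 2)\<bar> = \<bar>sin (pi * \<bar>z\<bar> / 2)\<bar>"
    by (cases "z \<ge> 0") auto
  then show ?thesis using pos[of "\<bar>z\<bar>"] assms by linarith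
qed

lemma singular_kernel_integral:
  fixes x \<epsilon> :: real
  assumes x: "x \<in> {0..1}" and eps: "0 < \<epsilon>"
  shows "((\<lambda>y. \<bar>x - y\<bar> powr (\<epsilon> - 1)) has_integral ((x powr \<epsilon> + (1 - x) powr \<epsilon>) / \<epsilon>)) {0..1}"
proof -
  have base: "((\<lambda>y. y powr (\<epsilon> - 1)) has_integral (c powr \<epsilon> / \<epsilon>)) {0..c}" if "0 \<le> c" for c :: real
    using has_integral_powr_from_0[of "\<epsilon> - 1" c] that eps by simp
  have "((\<lambda>y. (- 1 * y + x) powr (\<epsilon> - 1)) has_integral (x powr \<epsilon> / \<epsilon>)) {0..x}"
    using has_integral_affinity[of "\<lambda>y. y powr (\<epsilon> - 1)" "x powr \<epsilon> / \<epsilon>" 0 x "-1" x] base[of x] x by simp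
  then have 1: "((\<lambda>y. \<bar>x - y\<bar> powr (\<epsilon> - 1)) has_integral (x powr \<epsilon> / \<epsilon>)) {0..x}"
    by (rule has_integral_eq[rotated]) auto
  have "((\<lambda>y. (1 * y + - x) powr (\<epsilon> - 1)) has_integral ((1 - x) powr \<epsilon> / \<epsilon>)) {x..1}"
    using has_integral_affinity[of "\<lambda>y. y powr (\<epsilon> - 1)" "(1 - x) powr \<epsilon> / \<epsilon>" 0 "1 - x" 1 "- x"] base[of "1 - x"] x
    by simp
  then have 2: "((\<lambda>y. \<bar>x - y\<bar> powr (\<epsilon> - 1)) has_integral ((1 - x) powr \<epsilon> / \<epsilon>)) {x..1}"
    by (rule has_integral_eq[rotated]) auto
  show ?thesis
    using has_integral_combine[OF _ _ 1 2] x by (simp add: add_divide_distrib)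
qed

text \<open>
  A partial sum is the integral of \<open>h\<close> against \<open>D (x - y) - D (x + y)\<close> with the
  Dirichlet kernel \<open>D\<close>, and both terms are at most a multiple of \<open>\<bar>x - y\<bar> powr (\<epsilon> - 1)\<close>. For the
  second one this uses that \<open>x + y\<close> and \<open>2 - x - y\<close> are both at least \<open>\<bar>x - y\<bar>\<close> on the unit square,
  so that \<open>x + y\<close> is at least that far from the zeros 0 and 2 of the denominator.
\<close>

lemma sine_partial_sum_bound:
  assumes h: "continuous_on {0..1} h" and b: "\<And>y. y \<in> {0..1} \<Longrightarrow> \<bar>h y\<bar> \<le> B"
    and x: "x \<in> {0..1}" and eps: "0 < \<epsilon>" "\<epsilon> < 1"
  shows "\<bar>\<Sum>j<n. sine_coef h j * sin (freq j * x)\<bar> \<le> 4 / \<epsilon> * B * real n powr \<epsilon>"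
proof -
  define D where "D z = (\<Sum>j<n. cos (freq j * z))" for z
  have B0: "0 \<le> B" using b[OF x] by linarith
  define k where "k y = h y * (D (x - y) - D (x + y))" for y
  have "((\<lambda>y. \<Sum>j<n. 2 * sin (freq j * x) * (h y * sin (freq j * y))) has_integral
      (\<Sum>j<n. 2 * sin (freq j * x) * (sine_coef h j / 2))) {0..1}"
    by (intro has_integral_sum has_integral_mult_right sine_coef_has_integral h) auto
  moreover have "(\<Sum>j<n. 2 * sin (freq j * x) * (h y * sin (freq j * y))) = k y" for y
    unfolding k_def D_def sum_subtractf[symmetric] sum_distrib_left
    by (intro sum.cong) (simp_all add: algebra_simps cos_add cos_diff)
  ultimately have I: "(k has_integral (\<Sum>j<n. sine_coef h j * sin (freq j * x))) {0..1}"
    by (simp add: mult.commute)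
  define G where "G y = B * (2 * (real n powr \<epsilon> * \<bar>x - y\<bar> powr (\<epsilon> - 1)))" for y
  \<comment> \<open>At \<open>y = x\<close> the value of the power is 0 by convention, hence the exceptional point.\<close>
  define G' where "G' y = (if y = x then \<bar>k x\<bar> else G y)" for y
  have "(G has_integral B * (2 * (real n powr \<epsilon> * ((x powr \<epsilon> + (1 - x) powr \<epsilon>) / \<epsilon>)))) {0..1}"
    unfolding G_def by (intro has_integral_mult_right singular_kernel_integral x eps)
  then have G': "(G' has_integral B * (2 * (real n powr \<epsilon> * ((x powr \<epsilon> + (1 - x) powr \<epsilon>) / \<epsilon>)))) {0..1}"
    by (rule has_integral_spike_finite[of "{x}", rotated 2]) (auto simp: G'_def)
  have bd: "norm (k y) \<le> G' y" if y: "y \<in> {0..1}" for y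
  proof (cases "y = x")
    case False
    define r where "r = \<bar>x - y\<bar>"
    have r: "0 < r" using False by (simp add: r_def)
    have 1: "r \<le> \<bar>sin (pi * (x - y) / 2)\<bar>"
      unfolding r_def by (rule abs_sin_half_pi_ge) (use x y in auto)
    have 2: "r \<le> \<bar>sin (pi * (x + y) / 2)\<bar>"
    proof (cases "x + y \<le> 1")
      case True
      then show ?thesis using abs_sin_half_pi_ge[of "x + y"] x y by (auto simp: r_def)
    next
      case False
      have "pi * (2 - (x + y)) / 2 = pi - pi * (x + y) / 2" by (simp add: field_simps)
      then have "sin (pi * (2 - (x + y)) / 2) = sin (pi * (x + y) / 2)" by (simp only: sin_pi_minus)
      moreover have "\<bar>2 - (x + y)\<bar> \<le> \<bar>sin (pi * (2 - (x + y)) / 2)\<bar>"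
        by (rule abs_sin_half_pi_ge) (use False x y in auto)
      ultimately have "\<bar>2 - (x + y)\<bar> \<le> \<bar>sin (pi * (x + y) / 2)\<bar>" by simp
      then show ?thesis using x y unfolding r_def by (auto simp: abs_if split: if_splits)
    qed
    have "\<bar>D (x - y) - D (x + y)\<bar> \<le> \<bar>D (x - y)\<bar> + \<bar>D (x + y)\<bar>" by linarith
    also have "\<dots> \<le> 2 * (real n powr \<epsilon> * r powr (\<epsilon> - 1))"
      using dirichlet_kernel_bound[OF eps r 1, of n] dirichlet_kernel_bound[OF eps r 2, of n] unfolding D_def by linarith
    finally have "\<bar>h y\<bar> * \<bar>D (x - y) - D (x + y)\<bar> \<le> B * (2 * (real n powr \<epsilon> * r powr (\<epsilon> - 1)))"
      using b[OF y] B0 by (intro mult_mono) auto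
    then show ?thesis using False by (simp add: G'_def G_def k_def abs_mult r_def)
  qed (simp add: G'_def)
  have "norm (integral {0..1} k) \<le> integral {0..1} G'"
    by (rule integral_norm_bound_integral) (use I G' bd in \<open>auto simp: integrable_on_def\<close>)
  then have "\<bar>\<Sum>j<n. sine_coef h j * sin (freq j * x)\<bar> \<le>
      B * (2 * (real n powr \<epsilon> * ((x powr \<epsilon> + (1 - x) powr \<epsilon>) / \<epsilon>)))"
    using integral_unique[OF I] integral_unique[OF G'] by simp
  also have "\<dots> \<le> B * (2 * (real n powr \<epsilon> * ((1 + 1) / \<epsilon>)))"
  proof -
    have "x powr \<epsilon> \<le> 1" "(1 - x) powr \<epsilon> \<le> 1"
      using x eps powr_mono2[of \<epsilon> x 1] powr_mono2[of \<epsilon> "1 - x" 1] by auto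
    then show ?thesis using B0 eps by (intro mult_left_mono divide_right_mono add_mono) auto
  qed
  finally show ?thesis by (simp add: field_simps)
qed

text \<open>
  The functions \<open>w\<close> for which \<open>P w\<close> has zero sine coefficients are closed under multiplication by
  \<open>cos (\<pi> x)\<close>, because \<open>2 sin (n \<pi> x) cos (\<pi> x)\<close> is the sum of the two neighbouring sines.
\<close>

lemma orthogonal_to_bernstein:
  assumes P: "continuous_on {0..1} P" and z: "\<And>n. sine_coef P n = 0"
  shows "((\<lambda>x. P x * sin (freq n * x) * (((1 + cos (pi * x)) / 2) ^ k * (1 - (1 + cos (pi * x)) / 2) ^ m)) has_integral 0) {0..1}"
proof -
  have step: "((\<lambda>x. P x * sin (freq n * x) * (cos (pi * x) * w x)) has_integral 0) {0..1}"
    if w: "\<And>n. ((\<lambda>x. P x * sin (freq n * x) * w x) has_integral 0) {0..1}" for w :: "real \<Rightarrow> real" and n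
  proof -
    have up: "((\<lambda>x. P x * sin (freq n * x + pi * x) * w x) has_integral 0) {0..1}"
    proof -
      have "freq n * x + pi * x = freq (Suc n) * x" for x by (simp add: freq_def algebra_simps)
      then show ?thesis using w[of "Suc n"] by simp
    qed
    have down: "((\<lambda>x. P x * sin (freq n * x - pi * x) * w x) has_integral 0) {0..1}"
    proof (cases n)
      case 0
      then show ?thesis by (simp add: freq_def)
    next
      case (Suc l)
      then have "freq n * x - pi * x = freq l * x" for x by (simp add: freq_def algebra_simps)
      then show ?thesis using w[of l] by simp
    qed
    have "((\<lambda>x. (P x * sin (freq n * x + pi * x) * w x + P x * sin (freq n * x - pi * x) * w x) / 2)
        has_integral (0 + 0) / 2) {0..1}"
      by (intro has_integral_divide has_integral_add up down)
    moreover have "(P x * sin (freq n * x + pi * x) * w x + P x * sin (freq n * x - pi * x) * w x) / 2 =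
        P x * sin (freq n * x) * (cos (pi * x) * w x)" for x
      by (simp add: sin_add sin_diff algebra_simps)
    ultimately show ?thesis by simp
  qed
  have stepA: "((\<lambda>x. P x * sin (freq n * x) * (((1 + cos (pi * x)) / 2) * w x)) has_integral 0) {0..1}"
    and stepB: "((\<lambda>x. P x * sin (freq n * x) * ((1 - (1 + cos (pi * x)) / 2) * w x)) has_integral 0) {0..1}"
    if w: "\<And>n. ((\<lambda>x. P x * sin (freq n * x) * w x) has_integral 0) {0..1}" for w :: "real \<Rightarrow> real" and n
  proof -
    have "((\<lambda>x. (P x * sin (freq n * x) * w x + P x * sin (freq n * x) * (cos (pi * x) * w x)) / 2)
        has_integral (0 + 0) / 2) {0..1}"
      by (intro has_integral_divide has_integral_add w step)
    then show "((\<lambda>x. P x * sin (freq n * x) * (((1 + cos (pi * x)) / 2) * w x)) has_integral 0) {0..1}"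
      by (simp add: algebra_simps)
    have "((\<lambda>x. (P x * sin (freq n * x) * w x - P x * sin (freq n * x) * (cos (pi * x) * w x)) / 2)
        has_integral (0 - 0) / 2) {0..1}"
      by (intro has_integral_divide has_integral_diff w step)
    moreover have "(P x * sin (freq n * x) * w x - P x * sin (freq n * x) * (cos (pi * x) * w x)) / 2 =
        P x * sin (freq n * x) * ((1 - (1 + cos (pi * x)) / 2) * w x)" for x
      by (simp add: field_simps)
    ultimately show "((\<lambda>x. P x * sin (freq n * x) * ((1 - (1 + cos (pi * x)) / 2) * w x)) has_integral 0) {0..1}"
      by simp
  qed
  have base: "((\<lambda>x. P x * sin (freq n * x) * 1) has_integral 0) {0..1}" for n
    using sine_coef_has_integral[OF P, of n] z by simp
  have "((\<lambda>x. P x * sin (freq n * x) * (1 - (1 + cos (pi * x)) / 2) ^ m) has_integral 0) {0..1}" for n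
  proof (induction m arbitrary: n)
    case 0 show ?case using base by simp
  next
    case (Suc m) show ?case using stepB[OF Suc.IH] by simp
  qed
  note B = this
  show ?thesis
  proof (induction k arbitrary: n)
    case 0 show ?case using B by simp
  next
    case (Suc k) show ?case using stepA[OF Suc.IH] by (simp add: mult.assoc)
  qed
qed

text \<open>
  In the variable \<open>y = (1 + cos (\<pi> x)) / 2\<close>, which runs over the unit interval, \<open>P\<close> is a uniform limit of
  Bernstein polynomials, and \<open>P sin (\<pi> x)\<close> is orthogonal to each of them. Hence the integral of
  \<open>P\<^sup>2 sin (\<pi> x)\<close> vanishes, and with it \<open>P\<close> on the open interval.
\<close>

theorem sine_system_complete:
  assumes P: "continuous_on {0..1} P" and z: "\<And>n. sine_coef P n = 0" and x: "x \<in> {0..1}"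
  shows "P x = 0"
proof -
  define Y where "Y x = (1 + cos (pi * x)) / 2" for x
  define F where "F y = P (arccos (2 * y - 1) / pi)" for y
  have FY: "F (Y x) = P x" if "x \<in> {0..1}" for x
  proof -
    have "2 * Y x - 1 = cos (pi * x)" by (simp add: Y_def field_simps)
    then show ?thesis using that by (simp add: F_def arccos_cos mult_left_le)
  qed
  have F: "continuous_on {0..1} F"
    unfolding F_def
  proof (rule continuous_on_compose2[OF P])
    show "continuous_on {0..1} (\<lambda>y. arccos (2 * y - 1) / pi)"
      by (intro continuous_intros continuous_on_compose2[OF continuous_on_arccos']) auto
    show "(\<lambda>y. arccos (2 * y - 1) / pi) ` {0..1} \<subseteq> {0..1}"
      using arccos_lbound arccos_ubound by (auto simp: divide_le_eq_1)
  qed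
  obtain M where M: "\<And>x. x \<in> {0..1} \<Longrightarrow> \<bar>P x\<bar> \<le> M"
    using compact_imp_bounded[OF compact_continuous_image[OF P compact_Icc]]
    unfolding bounded_iff by (metis imageI real_norm_def)
  have M0: "0 \<le> M" using M[of 0] by auto
  have Pint: "(\<lambda>x. (P x)\<^sup>2 * sin (pi * x)) integrable_on {0..1}"
    by (intro integrable_continuous_interval continuous_intros P)
  have sinpos: "0 \<le> sin (pi * x)" if "x \<in> {0..1}" for x :: real
    using that by (intro sin_ge_zero) (auto simp: mult_left_le)
  have "integral {0..1} (\<lambda>x. (P x)\<^sup>2 * sin (pi * x)) \<le> e" if e: "0 < e" for e
  proof -
    define e' where "e' = e / (M + 1)"
    have e': "0 < e'" using e M0 by (simp add: e'_def)
    obtain N where N: "\<And>y. y \<in> {0..1} \<Longrightarrow> \<bar>F y - (\<Sum>k\<le>N. F (k / N) * Bernstein N k y)\<bar> < e'"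
      using Bernstein_Weierstrass[OF F e'] by blast
    let ?B = "\<lambda>y. \<Sum>k\<le>N. F (k / N) * Bernstein N k y"
    have "((\<lambda>x. \<Sum>k\<le>N. F (k / N) * real (N choose k) *
        (P x * sin (freq 0 * x) * (((1 + cos (pi * x)) / 2) ^ k * (1 - (1 + cos (pi * x)) / 2) ^ (N - k))))
        has_integral (\<Sum>k\<le>N. F (k / N) * real (N choose k) * 0)) {0..1}"
      by (intro has_integral_sum has_integral_mult_right orthogonal_to_bernstein P z) auto
    moreover have "(\<Sum>k\<le>N. F (k / N) * real (N choose k) *
        (P x * sin (freq 0 * x) * (((1 + cos (pi * x)) / 2) ^ k * (1 - (1 + cos (pi * x)) / 2) ^ (N - k))))
       = P x * sin (pi * x) * ?B (Y x)" for x
      unfolding sum_distrib_left by (intro sum.cong) (simp_all add: Bernstein_def Y_def freq_def mult_ac)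
    ultimately have "((\<lambda>x. P x * sin (pi * x) * ?B (Y x)) has_integral 0) {0..1}" by simp
    from has_integral_diff[OF integrable_integral[OF Pint] this]
    have D: "((\<lambda>x. (P x)\<^sup>2 * sin (pi * x) - P x * sin (pi * x) * ?B (Y x)) has_integral
        integral {0..1} (\<lambda>x. (P x)\<^sup>2 * sin (pi * x))) {0..1}" by simp
    have "((\<lambda>x::real. e) has_integral e) {0..1}"
      using has_integral_const_real[of e 0 1] by simp
    from D this show ?thesis
    proof (rule has_integral_le)
      fix x :: real assume x: "x \<in> {0..1}"
      define c where "c = cos (pi * x)"
      have "- 1 \<le> c" "c \<le> 1" by (simp_all add: c_def)
      then have Yx: "Y x \<in> {0..1}"
        unfolding Y_def c_def[symmetric] by simp
      have "(P x)\<^sup>2 * sin (pi * x) - P x * sin (pi * x) * ?B (Y x) = P x * sin (pi * x) * (F (Y x) - ?B (Y x))"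
        using FY[OF x] by (simp add: power2_eq_square right_diff_distrib)
      also have "\<dots> \<le> \<bar>P x\<bar> * \<bar>sin (pi * x)\<bar> * \<bar>F (Y x) - ?B (Y x)\<bar>"
        using abs_ge_self[of "P x * sin (pi * x) * (F (Y x) - ?B (Y x))"] by (simp only: abs_mult)
      also have "\<dots> \<le> M * 1 * e'"
        using M[OF x] N[OF Yx] M0 by (intro mult_mono) auto
      also have "\<dots> \<le> e" using e M0 by (simp add: e'_def field_simps)
      finally show "(P x)\<^sup>2 * sin (pi * x) - P x * sin (pi * x) * ?B (Y x) \<le> e" .
    qed
  qed
  then have "integral {0..1} (\<lambda>x. (P x)\<^sup>2 * sin (pi * x)) \<le> 0" by (rule field_le_epsilon) simp
  moreover have "0 \<le> integral {0..1} (\<lambda>x. (P x)\<^sup>2 * sin (pi * x))"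
    by (rule integral_nonneg[OF Pint]) (simp add: sinpos)
  ultimately have "((\<lambda>x. (P x)\<^sup>2 * sin (pi * x)) has_integral 0) (cbox 0 1)"
    using integrable_integral[OF Pint] by simp
  moreover have "continuous_on {0..1} (\<lambda>x. (P x)\<^sup>2 * sin (pi * x))"
    by (intro continuous_intros P)
  ultimately have zero: "(P x)\<^sup>2 * sin (pi * x) = 0" if "x \<in> {0..1}" for x
    using has_integral_0_cbox_imp_0[of 0 1 "\<lambda>x. (P x)\<^sup>2 * sin (pi * x)" x] that sinpos by auto
  have inner: "P x = 0" if "x \<in> {0<..<1}" for x
  proof -
    have "0 < sin (pi * x)" using that by (intro sin_gt_zero) auto
    then show ?thesis using zero[of x] that by auto
  qed
  have "closure {0<..<1::real} = {0..1}" by simp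
  then show ?thesis
    using continuous_constant_on_closure[of "{0<..<1}" P 0 x] P inner x by simp
qed

section \<open>Periodic solutions of a scalar linear equation\<close>

text \<open>
  The \<open>\<omega>\<close>-periodic solution of \<open>v' = \<phi> - l v\<close>. The denominator sums the geometric series that arises
  when the integral of \<open>exp (- l s) \<phi> (t - s)\<close> over all \<open>s \<ge> 0\<close> is folded to one period.
\<close>

definition periodic_response :: "real \<Rightarrow> real \<Rightarrow> (real \<Rightarrow> real) \<Rightarrow> real \<Rightarrow> real" where
  "periodic_response l \<omega> \<phi> t =
     integral {0..\<omega>} (\<lambda>s. exp (- l * s) * \<phi> (t - s)) / (1 - exp (- l * \<omega>))"

lemma exp_integral:
  assumes "0 < l" "0 < (\<omega>::real)"
  shows "((\<lambda>s. exp (- l * s)) has_integral ((1 - exp (- l * \<omega>)) / l)) {0..\<omega>}"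
proof -
  have "((\<lambda>s. exp (- l * s)) has_integral (- exp (- l * \<omega>) / l - (- exp (- l * 0) / l))) {0..\<omega>}"
    using assms
    by (intro fundamental_theorem_of_calculus)
       (auto intro!: derivative_eq_intros simp: has_real_derivative_iff_has_vector_derivative[symmetric])
  then show ?thesis by (simp add: diff_divide_distrib)
qed

lemma continuous_shift:
  assumes "continuous_on UNIV \<phi>"
  shows "continuous_on A (\<lambda>s. \<phi> (t - s :: real))"
  by (rule continuous_on_compose2[OF assms]) (auto intro!: continuous_intros)

lemma response_has_integral:
  assumes "continuous_on UNIV \<phi>"
  shows "((\<lambda>s. exp (- l * s) / (1 - exp (- l * \<omega>)) * \<phi> (t - s)) has_integral
     periodic_response l \<omega> \<phi> t) {0..\<omega>}"
proof -
  have "((\<lambda>s. exp (- l * s) * \<phi> (t - s)) has_integral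
      integral {0..\<omega>} (\<lambda>s. exp (- l * s) * \<phi> (t - s))) {0..\<omega>}"
    by (intro integrable_integral integrable_continuous_interval continuous_intros continuous_shift assms)
  from has_integral_divide[OF this, of "1 - exp (- l * \<omega>)"] show ?thesis
    by (simp add: periodic_response_def)
qed

lemma response_diff:
  assumes "continuous_on UNIV \<phi>" "continuous_on UNIV \<psi>"
  shows "periodic_response l \<omega> (\<lambda>t. \<phi> t - \<psi> t) t = periodic_response l \<omega> \<phi> t - periodic_response l \<omega> \<psi> t"
proof -
  have A: "((\<lambda>s. exp (- l * s) / (1 - exp (- l * \<omega>)) * (\<phi> (t - s) - \<psi> (t - s))) has_integral
      periodic_response l \<omega> \<phi> t - periodic_response l \<omega> \<psi> t) {0..\<omega>}"
    using has_integral_diff[OF response_has_integral[OF assms(1)] response_has_integral[OF assms(2)]]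
    by (simp add: right_diff_distrib)
  have B: "((\<lambda>s. exp (- l * s) / (1 - exp (- l * \<omega>)) * (\<phi> (t - s) - \<psi> (t - s))) has_integral
      periodic_response l \<omega> (\<lambda>t. \<phi> t - \<psi> t) t) {0..\<omega>}"
    by (rule response_has_integral) (intro continuous_intros assms)
  show ?thesis by (rule has_integral_unique[OF B A])
qed

lemma response_kernel_integral:
  assumes l: "0 < l" and w: "0 < (\<omega>::real)"
  shows "((\<lambda>s. exp (- l * s) / (1 - exp (- l * \<omega>))) has_integral (1 / l)) {0..\<omega>}"
proof -
  have "exp (- l * \<omega>) \<noteq> 1" using l w by simp
  then show ?thesis
    using has_integral_divide[OF exp_integral[OF l w], of "1 - exp (- l * \<omega>)"] by simp
qed

lemma response_bound:
  assumes l: "0 < l" and w: "0 < \<omega>" and c: "continuous_on UNIV \<phi>"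
    and b: "\<And>t. \<bar>\<phi> t\<bar> \<le> B"
  shows "\<bar>periodic_response l \<omega> \<phi> t\<bar> \<le> B / l"
proof -
  have den: "0 < 1 - exp (- l * \<omega>)" using l w by simp
  have "norm (periodic_response l \<omega> \<phi> t) \<le>
      integral {0..\<omega>} (\<lambda>s. exp (- l * s) / (1 - exp (- l * \<omega>)) * B)"
    unfolding integral_unique[OF response_has_integral[OF c], symmetric]
  proof (rule integral_norm_bound_integral)
    fix s :: real
    have "exp (- l * s) / (1 - exp (- l * \<omega>)) * \<bar>\<phi> (t - s)\<bar> \<le> exp (- l * s) / (1 - exp (- l * \<omega>)) * B"
      by (rule mult_left_mono[OF b]) (use den in auto)
    then show "norm (exp (- l * s) / (1 - exp (- l * \<omega>)) * \<phi> (t - s)) \<le> exp (- l * s) / (1 - exp (- l * \<omega>)) * B"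
      using den by (simp add: abs_mult)
  qed (use response_has_integral[OF c] has_integral_mult_left[OF response_kernel_integral[OF l w], of B]
        in \<open>auto simp: integrable_on_def\<close>)
  also have "\<dots> = 1 / l * B"
    by (rule integral_unique[OF has_integral_mult_left[OF response_kernel_integral[OF l w]]])
  finally show ?thesis by simp
qed

text \<open>
  The contraction estimate in the Euclidean norm. Pair the response vector \<open>c\<close> with itself: its squared
  norm is an integral of \<open>\<Sum> c n * \<phi> n (t - s)\<close> with positive weights that decrease in \<open>l n\<close>, so
  that all weights may be replaced by the one for \<open>l0\<close>, whose integral is \<open>1 / l0\<close>.
\<close>

lemma response_vector_bound:
  fixes N :: nat
  assumes l0: "0 < l0" and w: "0 < \<omega>" and l: "\<And>n. n < N \<Longrightarrow> l0 \<le> l n"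
    and cont: "\<And>n. continuous_on UNIV (\<phi> n)" and B: "0 \<le> B"
    and b: "\<And>t. (\<Sum>n<N. (\<phi> n t)\<^sup>2) \<le> B\<^sup>2"
  shows "(\<Sum>n<N. (periodic_response (l n) \<omega> (\<phi> n) t)\<^sup>2) \<le> (B / l0)\<^sup>2"
proof -
  define c where "c n = periodic_response (l n) \<omega> (\<phi> n) t" for n
  define E where "E = (\<Sum>n<N. (c n)\<^sup>2)"
  define k where "k l s = exp (- l * s) / (1 - exp (- l * \<omega>))" for l s
  have E0: "0 \<le> E" by (simp add: E_def sum_nonneg)
  have mono: "0 \<le> k (l n) s \<and> k (l n) s \<le> k l0 s" if "n < N" "s \<in> {0..\<omega>}" for n s
  proof -
    have "0 < 1 - exp (- l0 * \<omega>)" "0 < 1 - exp (- l n * \<omega>)" using l[OF that(1)] l0 w by auto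
    moreover have "exp (- l n * s) \<le> exp (- l0 * s)" "exp (- l n * \<omega>) \<le> exp (- l0 * \<omega>)"
      using l[OF that(1)] that w by (auto intro: mult_right_mono)
    ultimately show ?thesis unfolding k_def by (auto intro!: frac_le)
  qed
  have "((\<lambda>s. \<Sum>n<N. c n * (k (l n) s * \<phi> n (t - s))) has_integral (\<Sum>n<N. c n * c n)) {0..\<omega>}"
    unfolding k_def c_def by (intro has_integral_sum has_integral_mult_right response_has_integral cont) simp
  moreover have "((\<lambda>s. k l0 s * (sqrt E * B)) has_integral (1 / l0 * (sqrt E * B))) {0..\<omega>}"
    unfolding k_def by (intro has_integral_mult_left response_kernel_integral l0 w)
  ultimately have "(\<Sum>n<N. c n * c n) \<le> 1 / l0 * (sqrt E * B)"
  proof (rule has_integral_le)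
    fix s assume s: "s \<in> {0..\<omega>}"
    have "(\<Sum>n<N. c n * (k (l n) s * \<phi> n (t - s))) \<le> (\<Sum>n<N. k l0 s * (\<bar>c n\<bar> * \<bar>\<phi> n (t - s)\<bar>))"
    proof (rule sum_mono)
      fix n assume n: "n \<in> {..<N}"
      have "c n * (k (l n) s * \<phi> n (t - s)) \<le> k (l n) s * (\<bar>c n\<bar> * \<bar>\<phi> n (t - s)\<bar>)"
        using mono[of n s] n s abs_ge_self[of "c n * \<phi> n (t - s)"]
        by (simp add: mult.left_commute[of "c n"] abs_mult mult_left_mono)
      also have "\<dots> \<le> k l0 s * (\<bar>c n\<bar> * \<bar>\<phi> n (t - s)\<bar>)"
        using mono[of n s] n s by (intro mult_right_mono) auto
      finally show "c n * (k (l n) s * \<phi> n (t - s)) \<le> k l0 s * (\<bar>c n\<bar> * \<bar>\<phi> n (t - s)\<bar>)" .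
    qed
    also have "\<dots> = k l0 s * (\<Sum>n<N. \<bar>c n\<bar> * \<bar>\<phi> n (t - s)\<bar>)" by (simp add: sum_distrib_left)
    also have "\<dots> \<le> k l0 s * (sqrt E * B)"
    proof (rule mult_left_mono)
      have "(\<Sum>n<N. \<bar>c n\<bar> * \<bar>\<phi> n (t - s)\<bar>) \<le> L2_set c {..<N} * L2_set (\<lambda>n. \<phi> n (t - s)) {..<N}"
        by (rule L2_set_mult_ineq)
      also have "\<dots> \<le> sqrt E * B"
        unfolding L2_set_def E_def
        by (intro mult_left_mono real_le_lsqrt b B) (auto simp: sum_nonneg)
      finally show "(\<Sum>n<N. \<bar>c n\<bar> * \<bar>\<phi> n (t - s)\<bar>) \<le> sqrt E * B" .
      show "0 \<le> k l0 s" unfolding k_def using l0 w by (simp)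
    qed
    finally show "(\<Sum>n<N. c n * (k (l n) s * \<phi> n (t - s))) \<le> k l0 s * (sqrt E * B)" .
  qed
  then have le: "sqrt E * sqrt E \<le> sqrt E * (B / l0)"
    using E0 by (simp add: E_def power2_eq_square mult_ac)
  have "sqrt E \<le> B / l0"
  proof (cases "E = 0")
    case True
    then show ?thesis using B l0 by simp
  next
    case False
    then have "0 < sqrt E" using E0 by simp
    then show ?thesis using le mult_le_cancel_left_pos by blast
  qed
  then have "(sqrt E)\<^sup>2 \<le> (B / l0)\<^sup>2" using E0 by (intro power_mono) auto
  then show ?thesis using E0 by (simp add: E_def c_def)
qed

text \<open>
  Near \<open>t\<close>, the response is \<open>exp (- l r) (g r - g (r - \<omega>))\<close> up to a constant factor, where \<open>g\<close> is an
  antiderivative of \<open>exp (l r) \<phi> r\<close>.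
\<close>

lemma response_has_derivative:
  assumes l: "0 < l" and w: "0 < \<omega>" and c: "continuous_on UNIV \<phi>"
    and per: "\<And>t. \<phi> (t + \<omega>) = \<phi> t"
  shows "(periodic_response l \<omega> \<phi> has_real_derivative (\<phi> t - l * periodic_response l \<omega> \<phi> t)) (at t)"
proof -
  define I where "I = {t - \<omega> - 1..t + 1}"
  define d where "d = 1 - exp (- l * \<omega>)"
  have d: "d \<noteq> 0" using l w by (simp add: d_def)
  obtain g where g: "\<And>r. r \<in> I \<Longrightarrow> (g has_vector_derivative (exp (l * r) * \<phi> r)) (at r within I)"
    unfolding I_def
    by (rule antiderivative_continuous[of "t - \<omega> - 1" "t + 1" "\<lambda>r. exp (l * r) * \<phi> r"])
       (auto intro!: continuous_intros continuous_on_subset[OF c])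
  have g': "(g has_real_derivative (exp (l * r) * \<phi> r)) (at r)" if "t - \<omega> - 1 < r" "r < t + 1" for r
  proof -
    have "at r within I = at r"
      by (rule at_within_interior) (use that in \<open>auto simp: I_def interior_atLeastAtMost_real\<close>)
    then show ?thesis using g[of r] that by (auto simp: I_def has_real_derivative_iff_has_vector_derivative)
  qed
  have eq: "periodic_response l \<omega> \<phi> r = exp (- l * r) * (g r - g (r - \<omega>)) / d"
    if r: "r \<in> {t - 1<..<t + 1}" for r
  proof -
    have "((\<lambda>s. exp (- l * s) * \<phi> (r - s)) has_integral
        (- exp (- l * r) * g (r - \<omega>) - (- exp (- l * r) * g (r - 0)))) {0..\<omega>}"
    proof (rule fundamental_theorem_of_calculus)
      fix s assume s: "s \<in> {0..\<omega>}"
      have "((\<lambda>s. - exp (- l * r) * g (r - s)) has_real_derivative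
          - exp (- l * r) * (exp (l * (r - s)) * \<phi> (r - s) * (0 - 1))) (at s)"
        by (intro DERIV_cmult DERIV_chain2[OF g'] derivative_intros) (use r s in auto)
      also have "- exp (- l * r) * (exp (l * (r - s)) * \<phi> (r - s) * (0 - 1)) = exp (- l * s) * \<phi> (r - s)"
      proof -
        have "exp (- l * r) * exp (l * (r - s)) = exp (- l * s)"
          by (simp add: exp_add[symmetric] algebra_simps)
        then show ?thesis by (simp add: mult.assoc[symmetric])
      qed
      finally show "((\<lambda>s. - exp (- l * r) * g (r - s)) has_vector_derivative exp (- l * s) * \<phi> (r - s)) (at s within {0..\<omega>})"
        by (simp add: has_real_derivative_iff_has_vector_derivative has_vector_derivative_at_within)
    qed (use w in simp)
    then show ?thesis
      unfolding periodic_response_def d_def by (simp add: integral_unique algebra_simps)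
  qed
  have g1: "(g has_real_derivative (exp (l * t) * \<phi> t)) (at t)"
    by (rule g') (use w in auto)
  have g2: "((\<lambda>r. g (r - \<omega>)) has_real_derivative (exp (l * (t - \<omega>)) * \<phi> (t - \<omega>) * (1 - 0))) (at t)"
    by (intro DERIV_chain2[OF g'] derivative_intros) (use w in auto)
  have e: "((\<lambda>r. exp (- l * r)) has_real_derivative (exp (- l * t) * (- l))) (at t)"
    by (auto intro!: derivative_eq_intros)
  note DERIV_cdivide[OF DERIV_mult[OF e DERIV_diff[OF g1 g2]], of d]
  moreover have "(exp (- l * t) * (- l) * (g t - g (t - \<omega>)) + (exp (l * t) * \<phi> t - exp (l * (t - \<omega>)) * \<phi> (t - \<omega>) * (1 - 0)) * exp (- l * t)) / d
     = \<phi> t - l * periodic_response l \<omega> \<phi> t"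
  proof -
    have 1: "\<phi> (t - \<omega>) = \<phi> t" using per[of "t - \<omega>"] by simp
    have 2: "exp (l * t) * exp (- l * t) = 1" "exp (l * (t - \<omega>)) * exp (- l * t) = 1 - d"
      by (simp_all add: exp_add[symmetric] d_def algebra_simps)
    have "(exp (l * t) * \<phi> t - exp (l * (t - \<omega>)) * \<phi> (t - \<omega>) * (1 - 0)) * exp (- l * t)
       = \<phi> t * (exp (l * t) * exp (- l * t)) - \<phi> t * (exp (l * (t - \<omega>)) * exp (- l * t))"
      unfolding 1 by (simp add: algebra_simps)
    also have "\<dots> = \<phi> t * d" unfolding 2 by (simp add: algebra_simps)
    finally have num: "(exp (l * t) * \<phi> t - exp (l * (t - \<omega>)) * \<phi> (t - \<omega>) * (1 - 0)) * exp (- l * t) = \<phi> t * d" .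
    define G where "G = exp (- l * t) * (g t - g (t - \<omega>))"
    have A: "exp (- l * t) * (- l) * (g t - g (t - \<omega>)) = - l * G" by (simp add: G_def)
    have B: "periodic_response l \<omega> \<phi> t = G / d" using eq[of t] by (simp add: G_def)
    show ?thesis unfolding num A B using d by (simp add: field_simps)
  qed
  ultimately have "((\<lambda>r. exp (- l * r) * (g r - g (r - \<omega>)) / d) has_real_derivative
      (\<phi> t - l * periodic_response l \<omega> \<phi> t)) (at t)" by (simp only:)
  then show ?thesis
    by (rule has_field_derivative_transform_within_open[of _ _ _ "{t - 1<..<t + 1}"]) (auto simp: eq)
qed

lemma response_periodic:
  assumes "\<And>t. \<phi> (t + \<omega>) = \<phi> t"
  shows "periodic_response l \<omega> \<phi> (t + \<omega>) = periodic_response l \<omega> \<phi> t"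
proof -
  have "\<phi> (t + \<omega> - s) = \<phi> (t - s)" for s
    using assms[of "t - s"] by (simp add: algebra_simps)
  then show ?thesis by (simp add: periodic_response_def)
qed

text \<open>
  The integral form of the derivative of the response. Its integrand contains differences of \<open>\<phi>\<close>,
  so that Hoelder continuity of \<open>\<phi>\<close> compensates the factor \<open>l\<close>.
\<close>

lemma response_derivative_integral:
  assumes l: "0 < l" and w: "0 < \<omega>" and c: "continuous_on UNIV \<phi>"
  shows "((\<lambda>s. l * exp (- l * s) * (\<phi> t - \<phi> (t - s))) has_integral
     ((1 - exp (- l * \<omega>)) * (\<phi> t - l * periodic_response l \<omega> \<phi> t))) {0..\<omega>}"
proof -
  define d where "d = 1 - exp (- l * \<omega>)"
  have d: "d \<noteq> 0" using l w by (simp add: d_def)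
  have "((\<lambda>s. exp (- l * s) * (l * \<phi> t) - l * d * (exp (- l * s) / d * \<phi> (t - s))) has_integral
     ((1 - exp (- l * \<omega>)) / l * (l * \<phi> t) - l * d * periodic_response l \<omega> \<phi> t)) {0..\<omega>}"
    unfolding d_def
    by (intro has_integral_diff has_integral_mult_right has_integral_mult_left exp_integral response_has_integral l w c)
  moreover have "exp (- l * s) * (l * \<phi> t) - l * d * (exp (- l * s) / d * \<phi> (t - s)) = l * exp (- l * s) * (\<phi> t - \<phi> (t - s))" for s
    using d by (simp add: field_simps)
  moreover have "(1 - exp (- l * \<omega>)) / l * (l * \<phi> t) - l * d * periodic_response l \<omega> \<phi> t =
      (1 - exp (- l * \<omega>)) * (\<phi> t - l * periodic_response l \<omega> \<phi> t)"
    using l by (simp add: d_def field_simps)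
  ultimately show ?thesis by simp
qed

section \<open>The spectrum and the smoothing estimate\<close>

definition eigenvalue :: "real \<Rightarrow> nat \<Rightarrow> real" where
  "eigenvalue \<gamma> n = \<gamma> * freq n ^ 4 + (freq n)\<^sup>2 - 1"

lemma pi_squared_ge_1: "1 \<le> pi\<^sup>2"
proof -
  have "1 \<le> pi" using pi_gt3 by linarith
  then show ?thesis by (simp add: one_le_power)
qed

lemma freq_squared_ge_1: "1 \<le> (freq n)\<^sup>2"
proof -
  have "1 \<le> (real (Suc n))\<^sup>2" by (rule one_le_power) simp
  from mult_mono[OF this pi_squared_ge_1] show ?thesis by (simp add: freq_def power_mult_distrib)
qed

lemma eigenvalue_ge_fourth_power:
  "\<gamma> * pi ^ 4 * real (Suc n) ^ 4 \<le> eigenvalue \<gamma> n"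
  using freq_squared_ge_1[of n]
  by (simp add: eigenvalue_def freq_def power_mult_distrib mult_ac)

lemma eigenvalue_pos: "0 < \<gamma> \<Longrightarrow> 0 < eigenvalue \<gamma> n"
  using eigenvalue_ge_fourth_power[of \<gamma> n] by (smt (verit) mult_pos_pos of_nat_0_less_iff pi_gt_zero zero_less_Suc zero_less_power)

lemma eigenvalue_mono:
  assumes "0 < \<gamma>" "n \<le> m"
  shows "eigenvalue \<gamma> n \<le> eigenvalue \<gamma> m"
proof -
  have "freq n \<le> freq m" using assms by (simp add: freq_def)
  then show ?thesis unfolding eigenvalue_def
    using assms freq_pos[of n] by (intro diff_right_mono add_mono mult_left_mono power_mono) auto
qed

lemma eigenvalue_0: "eigenvalue \<gamma> 0 = \<gamma> * pi ^ 4 + pi\<^sup>2 - 1"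
  by (simp add: eigenvalue_def freq_def)

text \<open>
  The cubic growth of the gaps is what summation by parts against \<open>symbol_increment\<close> needs.
\<close>

lemma eigenvalue_increment:
  assumes "0 < \<gamma>"
  shows "eigenvalue \<gamma> (Suc n) - eigenvalue \<gamma> n \<le> (15 * \<gamma> * pi ^ 4 + 3 * pi\<^sup>2) * real (Suc n) ^ 3"
proof -
  define N where "N = real (Suc n)"
  have N: "1 \<le> N" by (simp add: N_def)
  have N3: "N ^ 2 \<le> N ^ 3" "N \<le> N ^ 3" "1 \<le> N ^ 3"
    using N power_increasing[of 2 3 N] power_increasing[of 1 3 N] power_increasing[of 0 3 N] by auto
  have "(N + 1) ^ 4 - N ^ 4 = 4 * N ^ 3 + 6 * N ^ 2 + 4 * N + 1"
    by (simp add: power4_eq_xxxx power3_eq_cube power2_eq_square algebra_simps)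
  then have 4: "(N + 1) ^ 4 - N ^ 4 \<le> 15 * N ^ 3" using N3 by linarith
  have "(N + 1)\<^sup>2 - N\<^sup>2 = 2 * N + 1" by (simp add: power2_eq_square algebra_simps)
  then have 2: "(N + 1)\<^sup>2 - N\<^sup>2 \<le> 3 * N ^ 3" using N3 by linarith
  have "eigenvalue \<gamma> (Suc n) - eigenvalue \<gamma> n = \<gamma> * pi ^ 4 * ((N + 1) ^ 4 - N ^ 4) + pi\<^sup>2 * ((N + 1)\<^sup>2 - N\<^sup>2)"
  proof -
    have "freq (Suc n) = (N + 1) * pi" "freq n = N * pi" by (simp_all add: freq_def N_def)
    then show ?thesis by (simp add: eigenvalue_def power_mult_distrib right_diff_distrib)
  qed
  also have "\<dots> \<le> \<gamma> * pi ^ 4 * (15 * N ^ 3) + pi\<^sup>2 * (3 * N ^ 3)"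
    using 4 2 assms by (intro add_mono mult_left_mono) auto
  finally show ?thesis by (simp add: N_def algebra_simps)
qed

lemma powr_le_one_plus_square:
  fixes y \<epsilon> :: real
  assumes "0 < y" "0 \<le> \<epsilon>" "\<epsilon> \<le> 1"
  shows "y powr (1 + \<epsilon>) \<le> 1 + y\<^sup>2"
proof (cases "y \<le> 1")
  case True
  then have "y powr (1 + \<epsilon>) \<le> 1" using assms powr_mono2[of "1 + \<epsilon>" y 1] by simp
  then show ?thesis by (smt (verit) zero_le_power2)
next
  case False
  then have "y powr (1 + \<epsilon>) \<le> y powr 2" using assms by (intro powr_mono) auto
  then show ?thesis using assms by (simp add: powr_numeral)
qed

text \<open>
  These are estimates of \<open>y powr (1 + \<epsilon>) * (1 + y) * exp (- y)\<close> by a constant that is uniform in \<open>\<epsilon>\<close>.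
\<close>

lemma powr_exp_bound:
  fixes y \<epsilon> :: real
  assumes "0 < y" "0 \<le> \<epsilon>" "\<epsilon> \<le> 1"
  shows "(1 + y) * exp (- y) \<le> 16 * y powr (- 1 - \<epsilon>)" "exp (- y) \<le> 16 * y powr (- 1 - \<epsilon>)"
proof -
  have a: "1 + y \<le> 2 * exp (y / 2)" using exp_ge_add_one_self[of "y / 2"] assms by linarith
  have "1 + y / 2 + (y / 2)\<^sup>2 / 2 \<le> exp (y / 2)" by (rule exp_lower_Taylor_quadratic) (use assms in simp)
  then have b: "1 + y\<^sup>2 \<le> 8 * exp (y / 2)" using assms by (simp add: power_divide)
  have "(1 + y) * y powr (1 + \<epsilon>) \<le> (2 * exp (y / 2)) * (8 * exp (y / 2))"
    using a order_trans[OF powr_le_one_plus_square[OF assms] b] assms by (intro mult_mono) auto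
  also have "\<dots> = 16 * exp y" by (simp add: exp_add[symmetric])
  finally have "(1 + y) * y powr (1 + \<epsilon>) \<le> 16 * exp y" .
  then show 1: "(1 + y) * exp (- y) \<le> 16 * y powr (- 1 - \<epsilon>)"
  proof -
    assume *: "(1 + y) * y powr (1 + \<epsilon>) \<le> 16 * exp y"
    define z where "z = y powr (1 + \<epsilon>)"
    have z: "0 < z" using assms by (simp add: z_def)
    have eq: "y powr (- 1 - \<epsilon>) = 1 / z"
      using powr_minus_divide[of y "1 + \<epsilon>"] by (simp add: z_def)
    show ?thesis unfolding eq using * z unfolding z_def[symmetric] by (simp add: exp_minus field_simps)
  qed
  have "1 * exp (- y) \<le> (1 + y) * exp (- y)" using assms by (intro mult_right_mono) auto
  from order_trans[OF this 1] show "exp (- y) \<le> 16 * y powr (- 1 - \<epsilon>)" by simp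
qed

text \<open>
  The mean value theorem for \<open>z exp (- z s)\<close>, whose derivative is \<open>(1 - z s) exp (- z s)\<close>.
\<close>

lemma symbol_increment:
  fixes a b s \<epsilon> :: real
  assumes "0 < a" "a \<le> b" "0 < s" "0 \<le> \<epsilon>" "\<epsilon> \<le> 1"
  shows "\<bar>a * exp (- a * s) - b * exp (- b * s)\<bar> \<le> 16 * (b - a) * (a * s) powr (- 1 - \<epsilon>)"
proof -
  define f' where "f' z = (1 - z * s) * exp (- z * s)" for z
  have "norm (b * exp (- b * s) - a * exp (- a * s)) \<le> (16 * (a * s) powr (- 1 - \<epsilon>)) * norm (b - a)"
  proof (rule field_differentiable_bound[of "{a..b}" _ f'])
    show "((\<lambda>z. z * exp (- z * s)) has_field_derivative f' z) (at z within {a..b})" for z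
      by (auto intro!: derivative_eq_intros simp: f'_def algebra_simps)
    fix z assume z: "z \<in> {a..b}"
    then have y: "0 < z * s" using assms by auto
    have "\<bar>1 - z * s\<bar> \<le> 1 + z * s" using y by linarith
    then have "norm (f' z) \<le> (1 + z * s) * exp (- (z * s))"
      by (simp add: f'_def abs_mult)
    also have "\<dots> \<le> 16 * (z * s) powr (- 1 - \<epsilon>)" by (rule powr_exp_bound(1)[OF y assms(4,5)])
    also have "\<dots> \<le> 16 * (a * s) powr (- 1 - \<epsilon>)"
      using z assms by (intro mult_left_mono powr_mono2') auto
    finally show "norm (f' z) \<le> 16 * (a * s) powr (- 1 - \<epsilon>)" .
  qed (use assms in auto)
  then show ?thesis using assms by (simp add: abs_minus_commute algebra_simps)
qed

lemma summation_by_parts: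
  fixes m a :: "nat \<Rightarrow> real"
  assumes "p \<le> q"
  shows "(\<Sum>n\<in>{p..<q}. m n * a n) =
    m q * (\<Sum>j<q. a j) - m p * (\<Sum>j<p. a j) + (\<Sum>n\<in>{p..<q}. (m n - m (Suc n)) * (\<Sum>j<Suc n. a j))"
  using assms by (induction rule: dec_induct) (simp_all add: algebra_simps)

lemma frac_powr_summable:
  assumes "0 < e"
  shows "summable (\<lambda>n. real (Suc n) powr (- 1 - e))"
  using summable_real_powr_iff[of "- 1 - e"] assms summable_Suc_iff[of "\<lambda>n. real n powr (- 1 - e)"] by simp

text \<open>
  The operator \<open>A exp (- s A)\<close> acts on a function in the maximum norm almost like the scalar \<open>1 / s\<close>:
  if the partial sums of the series \<open>a\<close> grow at most like \<open>k powr \<epsilon>\<close>, then the series with the multipliers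
  \<open>\<lambda>\<^sub>n exp (- \<lambda>\<^sub>n s)\<close> is of size \<open>s powr (- 1 - \<epsilon>)\<close>, and its blocks tend to 0 uniformly in the
  data. After summation by parts, the boundary terms are of order \<open>N powr (- 3 \<epsilon>)\<close> and the increments
  of the multipliers contribute \<open>N powr (3 - 4 (1 + \<epsilon>) + \<epsilon>)\<close>, which is summable.
\<close>

lemma smoothing_block_bound:
  assumes g: "0 < \<gamma>" and eps: "0 < \<epsilon>" "\<epsilon> < 1"
  obtains \<rho> :: "nat \<Rightarrow> real" where "\<rho> \<longlonglongrightarrow> 0" and
    "\<And>p q s A a. p \<le> q \<Longrightarrow> 0 < s \<Longrightarrow> (\<And>k. \<bar>\<Sum>j<k. a j\<bar> \<le> A * real k powr \<epsilon>) \<Longrightarrow>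
      \<bar>\<Sum>n\<in>{p..<q}. eigenvalue \<gamma> n * exp (- eigenvalue \<gamma> n * s) * a n\<bar> \<le> A * \<rho> p * s powr (- 1 - \<epsilon>)"
proof -
  define c where "c = \<gamma> * pi ^ 4"
  define C where "C = 15 * \<gamma> * pi ^ 4 + 3 * pi\<^sup>2"
  define N where "N n = real (Suc n)" for n
  define D where "D = 16 * C * c powr (- 1 - \<epsilon>)"
  define \<sigma> where "\<sigma> n = N n powr (- 1 - 3 * \<epsilon>)" for n
  define \<rho> where "\<rho> p = 32 * c powr (- \<epsilon>) * N p powr (- (3 * \<epsilon>)) + D * (\<Sum>n. \<sigma> (n + p))" for p
  have c: "0 < c" using g by (simp add: c_def)
  have C: "0 < C" using g by (simp add: C_def add_pos_pos)
  have D: "0 \<le> D" using C by (simp add: D_def)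
  have N: "1 \<le> N n" for n by (simp add: N_def)
  have N0: "0 < N n" for n using N[of n] by linarith
  have sum\<sigma>: "summable \<sigma>" unfolding \<sigma>_def N_def using eps by (intro frac_powr_summable) simp
  have ev: "c * N n ^ 4 \<le> eigenvalue \<gamma> n" for n
    using eigenvalue_ge_fourth_power[of \<gamma> n] by (simp add: c_def N_def)
  have evp: "0 < eigenvalue \<gamma> n" for n using eigenvalue_pos[OF g] .
  have N4: "(c * N n ^ 4) powr r = c powr r * N n powr (4 * r)" for n r
    using c N0[of n] by (simp add: powr_mult powr_powr[symmetric] powr_numeral)
  have "(\<lambda>p. N p powr (- (3 * \<epsilon>))) \<longlonglongrightarrow> 0"
    unfolding N_def using eps
    by (intro tendsto_neg_powr filterlim_compose[OF filterlim_real_sequentially filterlim_Suc]) auto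
  then have "\<rho> \<longlonglongrightarrow> 32 * c powr (- \<epsilon>) * 0 + D * 0"
    unfolding \<rho>_def by (intro tendsto_intros suminf_exist_split2 sum\<sigma>)
  then have lim: "\<rho> \<longlonglongrightarrow> 0" by simp
  have block: "\<bar>\<Sum>n\<in>{p..<q}. eigenvalue \<gamma> n * exp (- eigenvalue \<gamma> n * s) * a n\<bar> \<le> A * \<rho> p * s powr (- 1 - \<epsilon>)"
    if pq: "p \<le> q" and s: "0 < s" and a: "\<And>k. \<bar>\<Sum>j<k. a j\<bar> \<le> A * real k powr \<epsilon>"
    for p q s A and a :: "nat \<Rightarrow> real"
  proof -
    define m where "m n = eigenvalue \<gamma> n * exp (- eigenvalue \<gamma> n * s)" for n
    define S where "S k = (\<Sum>j<k. a j)" for k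
    define T where "T = s powr (- 1 - \<epsilon>)"
    have T0: "0 \<le> T" by (simp add: T_def)
    have A0: "0 \<le> A" using a[of 1] by simp
    have S: "\<bar>S k\<bar> \<le> A * N n powr \<epsilon>" if "k \<le> Suc n" for k n
    proof -
      have "real k powr \<epsilon> \<le> N n powr \<epsilon>" using that eps by (intro powr_mono2) (auto simp: N_def)
      from mult_left_mono[OF this A0] show ?thesis using a[of k] unfolding S_def by linarith
    qed
    have m0: "0 \<le> m n" for n using evp[of n] by (simp add: m_def)
    have m: "m n \<le> 16 * c powr (- \<epsilon>) * N n powr (- (4 * \<epsilon>)) * T" for n
    proof -
      let ?l = "eigenvalue \<gamma> n"
      have "exp (- (?l * s)) \<le> 16 * (?l * s) powr (- 1 - \<epsilon>)"
        by (rule powr_exp_bound(2)) (use evp[of n] s eps in auto)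
      then have "m n \<le> ?l * (16 * (?l * s) powr (- 1 - \<epsilon>))"
        unfolding m_def using evp[of n] by (intro mult_left_mono) auto
      also have "\<dots> = 16 * (?l powr 1 * ?l powr (- 1 - \<epsilon>)) * T"
        using evp[of n] s by (simp add: powr_mult T_def)
      also have "?l powr 1 * ?l powr (- 1 - \<epsilon>) = ?l powr (- \<epsilon>)"
        unfolding powr_add[symmetric] by simp
      also have "16 * ?l powr (- \<epsilon>) * T \<le> 16 * (c * N n ^ 4) powr (- \<epsilon>) * T"
        using ev[of n] c N0[of n] eps T0 by (intro mult_right_mono mult_left_mono powr_mono2') auto
      finally show ?thesis by (simp add: N4)
    qed
    have NN: "N n powr x * N n powr y = N n powr (x + y)" for n x y by (simp add: powr_add)
    have bd: "\<bar>m n * S n\<bar> \<le> A * (16 * c powr (- \<epsilon>) * N p powr (- (3 * \<epsilon>))) * T" if "p \<le> n" for n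
    proof -
      have "\<bar>m n * S n\<bar> \<le> (16 * c powr (- \<epsilon>) * N n powr (- (4 * \<epsilon>)) * T) * (A * N n powr \<epsilon>)"
        unfolding abs_mult using m[of n] m0[of n] S[of n n] T0 by (intro mult_mono) auto
      also have "\<dots> = A * (16 * c powr (- \<epsilon>) * (N n powr (- (4 * \<epsilon>)) * N n powr \<epsilon>)) * T" by simp
      also have "N n powr (- (4 * \<epsilon>)) * N n powr \<epsilon> = N n powr (- (3 * \<epsilon>))" unfolding NN by simp
      also have "A * (16 * c powr (- \<epsilon>) * N n powr (- (3 * \<epsilon>))) * T \<le> A * (16 * c powr (- \<epsilon>) * N p powr (- (3 * \<epsilon>))) * T"
        using that A0 T0 eps N0[of p] by (intro mult_right_mono mult_left_mono powr_mono2') (auto simp: N_def)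
      finally show ?thesis .
    qed
    have inc: "\<bar>(m n - m (Suc n)) * S (Suc n)\<bar> \<le> A * D * T * \<sigma> n" for n
    proof -
      have "\<bar>m n - m (Suc n)\<bar> \<le> 16 * (eigenvalue \<gamma> (Suc n) - eigenvalue \<gamma> n) * (eigenvalue \<gamma> n * s) powr (- 1 - \<epsilon>)"
        unfolding m_def by (rule symbol_increment) (use evp eigenvalue_mono[OF g] s eps in auto)
      also have "\<dots> \<le> 16 * (C * N n ^ 3) * (c * N n ^ 4 * s) powr (- 1 - \<epsilon>)"
        using eigenvalue_increment[OF g, of n] eigenvalue_mono[OF g, of n "Suc n"] ev[of n] c N0[of n] s eps C
        by (intro mult_mono powr_mono2' mult_right_mono) (auto simp: C_def N_def)
      also have "(c * N n ^ 4 * s) powr (- 1 - \<epsilon>) = (c * N n ^ 4) powr (- 1 - \<epsilon>) * T"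
        using c N0[of n] s by (simp add: powr_mult T_def)
      also have "\<dots> = c powr (- 1 - \<epsilon>) * N n powr (4 * (- 1 - \<epsilon>)) * T" unfolding N4 ..
      also have "16 * (C * N n ^ 3) * (c powr (- 1 - \<epsilon>) * N n powr (4 * (- 1 - \<epsilon>)) * T)
          = D * (N n powr 3 * N n powr (4 * (- 1 - \<epsilon>))) * T"
        using N0[of n] by (simp add: D_def powr_numeral)
      also have "N n powr 3 * N n powr (4 * (- 1 - \<epsilon>)) = N n powr (- 1 - 4 * \<epsilon>)" unfolding NN by simp
      finally have 1: "\<bar>m n - m (Suc n)\<bar> \<le> D * N n powr (- 1 - 4 * \<epsilon>) * T" .
      have "\<bar>(m n - m (Suc n)) * S (Suc n)\<bar> \<le> (D * N n powr (- 1 - 4 * \<epsilon>) * T) * (A * N n powr \<epsilon>)"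
        unfolding abs_mult using 1 S[of "Suc n" n] D T0 by (intro mult_mono) auto
      also have "\<dots> = A * D * T * (N n powr (- 1 - 4 * \<epsilon>) * N n powr \<epsilon>)" by simp
      also have "N n powr (- 1 - 4 * \<epsilon>) * N n powr \<epsilon> = \<sigma> n" unfolding NN \<sigma>_def by (simp add: algebra_simps)
      finally show ?thesis .
    qed
    have tail: "(\<Sum>n\<in>{p..<q}. \<sigma> n) \<le> (\<Sum>n. \<sigma> (n + p))"
    proof -
      have "(\<Sum>n\<in>{p..<q}. \<sigma> n) = (\<Sum>n<q - p. \<sigma> (n + p))"
        using pq by (subst sum.atLeastLessThan_shift_0) (simp add: atLeast0LessThan add.commute)
      also have "\<dots> \<le> (\<Sum>n. \<sigma> (n + p))"
        using sum\<sigma> summable_iff_shift[of \<sigma> p] by (intro sum_le_suminf) (simp_all add: \<sigma>_def)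
      finally show ?thesis .
    qed
    have "(\<Sum>n\<in>{p..<q}. m n * a n) = m q * S q - m p * S p + (\<Sum>n\<in>{p..<q}. (m n - m (Suc n)) * S (Suc n))"
      unfolding S_def by (rule summation_by_parts[OF pq])
    moreover have "\<bar>\<Sum>n\<in>{p..<q}. (m n - m (Suc n)) * S (Suc n)\<bar> \<le> (\<Sum>n\<in>{p..<q}. A * D * T * \<sigma> n)"
      by (rule order_trans[OF sum_abs sum_mono]) (rule inc)
    moreover have "(\<Sum>n\<in>{p..<q}. A * D * T * \<sigma> n) \<le> A * D * T * (\<Sum>n. \<sigma> (n + p))"
      unfolding sum_distrib_left[symmetric] using A0 D T0 tail by (intro mult_left_mono) auto
    ultimately have "\<bar>\<Sum>n\<in>{p..<q}. m n * a n\<bar> \<le>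
        2 * (A * (16 * c powr (- \<epsilon>) * N p powr (- (3 * \<epsilon>))) * T) + A * D * T * (\<Sum>n. \<sigma> (n + p))"
      using bd[OF pq] bd[of p] by linarith
    also have "\<dots> = A * \<rho> p * T" by (simp add: \<rho>_def algebra_simps)
    finally show ?thesis by (simp add: m_def T_def)
  qed
  show ?thesis by (rule that[OF lim]) (rule block)
qed

section \<open>The linear problem with periodic forcing\<close>

lemma summable_inverse_squares: "summable (\<lambda>n. 1 / (real (Suc n))\<^sup>2)"
  using inverse_squares_sums by (simp add: sums_iff add.commute)

lemma trig_bounds:
  "\<bar>sin (freq n * x)\<bar> \<le> (freq n)\<^sup>2" "\<bar>freq n * cos (freq n * x)\<bar> \<le> (freq n)\<^sup>2"
  "\<bar>- ((freq n)\<^sup>2 * sin (freq n * x))\<bar> \<le> (freq n)\<^sup>2"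
proof -
  have f: "1 \<le> (freq n)\<^sup>2" by (rule freq_squared_ge_1)
  then show "\<bar>sin (freq n * x)\<bar> \<le> (freq n)\<^sup>2" using abs_sin_le_one[of "freq n * x"] by linarith
  have "1 \<le> freq n" by (rule power2_le_imp_le) (use f freq_pos[of n] in auto)
  then have a: "freq n * 1 \<le> freq n * freq n" using freq_pos[of n] by (intro mult_left_mono) auto
  have b: "freq n * \<bar>cos (freq n * x)\<bar> \<le> freq n * 1" using freq_pos[of n] by (intro mult_left_mono) auto
  have "\<bar>freq n * cos (freq n * x)\<bar> = freq n * \<bar>cos (freq n * x)\<bar>"
    using freq_pos[of n] by (simp add: abs_mult)
  then show "\<bar>freq n * cos (freq n * x)\<bar> \<le> (freq n)\<^sup>2"
    unfolding power2_eq_square using a b by linarith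
  show "\<bar>- ((freq n)\<^sup>2 * sin (freq n * x))\<bar> \<le> (freq n)\<^sup>2"
    by (simp add: abs_mult mult_left_le)
qed

lemma series_bound:
  assumes "\<And>n. \<bar>c n\<bar> \<le> K * (1 / (real (Suc n))\<^sup>2)"
  shows "\<bar>\<Sum>n. c n\<bar> \<le> K * (\<Sum>n. 1 / (real (Suc n))\<^sup>2)"
proof -
  have s: "summable (\<lambda>n. K * (1 / (real (Suc n))\<^sup>2))"
    by (rule summable_mult[OF summable_inverse_squares])
  have "norm (\<Sum>n. c n) \<le> (\<Sum>n. K * (1 / (real (Suc n))\<^sup>2))"
    by (rule norm_suminf_le[OF _ s]) (use assms in simp)
  also have "\<dots> = K * (\<Sum>n. 1 / (real (Suc n))\<^sup>2)"
    by (rule suminf_mult[OF summable_inverse_squares])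
  finally show ?thesis by simp
qed

lemma exp_neg_le_inverse: "0 < (y::real) \<Longrightarrow> exp (- y) \<le> 1 / y"
proof -
  assume y: "0 < y"
  have "y \<le> exp y" using exp_ge_add_one_self[of y] by linarith
  then show ?thesis using y by (simp add: exp_minus field_simps)
qed

text \<open>
  The bound \<open>B\<close> is imposed on the sine coefficients, because in the nonlinear problem
  only an \<open>L\<^sup>2\<close> bound on the right-hand side is under control. The constants \<open>weight\<close>, \<open>sup_const\<close> and
  \<open>modulus\<close> depend on \<open>h\<close> only through \<open>B\<close>.
\<close>

locale periodic_forcing =
  fixes \<gamma> \<omega> B :: real and h :: "real \<Rightarrow> real \<Rightarrow> real"
  assumes gamma: "0 < \<gamma>" and omega: "0 < \<omega>"
    and cont: "continuous_on (UNIV \<times> {0..1}) (\<lambda>(t, x). h t x)"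
    and periodic: "\<And>t x. x \<in> {0..1} \<Longrightarrow> h (t + \<omega>) x = h t x"
    and coef_bound: "\<And>t n. \<bar>sine_coef (h t) n\<bar> \<le> B"
begin

definition mode :: "nat \<Rightarrow> real \<Rightarrow> real" where
  "mode n t = periodic_response (eigenvalue \<gamma> n) \<omega> (\<lambda>s. sine_coef (h s) n) t"

definition dmode :: "nat \<Rightarrow> real \<Rightarrow> real" where
  "dmode n t = sine_coef (h t) n - eigenvalue \<gamma> n * mode n t"

definition sol :: "real \<Rightarrow> real \<Rightarrow> real" where
  "sol t x = (\<Sum>n. mode n t * sin (freq n * x))"

lemma B_nonneg: "0 \<le> B"
  using coef_bound[of 0 0] by linarith

lemma h_continuous: "continuous_on {0..1} (h t)"
proof -
  have "continuous_on {0..1} (\<lambda>x. (\<lambda>(t, x). h t x) (t, x))"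
    by (rule continuous_on_compose2[OF cont]) (auto intro!: continuous_intros)
  then show ?thesis by simp
qed

lemma coef_continuous: "continuous_on UNIV (\<lambda>t. sine_coef (h t) n)"
proof -
  have "continuous_on (UNIV \<times> cbox 0 1) (\<lambda>(t, x). h t x * sin (freq n * x))"
    using cont by (auto simp: case_prod_unfold intro!: continuous_intros)
  from integral_continuous_on_param[OF this] show ?thesis
    unfolding sine_coef_def by (auto intro!: continuous_intros)
qed

lemma coef_periodic: "sine_coef (h (t + \<omega>)) n = sine_coef (h t) n"
  by (rule sine_coef_cong) (rule periodic)

lemma mode_bound: "\<bar>mode n t\<bar> \<le> B / eigenvalue \<gamma> n"
  unfolding mode_def
  by (rule response_bound[OF eigenvalue_pos[OF gamma] omega coef_continuous coef_bound])

lemma dmode_bound: "\<bar>dmode n t\<bar> \<le> 2 * B"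
proof -
  have "eigenvalue \<gamma> n * \<bar>mode n t\<bar> \<le> B"
    using mode_bound[of n t] eigenvalue_pos[OF gamma, of n] by (simp add: pos_le_divide_eq mult.commute)
  then have "\<bar>eigenvalue \<gamma> n * mode n t\<bar> \<le> B"
    using eigenvalue_pos[OF gamma, of n] by (simp add: abs_mult)
  then show ?thesis using coef_bound[of t n] unfolding dmode_def by linarith
qed

lemma mode_has_derivative: "(mode n has_real_derivative dmode n t) (at t)"
proof -
  have "mode n = periodic_response (eigenvalue \<gamma> n) \<omega> (\<lambda>s. sine_coef (h s) n)"
    by (rule ext) (simp add: mode_def)
  then show ?thesis
    using response_has_derivative[OF eigenvalue_pos[OF gamma] omega coef_continuous coef_periodic]
    by (simp add: dmode_def)
qed

lemma mode_continuous: "continuous_on A (mode n)"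
  by (rule DERIV_continuous_on) (rule has_field_derivative_at_within[OF mode_has_derivative])

lemma dmode_continuous: "continuous_on A (dmode n)"
  unfolding dmode_def
  by (intro continuous_intros mode_continuous continuous_on_subset[OF coef_continuous]) auto

lemma mode_periodic: "mode n (t + \<omega>) = mode n t"
  unfolding mode_def by (rule response_periodic) (rule coef_periodic)

lemma sol_periodic: "sol (t + \<omega>) x = sol t x"
  unfolding sol_def mode_periodic ..

lemma mode_decay: "\<bar>mode n t\<bar> \<le> B / (\<gamma> * pi ^ 4) / real (Suc n) ^ 4"
proof -
  have "\<bar>mode n t\<bar> \<le> B / eigenvalue \<gamma> n" by (rule mode_bound)
  also have "\<dots> \<le> B / (\<gamma> * pi ^ 4 * real (Suc n) ^ 4)"
    by (rule divide_left_mono[OF eigenvalue_ge_fourth_power B_nonneg])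
       (use gamma eigenvalue_pos[OF gamma, of n] in \<open>auto intro!: mult_pos_pos\<close>)
  finally show ?thesis by simp
qed

text \<open>
  The constant in the majorant \<open>weight / n\<^sup>2\<close>, which serves for the series of the solution and of its first two
  derivatives in \<open>x\<close>.
\<close>

definition weight :: real where
  "weight = B / (\<gamma> * pi\<^sup>2)"

lemma mode_freq_squared: "\<bar>mode n t\<bar> * (freq n)\<^sup>2 \<le> weight * (1 / (real (Suc n))\<^sup>2)"
proof -
  have "\<bar>mode n t\<bar> * (freq n)\<^sup>2 \<le> B / (\<gamma> * pi ^ 4) / real (Suc n) ^ 4 * (freq n)\<^sup>2"
    by (intro mult_right_mono mode_decay) simp
  also have "\<dots> = weight * (1 / (real (Suc n))\<^sup>2)"
  proof -
    define N where "N = real (Suc n)"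
    have N: "0 < N" by (simp add: N_def)
    show ?thesis using gamma N
      unfolding N_def[symmetric] weight_def freq_def power_mult_distrib
      by (simp add: field_simps power4_eq_xxxx power2_eq_square)
  qed
  finally show ?thesis .
qed

lemma mode_times_bound:
  assumes "\<bar>c\<bar> \<le> (freq n)\<^sup>2"
  shows "\<bar>mode n t * c\<bar> \<le> weight * (1 / (real (Suc n))\<^sup>2)"
proof -
  have "\<bar>mode n t * c\<bar> \<le> \<bar>mode n t\<bar> * (freq n)\<^sup>2"
    unfolding abs_mult by (rule mult_left_mono[OF assms]) simp
  also note mode_freq_squared
  finally show ?thesis .
qed

lemma summable_weight: "summable (\<lambda>n. weight * (1 / (real (Suc n))\<^sup>2))"
  by (rule summable_mult[OF summable_inverse_squares])

lemma series_uniform_limit: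
  assumes "\<And>n x. \<bar>F n x\<bar> \<le> (freq n)\<^sup>2"
  shows "uniform_limit UNIV (\<lambda>N (t, x). \<Sum>n<N. mode n t * F n x) (\<lambda>(t, x). \<Sum>n. mode n t * F n x) sequentially"
proof -
  have "uniform_limit UNIV (\<lambda>N p. \<Sum>n<N. mode n (fst p) * F n (snd p)) (\<lambda>p. \<Sum>n. mode n (fst p) * F n (snd p)) sequentially"
    by (rule Weierstrass_m_test[OF _ summable_weight]) (use mode_times_bound assms in simp)
  then show ?thesis by (simp add: case_prod_unfold)
qed

lemma series_summable:
  assumes "\<And>n. \<bar>c n\<bar> \<le> (freq n)\<^sup>2"
  shows "summable (\<lambda>n. mode n t * c n)"
  by (rule summable_comparison_test'[OF summable_weight]) (use mode_times_bound assms in simp)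

lemma series_continuous:
  assumes "\<And>n x. \<bar>F n x\<bar> \<le> (freq n)\<^sup>2" and F: "\<And>n. continuous_on UNIV (F n)"
  shows "continuous_on UNIV (\<lambda>(t, x). \<Sum>n. mode n t * F n x)"
proof (rule uniform_limit_theorem[OF _ series_uniform_limit[of F, OF assms(1)]])
  show "\<forall>\<^sub>F N in sequentially. continuous_on UNIV (\<lambda>(t, x). \<Sum>n<N. mode n t * F n x)"
    unfolding case_prod_unfold
    by (intro always_eventually allI continuous_intros continuous_on_compose2[OF mode_continuous]
        continuous_on_compose2[OF F]) auto
qed simp

lemma series_x_derivative:
  assumes "\<And>n x. \<bar>F n x\<bar> \<le> (freq n)\<^sup>2" and F': "\<And>n x. \<bar>F' n x\<bar> \<le> (freq n)\<^sup>2"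
    and D: "\<And>n x. (F n has_real_derivative F' n x) (at x)"
  shows "((\<lambda>x. \<Sum>n. mode n t * F n x) has_real_derivative (\<Sum>n. mode n t * F' n x)) (at x)"
proof (rule has_field_derivative_series'(2)[of UNIV _ _ 0])
  show "uniformly_convergent_on UNIV (\<lambda>N x. \<Sum>n<N. mode n t * F' n x)"
    using uniform_limit_compose'[OF series_uniform_limit[of F', OF F'], where h = "\<lambda>x. (t, x)" and B = UNIV]
    unfolding uniformly_convergent_on_def by auto
  show "((\<lambda>x. mode n t * F n x) has_real_derivative mode n t * F' n x) (at x within UNIV)" for n x
    by (intro DERIV_cmult D)
  show "summable (\<lambda>n. mode n t * F n 0)" by (rule series_summable) (rule assms(1))
qed auto

definition sol_x :: "real \<Rightarrow> real \<Rightarrow> real" where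
  "sol_x t x = (\<Sum>n. mode n t * (freq n * cos (freq n * x)))"

definition sol_xx :: "real \<Rightarrow> real \<Rightarrow> real" where
  "sol_xx t x = (\<Sum>n. mode n t * - ((freq n)\<^sup>2 * sin (freq n * x)))"

lemma sol_has_x_derivative: "(sol t has_real_derivative sol_x t x) (at x)"
proof -
  have "sol t = (\<lambda>x. \<Sum>n. mode n t * sin (freq n * x))" by (rule ext) (simp add: sol_def)
  moreover have "((\<lambda>x. \<Sum>n. mode n t * sin (freq n * x)) has_real_derivative sol_x t x) (at x)"
    unfolding sol_x_def
    by (rule series_x_derivative[OF trig_bounds(1,2)]) (auto intro!: derivative_eq_intros)
  ultimately show ?thesis by simp
qed

lemma sol_x_has_x_derivative: "(sol_x t has_real_derivative sol_xx t x) (at x)"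
proof -
  have "sol_x t = (\<lambda>x. \<Sum>n. mode n t * (freq n * cos (freq n * x)))" by (rule ext) (simp add: sol_x_def)
  moreover have "((\<lambda>x. \<Sum>n. mode n t * (freq n * cos (freq n * x))) has_real_derivative sol_xx t x) (at x)"
    unfolding sol_xx_def
    by (rule series_x_derivative[OF trig_bounds(2,3)]) (auto intro!: derivative_eq_intros simp: power2_eq_square)
  ultimately show ?thesis by simp
qed

lemma sol_continuous: "continuous_on UNIV (\<lambda>(t, x). sol t x)"
  unfolding sol_def by (intro series_continuous trig_bounds continuous_intros)

lemma sol_x_continuous: "continuous_on UNIV (\<lambda>(t, x). sol_x t x)"
  unfolding sol_x_def by (intro series_continuous trig_bounds continuous_intros)

lemma sol_xx_continuous: "continuous_on UNIV (\<lambda>(t, x). sol_xx t x)"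
  unfolding sol_xx_def by (intro series_continuous trig_bounds continuous_intros)

lemma sol_boundary:
  assumes "x \<in> {0, 1}"
  shows "sol t x = 0" "sol_xx t x = 0"
proof -
  have "sin (freq n * x) = 0" for n using sin_freq_0_1[of n] assms by auto
  then show "sol t x = 0" "sol_xx t x = 0" by (simp_all add: sol_def sol_xx_def)
qed

definition sup_const :: real where
  "sup_const = weight * (\<Sum>n. 1 / (real (Suc n))\<^sup>2)"

lemma sol_bound: "\<bar>sol t x\<bar> \<le> sup_const"
  unfolding sol_def sup_const_def
  by (rule series_bound) (rule mode_times_bound[OF trig_bounds(1)])

definition modulus :: real where
  "modulus = (weight + 2 * B / (sqrt \<gamma> * pi\<^sup>2)) * (\<Sum>n. 1 / (real (Suc n))\<^sup>2)"

text \<open>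
  The difference is at most \<open>2 B \<bar>t - t'\<bar>\<close> by the differential equation and at most a multiple of \<open>n^(- 4)\<close>
  by decay; the geometric mean of the two is summable in \<open>n\<close> and has exponent \<open>1/2\<close> in time.
\<close>

lemma mode_difference:
  "\<bar>mode n t - mode n t'\<bar> \<le> 2 * B / (sqrt \<gamma> * pi\<^sup>2) * sqrt \<bar>t - t'\<bar> * (1 / (real (Suc n))\<^sup>2)"
proof -
  define N where "N = real (Suc n)"
  have N: "0 < N" by (simp add: N_def)
  define X where "X = \<bar>mode n t - mode n t'\<bar>"
  have X0: "0 \<le> X" by (simp add: X_def)
  have "norm (mode n t - mode n t') \<le> 2 * B * norm (t - t')"
    by (rule field_differentiable_bound[of UNIV "mode n" "dmode n"])
       (use mode_has_derivative dmode_bound in auto)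
  then have 1: "X \<le> 2 * B * \<bar>t - t'\<bar>" by (simp add: X_def)
  have 2: "X \<le> 2 * (B / (\<gamma> * pi ^ 4) / N ^ 4)"
    using mode_decay[of n t] mode_decay[of n t'] unfolding X_def N_def by linarith
  have "X * X \<le> (2 * B * \<bar>t - t'\<bar>) * (2 * (B / (\<gamma> * pi ^ 4) / N ^ 4))"
    by (rule mult_mono[OF 1 2]) (use B_nonneg X0 in auto)
  also have "\<dots> = (2 * B / (sqrt \<gamma> * pi\<^sup>2) * sqrt \<bar>t - t'\<bar> * (1 / N\<^sup>2))\<^sup>2"
    using gamma N by (simp add: power_mult_distrib power_divide power4_eq_xxxx power2_eq_square mult_ac)
  finally have "X\<^sup>2 \<le> (2 * B / (sqrt \<gamma> * pi\<^sup>2) * sqrt \<bar>t - t'\<bar> * (1 / N\<^sup>2))\<^sup>2"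
    by (simp add: power2_eq_square)
  then have "X \<le> 2 * B / (sqrt \<gamma> * pi\<^sup>2) * sqrt \<bar>t - t'\<bar> * (1 / N\<^sup>2)"
    by (rule power2_le_imp_le) (use B_nonneg gamma N in auto)
  then show ?thesis by (simp add: X_def N_def)
qed

lemma sol_modulus:
  "\<bar>sol t x - sol t' x'\<bar> \<le> modulus * (\<bar>x - x'\<bar> + sqrt \<bar>t - t'\<bar>)"
proof -
  define Z where "Z = (\<Sum>n. 1 / (real (Suc n))\<^sup>2)"
  define V where "V = 2 * B / (sqrt \<gamma> * pi\<^sup>2)"
  have Z0: "0 \<le> Z" unfolding Z_def by (intro suminf_nonneg summable_inverse_squares) auto
  have V0: "0 \<le> V" using B_nonneg gamma by (simp add: V_def)
  have W0: "0 \<le> weight" using B_nonneg gamma by (simp add: weight_def)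
  have sm: "summable (\<lambda>n. mode n t * sin (freq n * x))" for t x
    by (rule series_summable) (rule trig_bounds(1))
  have "\<bar>\<Sum>n. mode n t * sin (freq n * x) - mode n t' * sin (freq n * x)\<bar> \<le> (V * sqrt \<bar>t - t'\<bar>) * Z"
    unfolding Z_def
  proof (rule series_bound)
    fix n
    have "\<bar>mode n t - mode n t'\<bar> * \<bar>sin (freq n * x)\<bar> \<le> \<bar>mode n t - mode n t'\<bar>"
      by (simp add: mult_left_le)
    from order_trans[OF this mode_difference]
    show "\<bar>mode n t * sin (freq n * x) - mode n t' * sin (freq n * x)\<bar> \<le> V * sqrt \<bar>t - t'\<bar> * (1 / (real (Suc n))\<^sup>2)"
      unfolding V_def left_diff_distrib[symmetric] abs_mult .
  qed
  then have 1: "\<bar>sol t x - sol t' x\<bar> \<le> V * sqrt \<bar>t - t'\<bar> * Z"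
    unfolding sol_def suminf_diff[OF sm sm] .
  have "norm (sol t' x - sol t' x') \<le> (weight * Z) * norm (x - x')"
  proof (rule field_differentiable_bound[of UNIV "sol t'" "sol_x t'"])
    show "norm (sol_x t' y) \<le> weight * Z" for y
      unfolding sol_x_def Z_def real_norm_def
      by (rule series_bound) (rule mode_times_bound[OF trig_bounds(2)])
  qed (use sol_has_x_derivative in auto)
  then have "\<bar>sol t x - sol t' x'\<bar> \<le> V * sqrt \<bar>t - t'\<bar> * Z + weight * Z * \<bar>x - x'\<bar>"
    using 1 by (simp add: abs_if split: if_splits)
  also have "\<dots> \<le> (weight + V) * Z * (\<bar>x - x'\<bar> + sqrt \<bar>t - t'\<bar>)"
    using Z0 V0 W0 by (simp add: algebra_simps)
  finally show ?thesis by (simp add: modulus_def V_def Z_def)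
qed

lemma sol_uniform_limit: "uniform_limit {0..1} (\<lambda>N x. \<Sum>n<N. mode n t * sin (freq n * x)) (sol t) sequentially"
  using uniform_limit_compose'[OF series_uniform_limit[of "\<lambda>n x. sin (freq n * x)", OF trig_bounds(1)],
      where h = "\<lambda>x. (t, x)" and B = "{0..1}"]
  by (simp add: sol_def[abs_def])

text \<open>
  Bessel's inequality for \<open>h\<close>, the contraction estimate for the coefficient vectors, and the
  integral of a squared sine polynomial combine without loss: the two factors 2 cancel.
\<close>

lemma sol_L2_bound:
  assumes Q: "0 \<le> Q" and h: "\<And>t. integral {0..1} (\<lambda>x. (h t x)\<^sup>2) \<le> Q\<^sup>2"
  shows "integral {0..1} (\<lambda>x. (sol t x)\<^sup>2) \<le> (Q / eigenvalue \<gamma> 0)\<^sup>2"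
proof -
  let ?s = "\<lambda>N x. \<Sum>n<N. mode n t * sin (freq n * x)"
  have coefs: "(\<Sum>n<N. (mode n t)\<^sup>2) \<le> (sqrt 2 * Q / eigenvalue \<gamma> 0)\<^sup>2" for N
    unfolding mode_def
  proof (rule response_vector_bound)
    show "(\<Sum>n<N. (sine_coef (h t) n)\<^sup>2) \<le> (sqrt 2 * Q)\<^sup>2" for t
      using bessel[OF h_continuous, of t N] h[of t] by (simp add: power_mult_distrib)
  qed (use eigenvalue_pos[OF gamma] omega eigenvalue_mono[OF gamma] coef_continuous Q in auto)
  have part: "integral {0..1} (\<lambda>x. (?s N x)\<^sup>2) \<le> (Q / eigenvalue \<gamma> 0)\<^sup>2" for N
    using integral_unique[OF integral_sine_poly_squared[where N = N and a = "\<lambda>n. mode n t"]] coefs[of N]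
    by (simp add: power_mult_distrib power_divide)
  have bd: "bounded (sol t ` {0..1})"
    using sol_bound[of t] unfolding bounded_iff by (auto intro!: exI[of _ sup_const])
  have lim: "uniform_limit {0..1} (\<lambda>N x. ?s N x * ?s N x) (\<lambda>x. sol t x * sol t x) sequentially"
    by (rule uniform_lim_mult[OF sol_uniform_limit sol_uniform_limit bd bd])
  have c: "continuous_on {0..1} (\<lambda>x. ?s N x * ?s N x)" for N
    by (intro continuous_intros)
  obtain I J where I: "\<And>N. ((\<lambda>x. ?s N x * ?s N x) has_integral I N) {0..1}"
    and J: "((\<lambda>x. sol t x * sol t x) has_integral J) {0..1}" and IJ: "I \<longlonglongrightarrow> J"
    by (rule uniform_limit_integral[OF lim c sequentially_bot]) blast
  have "I N \<le> (Q / eigenvalue \<gamma> 0)\<^sup>2" for N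
    using part[of N] integral_unique[OF I[of N]] by (simp add: power2_eq_square)
  then have "J \<le> (Q / eigenvalue \<gamma> 0)\<^sup>2"
    by (intro LIMSEQ_le_const2[OF IJ]) auto
  then show ?thesis using integral_unique[OF J] by (simp add: power2_eq_square)
qed

definition sol_t :: "real \<Rightarrow> real \<Rightarrow> real" where
  "sol_t t x = (\<Sum>n. dmode n t * sin (freq n * x))"

text \<open>
  The coefficient \<open>dmode n t\<close> is \<open>(1 - exp (- \<lambda>\<^sub>n \<omega>))\<close> times itself, which is the integral over
  differences \<open>h(t) - h(t - s)\<close> from \<open>response_derivative_integral\<close>, plus an exponentially small rest. Blocks
  of the series of these integrals are bounded by \<open>smoothing_block_bound\<close> under the integral sign, with partial
  sums controlled by \<open>sine_partial_sum_bound\<close> and the Hoelder condition. The resulting majorant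
  \<open>s powr (\<theta> - 1 - \<epsilon>)\<close> is integrable as \<open>\<epsilon> = \<theta> / 2\<close>.
\<close>

lemma time_derivative_converges:
  assumes theta: "0 < \<theta>" "\<theta> \<le> 1"
    and hoelder: "\<And>t s x. x \<in> {0..1} \<Longrightarrow> 0 < s \<Longrightarrow> s \<le> \<omega> \<Longrightarrow> \<bar>h t x - h (t - s) x\<bar> \<le> C * s powr \<theta>"
  shows "uniformly_convergent_on (UNIV \<times> {0..1}) (\<lambda>N (t, x). \<Sum>n<N. dmode n t * sin (freq n * x))"
proof -
  define \<epsilon> where "\<epsilon> = \<theta> / 2"
  have eps: "0 < \<epsilon>" "\<epsilon> < 1" using theta by (auto simp: \<epsilon>_def)
  define l where "l n = eigenvalue \<gamma> n" for n
  have l: "0 < l n" for n unfolding l_def by (rule eigenvalue_pos[OF gamma])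
  define d1 where "d1 n t = (1 - exp (- l n * \<omega>)) * dmode n t" for n t
  define d2 where "d2 n t = exp (- l n * \<omega>) * dmode n t" for n t
  have split: "dmode n t = d1 n t + d2 n t" for n t by (simp add: d1_def d2_def algebra_simps)
  have C0: "0 \<le> C"
  proof -
    have "0 \<le> C * \<omega> powr \<theta>" using hoelder[of 0 \<omega> 0] omega by (auto intro: order_trans[OF abs_ge_zero])
    then show ?thesis using omega by (simp add: zero_le_mult_iff)
  qed
  obtain \<rho> where \<rho>: "\<rho> \<longlonglongrightarrow> 0" and block: "\<And>p q s A a. p \<le> q \<Longrightarrow> 0 < s \<Longrightarrow>
      (\<And>k. \<bar>\<Sum>j<k. a j\<bar> \<le> A * real k powr \<epsilon>) \<Longrightarrow>
      \<bar>\<Sum>n\<in>{p..<q}. l n * exp (- l n * s) * a n\<bar> \<le> A * \<rho> p * s powr (- 1 - \<epsilon>)"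
  proof (rule smoothing_block_bound[OF gamma eps, folded l_def])
    fix \<rho> :: "nat \<Rightarrow> real"
    assume "\<rho> \<longlonglongrightarrow> 0" and "\<And>p q s A a. p \<le> q \<Longrightarrow> 0 < s \<Longrightarrow>
      (\<And>k. \<bar>\<Sum>j<k. a j\<bar> \<le> A * real k powr \<epsilon>) \<Longrightarrow>
      \<bar>\<Sum>n\<in>{p..<q}. l n * exp (- l n * s) * a n\<bar> \<le> A * \<rho> p * s powr (- 1 - \<epsilon>)"
    then show ?thesis by (rule that)
  qed
  define R where "R = 4 / \<epsilon> * C * (\<omega> powr \<epsilon> / \<epsilon>)"
  have est: "\<bar>\<Sum>n\<in>{p..<q}. d1 n t * sin (freq n * x)\<bar> \<le> R * \<rho> p"
    if pq: "p \<le> q" and x: "x \<in> {0..1}" for p q t x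
  proof -
    define w where "w s y = h t y - h (t - s) y" for s y
    have wc: "continuous_on {0..1} (w s)" for s
      unfolding w_def by (intro continuous_intros h_continuous)
    have wcoef: "sine_coef (w s) n = sine_coef (h t) n - sine_coef (h (t - s)) n" for s n
      unfolding w_def by (rule sine_coef_diff[OF h_continuous h_continuous])
    define J where "J s = (\<Sum>n\<in>{p..<q}. l n * exp (- l n * s) * (sine_coef (w s) n * sin (freq n * x)))" for s
    have "((\<lambda>s. \<Sum>n\<in>{p..<q}. l n * exp (- l n * s) * (sine_coef (h t) n - sine_coef (h (t - s)) n) * sin (freq n * x))
        has_integral (\<Sum>n\<in>{p..<q}. d1 n t * sin (freq n * x))) {0..\<omega>}"
      unfolding d1_def dmode_def mode_def l_def
      by (intro has_integral_sum has_integral_mult_left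
          response_derivative_integral[OF eigenvalue_pos[OF gamma] omega coef_continuous]) auto
    then have J: "(J has_integral (\<Sum>n\<in>{p..<q}. d1 n t * sin (freq n * x))) {0..\<omega>}"
      unfolding J_def wcoef by (simp add: mult.assoc)
    have "((\<lambda>s. s powr (\<epsilon> - 1)) has_integral (\<omega> powr \<epsilon> / \<epsilon>)) {0..\<omega>}"
      using has_integral_powr_from_0[of "\<epsilon> - 1" \<omega>] eps omega by simp
    then have G: "((\<lambda>s. 4 / \<epsilon> * C * \<rho> p * s powr (\<epsilon> - 1)) has_integral (4 / \<epsilon> * C * \<rho> p * (\<omega> powr \<epsilon> / \<epsilon>))) {0..\<omega>}"
      by (rule has_integral_mult_right)
    have "norm (integral {0..\<omega>} J) \<le> integral {0..\<omega>} (\<lambda>s. 4 / \<epsilon> * C * \<rho> p * s powr (\<epsilon> - 1))"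
    proof (rule integral_norm_bound_integral)
      fix s assume s: "s \<in> {0..\<omega>}"
      show "norm (J s) \<le> 4 / \<epsilon> * C * \<rho> p * s powr (\<epsilon> - 1)"
      proof (cases "s = 0")
        case True
        then show ?thesis by (simp add: J_def wcoef)
      next
        case False
        then have s0: "0 < s" using s by simp
        have "\<bar>\<Sum>j<k. sine_coef (w s) j * sin (freq j * x)\<bar> \<le> 4 / \<epsilon> * (C * s powr \<theta>) * real k powr \<epsilon>" for k
          by (rule sine_partial_sum_bound[OF wc _ x eps]) (use hoelder[OF _ s0] s in \<open>simp add: w_def\<close>)
        from block[OF pq s0 this]
        have "\<bar>J s\<bar> \<le> 4 / \<epsilon> * (C * s powr \<theta>) * \<rho> p * s powr (- 1 - \<epsilon>)" unfolding J_def .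
        also have "\<dots> = 4 / \<epsilon> * C * \<rho> p * (s powr \<theta> * s powr (- 1 - \<epsilon>))" by simp
        also have "s powr \<theta> * s powr (- 1 - \<epsilon>) = s powr (\<epsilon> - 1)"
          unfolding powr_add[symmetric] by (simp add: \<epsilon>_def)
        finally show ?thesis by simp
      qed
    qed (use J G in \<open>auto simp: integrable_on_def\<close>)
    then show ?thesis
      using integral_unique[OF J] integral_unique[OF G] by (simp add: R_def mult_ac)
  qed
  have R0: "0 \<le> R" using C0 eps by (simp add: R_def)
  have "uniformly_Cauchy_on (UNIV \<times> {0..1}) (\<lambda>N p. \<Sum>n<N. d1 n (fst p) * sin (freq n * snd p))"
  proof (rule uniformly_Cauchy_onI')
    fix e :: real assume e: "0 < e"
    have "(\<lambda>p. R * \<rho> p) \<longlonglongrightarrow> R * 0" by (intro tendsto_intros \<rho>)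
    then have "\<forall>\<^sub>F p in sequentially. R * \<rho> p < e" using e by (intro order_tendstoD) auto
    then obtain M where M: "\<And>p. M \<le> p \<Longrightarrow> R * \<rho> p < e" by (auto simp: eventually_sequentially)
    have "dist (\<Sum>n<m. d1 n t * sin (freq n * x)) (\<Sum>n<n. d1 n t * sin (freq n * x)) < e"
      if "M \<le> m" "m < n" "x \<in> {0..1}" for m n t x
    proof -
      have "(\<Sum>n<n. d1 n t * sin (freq n * x)) - (\<Sum>n<m. d1 n t * sin (freq n * x)) = (\<Sum>n\<in>{m..<n}. d1 n t * sin (freq n * x))"
        using that by (simp add: sum_diff_nat_ivl atLeast0LessThan[symmetric])
      then show ?thesis using est[of m n x t] M[OF that(1)] that by (simp add: dist_real_def abs_minus_commute)
    qed
    then show "\<exists>M. \<forall>p\<in>UNIV \<times> {0..1}. \<forall>m\<ge>M. \<forall>n>m.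
        dist (\<Sum>n<m. d1 n (fst p) * sin (freq n * snd p)) (\<Sum>n<n. d1 n (fst p) * sin (freq n * snd p)) < e"
      by (intro exI[of _ M]) auto
  qed
  then have 1: "uniformly_convergent_on (UNIV \<times> {0..1}) (\<lambda>N p. \<Sum>n<N. d1 n (fst p) * sin (freq n * snd p))"
    by (rule Cauchy_uniformly_convergent)
  have 2: "uniformly_convergent_on (UNIV \<times> {0..1}) (\<lambda>N p. \<Sum>n<N. d2 n (fst p) * sin (freq n * snd p))"
  proof (rule Weierstrass_m_test')
    define c where "c = \<gamma> * pi ^ 4 * \<omega>"
    have c: "0 < c" using gamma omega by (simp add: c_def)
    show "summable (\<lambda>n. 2 * B / c * (1 / (real (Suc n))\<^sup>2))"
      by (rule summable_mult[OF summable_inverse_squares])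
    fix n and p :: "real \<times> real"
    define N where "N = real (Suc n)"
    have N: "1 \<le> N" by (simp add: N_def)
    have "N ^ 2 \<le> N ^ 4" using N by (intro power_increasing) auto
    then have "c * N\<^sup>2 \<le> c * N ^ 4" using c by (intro mult_left_mono) auto
    also have "\<dots> = \<gamma> * pi ^ 4 * N ^ 4 * \<omega>" by (simp add: c_def)
    also have "\<dots> \<le> l n * \<omega>"
      using eigenvalue_ge_fourth_power[of \<gamma> n] omega unfolding l_def N_def by (intro mult_right_mono) auto
    finally have ge: "c * N\<^sup>2 \<le> l n * \<omega>" .
    have cN: "0 < c * N\<^sup>2" using c N by simp
    have "exp (- l n * \<omega>) \<le> 1 / (l n * \<omega>)" using exp_neg_le_inverse[of "l n * \<omega>"] l[of n] omega by simp
    also have "\<dots> \<le> 1 / (c * N\<^sup>2)" using ge cN by (intro divide_left_mono) auto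
    finally have e: "exp (- l n * \<omega>) \<le> 1 / (c * N\<^sup>2)" .
    have "\<bar>d2 n (fst p) * sin (freq n * snd p)\<bar> \<le> (1 / (c * N\<^sup>2) * (2 * B)) * 1"
      unfolding d2_def abs_mult
      using e dmode_bound[of n "fst p"] cN B_nonneg by (intro mult_mono) auto
    then show "norm (d2 n (fst p) * sin (freq n * snd p)) \<le> 2 * B / c * (1 / (real (Suc n))\<^sup>2)"
      by (simp add: N_def mult_ac)
  qed
  show ?thesis
    using uniformly_convergent_add[OF 1 2]
    by (simp add: case_prod_unfold split distrib_right sum.distrib)
qed

end

section \<open>Classical regularity\<close>

text \<open>
  Derivatives within the unit interval see only the values there, so that they may be computed from
  any function that agrees with \<open>v t\<close> on the interval.
\<close>

lemma dx_of_extension: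
  assumes eq: "\<And>x. x \<in> {0..1} \<Longrightarrow> v t x = F x"
    and D: "(F has_real_derivative D) (at x within {0..1})" and x: "x \<in> {0..1}"
  shows "dx_exists v t x" "dx v t x = D"
proof -
  have "(v t has_real_derivative D) (at x within {0..1})"
    by (rule has_field_derivative_transform_within[OF D zero_less_one x]) (simp add: eq)
  then have V: "(v t has_vector_derivative D) (at x within {0..1})"
    by (simp add: has_real_derivative_iff_has_vector_derivative)
  then show "dx_exists v t x"
    unfolding dx_exists_def by (rule differentiableI_vector)
  show "dx v t x = D"
    unfolding dx_def by (rule vector_derivative_within_closed_interval[OF _ x V]) simp
qed

context periodic_forcing
begin

context
  assumes conv: "uniformly_convergent_on (UNIV \<times> {0..1}) (\<lambda>N (t, x). \<Sum>n<N. dmode n t * sin (freq n * x))"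
begin

lemma sol_t_uniform_limit:
  "uniform_limit (UNIV \<times> {0..1}) (\<lambda>N (t, x). \<Sum>n<N. dmode n t * sin (freq n * x)) (\<lambda>(t, x). sol_t t x) sequentially"
  using uniform_limit_suminf[of "UNIV \<times> {0..1}" "\<lambda>n (t, x). dmode n t * sin (freq n * x)"] conv
  by (simp add: case_prod_unfold sol_t_def)

lemma sol_t_continuous: "continuous_on (UNIV \<times> {0..1}) (\<lambda>(t, x). sol_t t x)"
proof (rule uniform_limit_theorem[OF _ sol_t_uniform_limit])
  show "\<forall>\<^sub>F N in sequentially. continuous_on (UNIV \<times> {0..1}) (\<lambda>(t, x). \<Sum>n<N. dmode n t * sin (freq n * x))"
    unfolding case_prod_unfold
    by (intro always_eventually allI continuous_intros continuous_on_compose2[OF dmode_continuous[of UNIV]]) auto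
qed simp

lemma sol_has_t_derivative:
  assumes x: "x \<in> {0..1}"
  shows "((\<lambda>s. sol s x) has_real_derivative sol_t t x) (at t)"
  unfolding sol_def sol_t_def
proof (rule has_field_derivative_series'(2)[of UNIV _ _ t])
  show "((\<lambda>s. mode n s * sin (freq n * x)) has_real_derivative dmode n s * sin (freq n * x)) (at s within UNIV)" for n s
    by (intro DERIV_cmult_right mode_has_derivative)
  have "uniform_limit UNIV (\<lambda>N s. \<Sum>n<N. dmode n s * sin (freq n * x)) (\<lambda>s. sol_t s x) sequentially"
    using uniform_limit_compose'[OF sol_t_uniform_limit, where h = "\<lambda>s. (s, x)" and B = UNIV] x by simp
  then show "uniformly_convergent_on UNIV (\<lambda>N s. \<Sum>n<N. dmode n s * sin (freq n * x))"
    unfolding uniformly_convergent_on_def by blast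
  show "summable (\<lambda>n. mode n t * sin (freq n * x))"
    by (rule series_summable) (rule trig_bounds(1))
qed auto

text \<open>
  The series for \<open>sol_xx\<close> cannot be differentiated twice term by term. Instead, the Dirichlet problem
  \<open>P'' = q\<close> with the continuous function \<open>q = h - sol_t + sol_xx + sol\<close> is solved by integrating twice;
  comparing sine coefficients identifies \<open>P\<close> with \<open>\<gamma> sol_xx\<close>.
\<close>

lemma fourth_derivative:
  obtains w where
    "\<And>x. x \<in> {0..1} \<Longrightarrow> (sol_xx t has_real_derivative w x) (at x within {0..1})"
    "\<And>x. x \<in> {0..1} \<Longrightarrow>
       (w has_real_derivative (h t x - sol_t t x + sol_xx t x + sol t x) / \<gamma>) (at x within {0..1})"
proof -
  have slice: "continuous_on {0..1} (v t)" if "continuous_on (UNIV \<times> {0..1}) (\<lambda>(t, x). v t x)"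
    for v :: "real \<Rightarrow> real \<Rightarrow> real"
  proof -
    have "continuous_on {0..1} (\<lambda>x. (\<lambda>(t, x). v t x) (t, x))"
      by (rule continuous_on_compose2[OF that]) (auto intro!: continuous_intros)
    then show ?thesis by simp
  qed
  have c_t: "continuous_on {0..1} (sol_t t)" by (rule slice[OF sol_t_continuous])
  have c_xx: "continuous_on {0..1} (sol_xx t)"
    by (rule slice[OF continuous_on_subset[OF sol_xx_continuous]]) simp
  have c_0: "continuous_on {0..1} (sol t)"
    by (rule slice[OF continuous_on_subset[OF sol_continuous]]) simp
  define q where "q x = h t x - sol_t t x + sol_xx t x + sol t x" for x
  have cq: "continuous_on {0..1} q"
    unfolding q_def by (intro continuous_intros h_continuous c_t c_xx c_0)
  define Q1 where "Q1 x = integral {0..x} q" for x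
  have Q1: "(Q1 has_real_derivative q x) (at x within {0..1})" if "x \<in> {0..1}" for x
    unfolding Q1_def by (rule integral_has_real_derivative[OF cq that])
  have cQ1: "continuous_on {0..1} Q1" by (rule DERIV_continuous_on[OF Q1])
  define Q2 where "Q2 x = integral {0..x} Q1" for x
  have Q2: "(Q2 has_real_derivative Q1 x) (at x within {0..1})" if "x \<in> {0..1}" for x
    unfolding Q2_def by (rule integral_has_real_derivative[OF cQ1 that])
  define P where "P x = Q2 x - x * Q2 1" for x
  define P' where "P' x = Q1 x - Q2 1" for x
  have P: "(P has_real_derivative P' x) (at x within {0..1})" if "x \<in> {0..1}" for x
    unfolding P_def P'_def by (auto intro!: derivative_eq_intros Q2 that)
  have P': "(P' has_real_derivative q x) (at x within {0..1})" if "x \<in> {0..1}" for x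
    unfolding P'_def by (auto intro!: derivative_eq_intros Q1 that)
  have cP: "continuous_on {0..1} P" by (rule DERIV_continuous_on[OF P])
  have s_t: "sine_coef (sol_t t) n = dmode n t" for n
  proof (rule sine_coef_uniform_limit)
    show "uniform_limit {0..1} (\<lambda>N x. \<Sum>m<N. dmode m t * sin (freq m * x)) (sol_t t) sequentially"
      using uniform_limit_compose'[OF sol_t_uniform_limit, where h = "\<lambda>x. (t, x)" and B = "{0..1}"] by simp
  qed
  have s_0: "sine_coef (sol t) n = mode n t" for n
    by (rule sine_coef_uniform_limit[OF sol_uniform_limit])
  have s_xx: "sine_coef (sol_xx t) n = - (mode n t * (freq n)\<^sup>2)" for n
  proof (rule sine_coef_uniform_limit[where a = "\<lambda>n. - (mode n t * (freq n)\<^sup>2)"])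
    show "uniform_limit {0..1} (\<lambda>N x. \<Sum>m<N. - (mode m t * (freq m)\<^sup>2) * sin (freq m * x)) (sol_xx t) sequentially"
      using uniform_limit_compose'[OF series_uniform_limit[of "\<lambda>n x. - ((freq n)\<^sup>2 * sin (freq n * x))", OF trig_bounds(3)],
        where h = "\<lambda>x. (t, x)" and B = "{0..1}"]
      by (simp add: sol_xx_def[abs_def] mult.assoc)
  qed
  have "sine_coef q n = sine_coef (h t) n - dmode n t - mode n t * (freq n)\<^sup>2 + mode n t" for n
    unfolding q_def
    by (simp add: sine_coef_add sine_coef_diff continuous_intros h_continuous c_t c_xx c_0 s_t s_0 s_xx)
  then have sq: "sine_coef q n = \<gamma> * freq n ^ 4 * mode n t" for n
    by (simp add: dmode_def eigenvalue_def algebra_simps)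
  have diff: "sine_coef (\<lambda>x. P x - \<gamma> * sol_xx t x) n = 0" for n
  proof -
    have "sine_coef q n = - (freq n)\<^sup>2 * sine_coef P n"
      by (rule sine_coef_second_derivative[OF P P' cq]) (simp_all add: P_def Q2_def)
    then have "(freq n)\<^sup>2 * sine_coef P n = - (\<gamma> * freq n ^ 4 * mode n t)"
      unfolding sq by linarith
    also have "\<dots> = (freq n)\<^sup>2 * (- (\<gamma> * (freq n)\<^sup>2 * mode n t))"
      by (simp add: power4_eq_xxxx power2_eq_square mult_ac)
    finally have "sine_coef P n = - (\<gamma> * (freq n)\<^sup>2 * mode n t)"
      using freq_pos[of n] by (subst (asm) mult_left_cancel) auto
    then show ?thesis
      by (simp add: sine_coef_diff[OF cP] sine_coef_cmult s_xx continuous_on_mult_left c_xx)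
  qed
  have cD: "continuous_on {0..1} (\<lambda>x. P x - \<gamma> * sol_xx t x)" by (intro continuous_intros cP c_xx)
  have eq: "P x / \<gamma> = sol_xx t x" if "x \<in> {0..1}" for x
    using sine_system_complete[OF cD diff that] gamma by (simp add: field_simps)
  show ?thesis
  proof (rule that[of "\<lambda>x. P' x / \<gamma>"])
    fix x :: real assume x: "x \<in> {0..1}"
    show "(sol_xx t has_real_derivative P' x / \<gamma>) (at x within {0..1})"
      by (rule has_field_derivative_transform_within[OF DERIV_cdivide[OF P[OF x]] zero_less_one x]) (simp add: eq)
    show "((\<lambda>x. P' x / \<gamma>) has_real_derivative (h t x - sol_t t x + sol_xx t x + sol t x) / \<gamma>) (at x within {0..1})"
      using DERIV_cdivide[OF P'[OF x], of \<gamma>] by (simp add: q_def)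
  qed
qed

text \<open>
  The source term of the linear problem takes the place of \<open>g\<close>, with the zero function as nonlinearity.
\<close>

theorem sol_is_classical:
  shows "C12 sol" "classical_solution \<gamma> \<tau> (\<lambda>_. 0) h sol"
proof -
  have t1: "dt_exists sol t x" "dt sol t x = sol_t t x" if "x \<in> {0..1}" for t x
    using sol_has_t_derivative[OF that, of t]
    by (auto simp: dt_exists_def dt_def real_differentiable_def intro: DERIV_imp_deriv)
  have d1: "dx_exists sol t x" "dx sol t x = sol_x t x" if "x \<in> {0..1}" for t x
    by (rule dx_of_extension[OF _ has_field_derivative_at_within[OF sol_has_x_derivative] that], simp)+
  have d2: "dx_exists (dx sol) t x" "dx (dx sol) t x = sol_xx t x" if "x \<in> {0..1}" for t x
    by (rule dx_of_extension[OF _ has_field_derivative_at_within[OF sol_x_has_x_derivative] that], simp add: d1)+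
  have d34: "dx_exists (dx (dx sol)) t x \<and> dx_exists (dx (dx (dx sol))) t x \<and>
      dx (dx (dx (dx sol))) t x = (h t x - sol_t t x + sol_xx t x + sol t x) / \<gamma>" if x: "x \<in> {0..1}" for t x
  proof -
    obtain w where w: "\<And>x. x \<in> {0..1} \<Longrightarrow> (sol_xx t has_real_derivative w x) (at x within {0..1})"
      "\<And>x. x \<in> {0..1} \<Longrightarrow>
         (w has_real_derivative (h t x - sol_t t x + sol_xx t x + sol t x) / \<gamma>) (at x within {0..1})"
      by (rule fourth_derivative[of t]) blast
    have d3: "dx_exists (dx (dx sol)) t x" "dx (dx (dx sol)) t x = w x" if "x \<in> {0..1}" for x
      by (rule dx_of_extension[OF _ w(1)[OF that] that], simp add: d2)+
    have "dx_exists (dx (dx (dx sol))) t x" "dx (dx (dx (dx sol))) t x = (h t x - sol_t t x + sol_xx t x + sol t x) / \<gamma>"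
      by (rule dx_of_extension[OF _ w(2)[OF x] x], simp add: d3)+
    with d3(1)[OF x] show ?thesis by simp
  qed
  have cont: "continuous_on (UNIV \<times> {0..1}) (\<lambda>(t, x). v t x)"
    if "continuous_on (UNIV \<times> {0..1}) (\<lambda>(t, x). u t x)" "\<And>t x. x \<in> {0..1} \<Longrightarrow> v t x = u t x"
    for u v :: "real \<Rightarrow> real \<Rightarrow> real"
    by (rule continuous_on_eq[OF that(1)]) (auto simp: that(2))
  have "continuous_on (UNIV \<times> {0..1}) (\<lambda>(t, x). sol t x)"
    by (rule continuous_on_subset[OF sol_continuous]) simp
  moreover have "continuous_on (UNIV \<times> {0..1}) (\<lambda>(t, x). dt sol t x)"
    by (rule cont[OF sol_t_continuous t1(2)])
  moreover have "continuous_on (UNIV \<times> {0..1}) (\<lambda>(t, x). dx sol t x)"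
    by (rule cont[OF continuous_on_subset[OF sol_x_continuous] d1(2)]) simp_all
  moreover have "continuous_on (UNIV \<times> {0..1}) (\<lambda>(t, x). dx (dx sol) t x)"
    by (rule cont[OF continuous_on_subset[OF sol_xx_continuous] d2(2)]) simp_all
  ultimately show "C12 sol" unfolding C12_def using t1 d1 d2 by simp
  have pow: "(dx ^^ 2) sol = dx (dx sol)" "(dx ^^ 3) sol = dx (dx (dx sol))" "(dx ^^ 4) sol = dx (dx (dx (dx sol)))"
    by (simp_all add: eval_nat_numeral)
  have "dx_exists ((dx ^^ j) sol) t x" if "j < 4" "x \<in> {0..1}" for j t x
  proof -
    have "j = 0 \<or> j = 1 \<or> j = 2 \<or> j = 3" using that(1) by linarith
    then show ?thesis using d1(1)[OF that(2)] d2(1)[OF that(2)] d34[OF that(2)] by (auto simp: pow)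
  qed
  moreover have "dt sol t x + \<gamma> * (dx ^^ 4) sol t x - (dx ^^ 2) sol t x - sol t x = h t x" if "x \<in> {0..1}" for t x
    using that gamma by (simp add: pow t1 d2 d34)
  ultimately show "classical_solution \<gamma> \<tau> (\<lambda>_. 0) h sol"
    unfolding classical_solution_def pow(1) using t1 d1 d2 sol_boundary by (auto simp: pow)
qed

end

end

section \<open>Tools for the nonlinear problem\<close>

lemma (in periodic_forcing) sol_periodic_x: "sol t (x + 2) = sol t x"
proof -
  have "sin (freq n * (x + 2)) = sin (freq n * x)" for n
  proof -
    have "freq n * (x + 2) = freq n * x + 2 * pi * of_int (int (Suc n))"
      by (simp add: freq_def algebra_simps)
    then show ?thesis using sin.plus_of_int[of "freq n * x" "int (Suc n)"] by (simp add: mult_ac)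
  qed
  then show ?thesis by (simp add: sol_def)
qed

lemma sol_difference:
  assumes h: "periodic_forcing \<gamma> \<omega> B h" and k: "periodic_forcing \<gamma> \<omega> B' k"
    and d: "periodic_forcing \<gamma> \<omega> \<delta> (\<lambda>t x. h t x - k t x)"
  shows "\<bar>periodic_forcing.sol \<gamma> \<omega> h t x - periodic_forcing.sol \<gamma> \<omega> k t x\<bar> \<le> periodic_forcing.sup_const \<gamma> \<delta>"
proof -
  interpret h: periodic_forcing \<gamma> \<omega> B h by fact
  interpret k: periodic_forcing \<gamma> \<omega> B' k by fact
  interpret d: periodic_forcing \<gamma> \<omega> \<delta> "\<lambda>t x. h t x - k t x" by fact
  have "d.mode n t = h.mode n t - k.mode n t" for n
    unfolding d.mode_def h.mode_def k.mode_def
    by (simp add: sine_coef_diff h.h_continuous k.h_continuous response_diff h.coef_continuous k.coef_continuous)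
  then have "d.sol t x = (\<Sum>n. h.mode n t * sin (freq n * x) - k.mode n t * sin (freq n * x))"
    by (simp add: d.sol_def left_diff_distrib)
  also have "\<dots> = h.sol t x - k.sol t x"
    unfolding h.sol_def k.sol_def
    by (intro suminf_diff[symmetric] h.series_summable k.series_summable trig_bounds)
  finally show ?thesis using d.sol_bound[of t x] by simp
qed

lemma lipschitz_on_compact:
  fixes f :: "'a::metric_space \<Rightarrow> 'b::metric_space"
  assumes f: "locally_lipschitz f" and X: "compact X"
  obtains L where "L-lipschitz_on X f"
proof -
  have ll: "local_lipschitz {0::real} X (\<lambda>_. f)"
  proof (rule local_lipschitzI)
    fix t :: real and x assume "x \<in> X"
    obtain r L where r: "0 < r" and L: "L-lipschitz_on (ball x r) f"
      using f unfolding locally_lipschitz_def by blast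
    have "L-lipschitz_on (cball x (r / 2) \<inter> X) f"
      by (rule lipschitz_on_subset[OF L]) (use r in auto)
    then show "\<exists>u>0. \<exists>L. \<forall>t\<in>cball t u \<inter> {0}. L-lipschitz_on (cball x u \<inter> X) f"
      using r by (intro exI[of _ "r / 2"]) auto
  qed
  show ?thesis
    by (rule local_lipschitz_compact_implies_lipschitz[OF ll X compact_sing]) (auto intro: that)
qed

lemma locally_lipschitz_continuous:
  fixes f :: "'a::metric_space \<Rightarrow> 'b::metric_space"
  assumes "locally_lipschitz f"
  shows "continuous_on UNIV f"
proof (rule continuous_at_imp_continuous_on, rule ballI)
  fix x
  obtain r L where r: "0 < r" and L: "L-lipschitz_on (ball x r) f"
    using assms unfolding locally_lipschitz_def by blast
  have "continuous_on (ball x r) f" by (rule lipschitz_on_continuous_on[OF L])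
  then show "isCont f x" using r by (simp add: continuous_on_eq_continuous_at)
qed

lemma hoelder_continuous:
  fixes g :: "'a::metric_space \<Rightarrow> 'b::metric_space"
  assumes "hoelder_continuous_on S g"
  shows "continuous_on S g"
proof -
  obtain \<alpha> C where a: "0 < \<alpha>" and H: "\<And>p q. p \<in> S \<Longrightarrow> q \<in> S \<Longrightarrow> dist (g p) (g q) \<le> C * dist p q powr \<alpha>"
    using assms unfolding hoelder_continuous_on_def by blast
  show ?thesis
    unfolding continuous_on_def
  proof
    fix p assume p: "p \<in> S"
    have "((\<lambda>q. C * dist q p powr \<alpha>) \<longlongrightarrow> C * dist p p powr \<alpha>) (at p within S)"
      using a
    proof (intro tendsto_mult tendsto_const tendsto_powr2)
      show "((\<lambda>q. dist q p) \<longlongrightarrow> dist p p) (at p within S)"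
        by (intro tendsto_dist tendsto_ident_at tendsto_const)
    qed auto
    then have lim: "((\<lambda>q. C * dist q p powr \<alpha>) \<longlongrightarrow> 0) (at p within S)" using a by simp
    have "((\<lambda>q. dist (g q) (g p)) \<longlongrightarrow> 0) (at p within S)"
      by (rule Lim_null_comparison[OF _ lim]) (use H p in \<open>auto simp: eventually_at_filter\<close>)
    then show "(g \<longlongrightarrow> g p) (at p within S)" by (rule tendsto_dist_iff[THEN iffD2])
  qed
qed

text \<open>
  Minkowski's inequality for a combination of functions of norm at most \<open>R\<close> and a constant. It is
  proved from a pointwise Cauchy-Schwarz inequality with weights \<open>\<beta> k * R\<close> and \<open>K\<close>, whose sum is \<open>Q\<close>, so
  that integration uses only the squares of the \<open>v k\<close>.
\<close>

lemma weighted_L2_bound: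
  fixes v :: "'n::finite \<Rightarrow> real \<Rightarrow> real" and \<beta> :: "'n \<Rightarrow> real"
  assumes H: "continuous_on {0..1} H" and v: "\<And>k. continuous_on {0..1} (v k)"
    and le: "\<And>x. x \<in> {0..1} \<Longrightarrow> \<bar>H x\<bar> \<le> (\<Sum>k\<in>UNIV. \<beta> k * \<bar>v k x\<bar>) + K"
    and \<beta>: "\<And>k. 0 \<le> \<beta> k" and K: "0 < K" and R: "0 < R"
    and L2: "\<And>k. integral {0..1} (\<lambda>x. (v k x)\<^sup>2) \<le> R\<^sup>2"
  shows "integral {0..1} (\<lambda>x. (H x)\<^sup>2) \<le> (sum \<beta> UNIV * R + K)\<^sup>2"
proof -
  define b where "b = sum \<beta> UNIV"
  define Q where "Q = b * R + K"
  have b: "0 \<le> b" unfolding b_def by (intro sum_nonneg \<beta>)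
  have Q: "0 < Q" using b R K by (simp add: Q_def add_nonneg_pos)
  have point: "(H x)\<^sup>2 \<le> Q * ((\<Sum>k\<in>UNIV. \<beta> k / R * (v k x)\<^sup>2) + K)" if x: "x \<in> {0..1}" for x
  proof -
    define y where "y = (\<Sum>k\<in>UNIV. \<beta> k * \<bar>v k x\<bar>) + K"
    \<comment> \<open>The common value at which all squares \<open>(\<bar>v k x\<bar> / R - c)\<^sup>2\<close> and \<open>(1 - c)\<^sup>2\<close> have the least weighted sum;
      that sum being nonnegative is the claim.\<close>
    define c where "c = y / Q"
    have "2 * c * (\<beta> k * \<bar>v k x\<bar>) \<le> \<beta> k / R * (v k x)\<^sup>2 + c\<^sup>2 * R * \<beta> k" for k
    proof -
      have "0 \<le> \<beta> k / R * (\<bar>v k x\<bar> - c * R)\<^sup>2" using \<beta>[of k] R by simp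
      also have "\<dots> = \<beta> k / R * (v k x)\<^sup>2 + c\<^sup>2 * R * \<beta> k - 2 * c * (\<beta> k * \<bar>v k x\<bar>)"
        using R by (simp add: power2_diff power_mult_distrib field_simps power2_eq_square)
      finally show ?thesis by simp
    qed
    then have "(\<Sum>k\<in>UNIV. 2 * c * (\<beta> k * \<bar>v k x\<bar>)) \<le> (\<Sum>k\<in>UNIV. \<beta> k / R * (v k x)\<^sup>2 + c\<^sup>2 * R * \<beta> k)"
      by (rule sum_mono)
    then have "2 * c * (y - K) \<le> (\<Sum>k\<in>UNIV. \<beta> k / R * (v k x)\<^sup>2) + c\<^sup>2 * R * b"
      by (simp add: y_def b_def sum.distrib sum_distrib_left)
    moreover have "2 * c * K \<le> K + c\<^sup>2 * K"
    proof -
      have "0 \<le> K * (1 - c)\<^sup>2" using K by simp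
      also have "\<dots> = K + c\<^sup>2 * K - 2 * c * K" by (simp add: power2_eq_square algebra_simps)
      finally show ?thesis by simp
    qed
    ultimately have "2 * c * y - c\<^sup>2 * Q \<le> (\<Sum>k\<in>UNIV. \<beta> k / R * (v k x)\<^sup>2) + K"
      by (simp add: Q_def algebra_simps)
    moreover have "2 * c * y - c\<^sup>2 * Q = y\<^sup>2 / Q"
      using Q by (simp add: c_def field_simps power2_eq_square)
    ultimately have "y\<^sup>2 \<le> Q * ((\<Sum>k\<in>UNIV. \<beta> k / R * (v k x)\<^sup>2) + K)"
      using Q by (simp add: pos_divide_le_eq mult.commute)
    moreover have "(H x)\<^sup>2 \<le> y\<^sup>2"
      using le[OF x] by (intro abs_le_square_iff[THEN iffD1]) (auto simp: y_def)
    ultimately show ?thesis by linarith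
  qed
  have I: "((\<lambda>x. Q * ((\<Sum>k\<in>UNIV. \<beta> k / R * (v k x)\<^sup>2) + K)) has_integral
      (Q * ((\<Sum>k\<in>UNIV. \<beta> k / R * integral {0..1} (\<lambda>x. (v k x)\<^sup>2)) + K))) {0..1}"
    using has_integral_const_real[of K 0 1]
    by (intro has_integral_mult_right has_integral_add has_integral_sum integrable_integral
         integrable_continuous_interval continuous_intros v) auto
  have "((\<lambda>x. (H x)\<^sup>2) has_integral integral {0..1} (\<lambda>x. (H x)\<^sup>2)) {0..1}"
    by (intro integrable_integral integrable_continuous_interval continuous_intros H)
  from has_integral_le[OF this I point]
  have "integral {0..1} (\<lambda>x. (H x)\<^sup>2) \<le> Q * ((\<Sum>k\<in>UNIV. \<beta> k / R * integral {0..1} (\<lambda>x. (v k x)\<^sup>2)) + K)" .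
  also have "\<dots> \<le> Q * ((\<Sum>k\<in>UNIV. \<beta> k / R * R\<^sup>2) + K)"
    using Q R \<beta> by (intro mult_left_mono add_right_mono sum_mono L2) auto
  also have "(\<Sum>k\<in>UNIV. \<beta> k / R * R\<^sup>2) = b * R"
    using R by (simp add: b_def sum_distrib_right power2_eq_square)
  also have "Q * (b * R + K) = Q\<^sup>2" by (simp add: Q_def power2_eq_square)
  finally show ?thesis by (simp add: Q_def b_def)
qed

lemma periodic_shift_int:
  fixes f :: "real \<Rightarrow> 'a"
  assumes per: "\<And>t. f (t + p) = f t"
  shows "f (t + of_int k * p) = f t"
proof (induction k rule: int_induct[where k = 0])
  case (step1 i)
  then show ?case using per[of "t + of_int i * p"] by (simp add: algebra_simps)
next
  case (step2 i)
  then show ?case using per[of "t + of_int (i - 1) * p"] by (simp add: algebra_simps)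
qed simp

lemma periodic_representative:
  fixes p t :: real
  assumes p: "0 < p"
  obtains t0 where "t0 \<in> {0..p}" and "\<And>f :: real \<Rightarrow> real. (\<And>t. f (t + p) = f t) \<Longrightarrow> f t = f t0"
proof (rule that[of "t + of_int (- \<lfloor>t / p\<rfloor>) * p"])
  have "of_int \<lfloor>t / p\<rfloor> \<le> t / p" "t / p \<le> of_int \<lfloor>t / p\<rfloor> + 1" by linarith+
  then have "of_int \<lfloor>t / p\<rfloor> * p \<le> t" "t \<le> (of_int \<lfloor>t / p\<rfloor> + 1) * p"
    unfolding pos_le_divide_eq[OF p] pos_divide_le_eq[OF p] .
  then show "t + of_int (- \<lfloor>t / p\<rfloor>) * p \<in> {0..p}" by (simp add: algebra_simps)
  show "f t = f (t + of_int (- \<lfloor>t / p\<rfloor>) * p)" if "\<And>t. f (t + p) = f t" for f :: "real \<Rightarrow> real"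
    by (rule periodic_shift_int[of f p, OF that, symmetric])
qed

section \<open>The compact convex set of candidates\<close>

text \<open>
  Functions are defined for all real \<open>x\<close>: sine series are 2-periodic in \<open>x\<close>, and with periodicity in both
  variables, uniform convergence on one rectangle is convergence in the norm of bounded continuous
  functions on the plane.
\<close>

definition candidates :: "real \<Rightarrow> real \<Rightarrow> real \<Rightarrow> real \<Rightarrow> ((real \<times> real) \<Rightarrow>\<^sub>C real) set" where
  "candidates \<omega> m M R = {u :: (real \<times> real) \<Rightarrow>\<^sub>C real.
     (\<forall>t x. u (t + \<omega>, x) = u (t, x) \<and> u (t, x + 2) = u (t, x)) \<and>
     (\<forall>p. \<bar>u p\<bar> \<le> m) \<and>
     (\<forall>t x t' x'. \<bar>u (t, x) - u (t', x')\<bar> \<le> M * (\<bar>x - x'\<bar> + sqrt \<bar>t - t'\<bar>)) \<and>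
     (\<forall>t. integral {0..1} (\<lambda>x. (u (t, x))\<^sup>2) \<le> R\<^sup>2)}"

lemma candidatesD:
  assumes "u \<in> candidates \<omega> m M R"
  shows "u (t + \<omega>, x) = u (t, x)" "u (t, x + 2) = u (t, x)" "\<bar>u p\<bar> \<le> m"
    "\<bar>u (t, x) - u (t', x')\<bar> \<le> M * (\<bar>x - x'\<bar> + sqrt \<bar>t - t'\<bar>)"
    "integral {0..1} (\<lambda>x. (u (t, x))\<^sup>2) \<le> R\<^sup>2"
  using assms unfolding candidates_def mem_Collect_eq by (elim conjE, blast)+

lemma bcontfun_slice_continuous:
  fixes u :: "(real \<times> real) \<Rightarrow>\<^sub>C real"
  shows "continuous_on A (\<lambda>x. u (t, x))"
  by (rule continuous_on_compose2[OF continuous_on_apply_bcontfun[of UNIV u]]) (auto intro!: continuous_intros)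

lemma convex_candidates: "convex (candidates \<omega> m M R)"
proof (rule convexI)
  fix u v :: "(real \<times> real) \<Rightarrow>\<^sub>C real" and a b :: real
  assume u: "u \<in> candidates \<omega> m M R" and v: "v \<in> candidates \<omega> m M R"
    and ab: "0 \<le> a" "0 \<le> b" "a + b = 1"
  have comb: "a * p + b * q \<le> r" if "p \<le> r" "q \<le> r" for p q r :: real
    using convex_bound_le[OF that ab] .
  have abscomb: "\<bar>a * p + b * q\<bar> \<le> r" if "\<bar>p\<bar> \<le> r" "\<bar>q\<bar> \<le> r" for p q r :: real
  proof -
    have "\<bar>a * p + b * q\<bar> \<le> a * \<bar>p\<bar> + b * \<bar>q\<bar>"
      using abs_triangle_ineq[of "a * p" "b * q"] ab by (simp add: abs_mult)
    with comb[OF that] show ?thesis by linarith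
  qed
  have app: "(a *\<^sub>R u + b *\<^sub>R v) p = a * u p + b * v p" for p by simp
  have "\<bar>(a *\<^sub>R u + b *\<^sub>R v) (t, x) - (a *\<^sub>R u + b *\<^sub>R v) (t', x')\<bar> \<le> M * (\<bar>x - x'\<bar> + sqrt \<bar>t - t'\<bar>)" for t x t' x'
  proof -
    have "a * u (t, x) + b * v (t, x) - (a * u (t', x') + b * v (t', x'))
        = a * (u (t, x) - u (t', x')) + b * (v (t, x) - v (t', x'))" by (simp add: algebra_simps)
    then show ?thesis unfolding app using u v by (simp only:) (rule abscomb, auto simp: candidates_def)
  qed
  moreover have "integral {0..1} (\<lambda>x. ((a *\<^sub>R u + b *\<^sub>R v) (t, x))\<^sup>2) \<le> R\<^sup>2" for t
  proof -
    have iu: "((\<lambda>x. (w (t, x))\<^sup>2) has_integral integral {0..1} (\<lambda>x. (w (t, x))\<^sup>2)) {0..1}"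
      for w :: "(real \<times> real) \<Rightarrow>\<^sub>C real"
      by (intro integrable_integral integrable_continuous_interval continuous_intros bcontfun_slice_continuous)
    have "((a *\<^sub>R u + b *\<^sub>R v) (t, x))\<^sup>2 \<le> a * (u (t, x))\<^sup>2 + b * (v (t, x))\<^sup>2" for x
    proof -
      define p q where "p = u (t, x)" and "q = v (t, x)"
      have "a * p\<^sup>2 + b * q\<^sup>2 - (a * p + b * q)\<^sup>2 = a * b * (p - q)\<^sup>2 + (1 - (a + b)) * (a * p\<^sup>2 + b * q\<^sup>2)"
        by (simp add: power2_eq_square algebra_simps)
      also have "\<dots> \<ge> 0" using ab by simp
      finally show ?thesis unfolding app p_def q_def by simp
    qed
    then have "integral {0..1} (\<lambda>x. ((a *\<^sub>R u + b *\<^sub>R v) (t, x))\<^sup>2) \<le>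
        a * integral {0..1} (\<lambda>x. (u (t, x))\<^sup>2) + b * integral {0..1} (\<lambda>x. (v (t, x))\<^sup>2)"
      by (rule has_integral_le[OF iu has_integral_add[OF has_integral_mult_right[OF iu] has_integral_mult_right[OF iu]]])
    also have "\<dots> \<le> R\<^sup>2" by (rule comb) (use u v in \<open>auto simp: candidates_def\<close>)
    finally show ?thesis .
  qed
  moreover have "\<bar>(a *\<^sub>R u + b *\<^sub>R v) p\<bar> \<le> m" for p
    unfolding app by (rule abscomb) (use u v in \<open>auto intro: candidatesD\<close>)
  moreover have "(a *\<^sub>R u + b *\<^sub>R v) (t + \<omega>, x) = (a *\<^sub>R u + b *\<^sub>R v) (t, x)"
    "(a *\<^sub>R u + b *\<^sub>R v) (t, x + 2) = (a *\<^sub>R u + b *\<^sub>R v) (t, x)" for t x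
    unfolding app using u v by (simp_all add: candidates_def)
  ultimately show "a *\<^sub>R u + b *\<^sub>R v \<in> candidates \<omega> m M R"
    unfolding candidates_def by blast
qed

lemma candidates_limit:
  assumes u: "\<And>n::nat. u n \<in> candidates \<omega> m M R" and lim: "u \<longlonglongrightarrow> l"
  shows "l \<in> candidates \<omega> m M R"
proof -
  have ul: "uniform_limit UNIV (\<lambda>n. apply_bcontfun (u n)) (apply_bcontfun l) sequentially"
    by (rule tendsto_bcontfun_uniform_limit[OF lim])
  have pt: "(\<lambda>n. u n p) \<longlonglongrightarrow> l p" for p
    using tendsto_uniform_limitI[OF ul, of p] by simp
  have 1: "l (t + \<omega>, x) = l (t, x)" for t x
    by (rule LIMSEQ_unique[OF pt[of "(t + \<omega>, x)"]]) (use pt[of "(t, x)"] u in \<open>simp add: candidates_def\<close>)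
  have 2: "l (t, x + 2) = l (t, x)" for t x
    by (rule LIMSEQ_unique[OF pt[of "(t, x + 2)"]]) (use pt[of "(t, x)"] u in \<open>simp add: candidates_def\<close>)
  have 3: "\<bar>l p\<bar> \<le> m" for p
    by (rule LIMSEQ_le_const2[OF tendsto_rabs[OF pt]]) (use u in \<open>auto intro: candidatesD\<close>)
  have 4: "\<bar>l (t, x) - l (t', x')\<bar> \<le> M * (\<bar>x - x'\<bar> + sqrt \<bar>t - t'\<bar>)" for t x t' x'
    by (rule LIMSEQ_le_const2[OF tendsto_rabs[OF tendsto_diff[OF pt pt]]]) (use u in \<open>auto simp: candidates_def\<close>)
  have 5: "integral {0..1} (\<lambda>x. (l (t, x))\<^sup>2) \<le> R\<^sup>2" for t
  proof -
    have s: "uniform_limit {0..1} (\<lambda>n x. u n (t, x)) (\<lambda>x. l (t, x)) sequentially"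
      using uniform_limit_compose'[OF ul, where h = "\<lambda>x. (t, x)" and B = "{0..1}"] by simp
    have bd: "bounded ((\<lambda>x. l (t, x)) ` {0..1})"
      using 3 unfolding bounded_iff by (auto intro!: exI[of _ m])
    have lim: "uniform_limit {0..1} (\<lambda>n x. u n (t, x) * u n (t, x)) (\<lambda>x. l (t, x) * l (t, x)) sequentially"
      by (rule uniform_lim_mult[OF s s bd bd])
    have c: "continuous_on {0..1} (\<lambda>x. u n (t, x) * u n (t, x))" for n
      by (intro continuous_intros bcontfun_slice_continuous)
    obtain I J where I: "\<And>n. ((\<lambda>x. u n (t, x) * u n (t, x)) has_integral I n) {0..1}"
      and J: "((\<lambda>x. l (t, x) * l (t, x)) has_integral J) {0..1}" and IJ: "I \<longlonglongrightarrow> J"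
      by (rule uniform_limit_integral[OF lim c sequentially_bot]) blast
    have "I n \<le> R\<^sup>2" for n
      using candidatesD(5)[OF u[of n], of t] integral_unique[OF I[of n]] by (simp add: power2_eq_square)
    then have "J \<le> R\<^sup>2" by (intro LIMSEQ_le_const2[OF IJ]) auto
    then show ?thesis using integral_unique[OF J] by (simp add: power2_eq_square)
  qed
  show ?thesis unfolding candidates_def using 1 2 3 4 5 by blast
qed

text \<open>
  The common modulus of continuity gives a subsequence that converges uniformly on a period
  rectangle, by the theorem of Arzela and Ascoli. By periodicity the subsequence is Cauchy in the space of
  bounded continuous functions on the plane, which is complete.
\<close>

lemma compact_candidates:
  assumes w: "0 < \<omega>" and M: "0 \<le> M"
  shows "compact (candidates \<omega> m M R)"
  unfolding compact_def
proof (intro allI impI)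
  fix u :: "nat \<Rightarrow> (real \<times> real) \<Rightarrow>\<^sub>C real"
  assume "\<forall>n. u n \<in> candidates \<omega> m M R"
  then have u: "u n \<in> candidates \<omega> m M R" for n by simp
  define box where "box = {0..\<omega>} \<times> {0..2::real}"
  have rep: "\<exists>p\<in>box. \<forall>v\<in>candidates \<omega> m M R. v (t, x) = v p" for t x
  proof -
    obtain t0 where t0: "t0 \<in> {0..\<omega>}" "\<And>f :: real \<Rightarrow> real. (\<And>t. f (t + \<omega>) = f t) \<Longrightarrow> f t = f t0"
      by (rule periodic_representative[OF w]) blast
    obtain x0 where x0: "x0 \<in> {0..2}" "\<And>f :: real \<Rightarrow> real. (\<And>x. f (x + 2) = f x) \<Longrightarrow> f x = f x0"
      by (rule periodic_representative[of 2]) (simp, blast)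
    have "v (t, x) = v (t0, x0)" if "v \<in> candidates \<omega> m M R" for v
      using t0(2)[of "\<lambda>t. v (t, x)"] x0(2)[of "\<lambda>x. v (t0, x)"] that by (simp add: candidates_def)
    then show ?thesis using t0(1) x0(1) by (intro bexI[of _ "(t0, x0)"]) (auto simp: box_def)
  qed
  have "compact box" unfolding box_def by (intro compact_Times compact_Icc)
  then obtain g k where k: "strict_mono (k :: nat \<Rightarrow> nat)"
    and conv: "\<And>e. 0 < e \<Longrightarrow> \<exists>N. \<forall>n p. n \<ge> N \<and> p \<in> box \<longrightarrow> norm (u (k n) p - g p) < e"
  proof (rule Arzela_Ascoli[of box "\<lambda>n. apply_bcontfun (u n)" m])
    show "norm (u n p) \<le> m" for n p using candidatesD(3)[OF u[of n]] by simp
    fix p :: "real \<times> real" and e :: real assume e: "0 < e"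
    \<comment> \<open>Points at distance less than \<open>r\<^sup>2\<close> have values that differ by at most \<open>2 M r < e\<close>, as \<open>r\<^sup>2 \<le> r\<close>.\<close>
    define r where "r = min 1 (e / (2 * (M + 1)))"
    have r: "0 < r" "r \<le> 1" using e M by (auto simp: r_def)
    have "norm (u n p - u n q) < e" if d: "norm (p - q) < r\<^sup>2" for n q
    proof -
      obtain t x t' x' where pq: "p = (t, x)" "q = (t', x')" by (cases p, cases q) auto
      have dt: "\<bar>t - t'\<bar> \<le> r\<^sup>2" and dx: "\<bar>x - x'\<bar> \<le> r\<^sup>2"
        using norm_fst_le[of "t - t'" "x - x'"] norm_snd_le[of "x - x'" "t - t'"] d unfolding pq by auto
      have "sqrt \<bar>t - t'\<bar> \<le> r" using dt r by (intro real_le_lsqrt) auto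
      moreover have "r\<^sup>2 \<le> r" using r by (simp add: power2_eq_square mult_left_le)
      ultimately have "\<bar>x - x'\<bar> + sqrt \<bar>t - t'\<bar> \<le> 2 * r" using dx by linarith
      then have "M * (\<bar>x - x'\<bar> + sqrt \<bar>t - t'\<bar>) \<le> M * (2 * r)" using M by (rule mult_left_mono)
      also have "\<dots> \<le> M * (2 * (e / (2 * (M + 1))))" using M by (intro mult_left_mono) (auto simp: r_def)
      also have "\<dots> < e" using M e by (simp add: field_simps)
      finally have "M * (\<bar>x - x'\<bar> + sqrt \<bar>t - t'\<bar>) < e" .
      moreover have "\<bar>u n (t, x) - u n (t', x')\<bar> \<le> M * (\<bar>x - x'\<bar> + sqrt \<bar>t - t'\<bar>)"
        by (rule candidatesD(4)[OF u])
      ultimately show ?thesis by (simp add: pq)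
    qed
    then show "\<exists>d. 0 < d \<and> (\<forall>n q. q \<in> box \<and> norm (p - q) < d \<longrightarrow> norm (u n p - u n q) < e)"
      using r by (intro exI[of _ "r\<^sup>2"]) auto
  next
    fix g and k :: "nat \<Rightarrow> nat"
    assume "strict_mono k" and "\<And>e. 0 < e \<Longrightarrow> \<exists>N. \<forall>n p. n \<ge> N \<and> p \<in> box \<longrightarrow> norm (u (k n) p - g p) < e"
    then show thesis by (rule that)
  qed
  have "Cauchy (u \<circ> k)"
  proof (rule metric_CauchyI)
    fix e :: real assume e: "0 < e"
    obtain N where N: "\<forall>n p. n \<ge> N \<and> p \<in> box \<longrightarrow> norm (u (k n) p - g p) < e / 3"
      using conv[of "e / 3"] e by auto
    have "dist (u (k i)) (u (k j)) < e" if ij: "i \<ge> N" "j \<ge> N" for i j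
    proof -
      have "dist (u (k i) q) (u (k j) q) \<le> 2 * e / 3" for q
      proof -
        obtain t x where q: "q = (t, x)" by (cases q)
        obtain p where p: "p \<in> box" "\<forall>v\<in>candidates \<omega> m M R. v (t, x) = v p" using rep by blast
        have "u (k i) q = u (k i) p" "u (k j) q = u (k j) p" using p(2) u by (auto simp: q)
        moreover have "norm (u (k i) p - g p) < e / 3" "norm (u (k j) p - g p) < e / 3"
          using N[rule_format, of i p] N[rule_format, of j p] ij p(1) by simp_all
        ultimately show ?thesis unfolding dist_real_def real_norm_def by linarith
      qed
      then have "dist (u (k i)) (u (k j)) \<le> 2 * e / 3" by (rule dist_bound)
      then show ?thesis using e by linarith
    qed
    then show "\<exists>N. \<forall>i\<ge>N. \<forall>j\<ge>N. dist ((u \<circ> k) i) ((u \<circ> k) j) < e" by auto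
  qed
  then obtain l where l: "(u \<circ> k) \<longlonglongrightarrow> l" using Cauchy_convergent convergent_def by blast
  have "l \<in> candidates \<omega> m M R" by (rule candidates_limit[OF _ l]) (simp add: u)
  with l k show "\<exists>l\<in>candidates \<omega> m M R. \<exists>k. strict_mono k \<and> (u \<circ> k) \<longlonglongrightarrow> l" by blast
qed

section \<open>The delayed problem\<close>

locale delayed_problem =
  fixes \<gamma> \<omega> K :: real and \<tau> \<beta> :: "'n::finite \<Rightarrow> real" and f :: "real ^ 'n \<Rightarrow> real"
    and g :: "real \<Rightarrow> real \<Rightarrow> real"
  assumes gamma: "0 < \<gamma>" and omega: "0 < \<omega>"
    and lipschitz: "locally_lipschitz f"
    and hoelder: "hoelder_continuous_on (UNIV \<times> {0..1}) (\<lambda>(t, x). g t x)"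
    and g_periodic: "time_periodic \<omega> g"
    and beta: "\<And>k. 0 < \<beta> k" and K: "0 < K"
    and growth: "\<And>t x \<xi>. x \<in> {0..1} \<Longrightarrow> \<bar>f \<xi> + g t x\<bar> \<le> (\<Sum>k\<in>UNIV. \<beta> k * \<bar>\<xi> $ k\<bar>) + K"
    and gap: "sum \<beta> UNIV < eigenvalue \<gamma> 0"
begin

text \<open>
  The fixed point of \<open>r \<mapsto> (sum \<beta> UNIV * r + K) / eigenvalue \<gamma> 0\<close>, which bounds the norm of the response to
  a forcing built from a function of norm \<open>r\<close>.
\<close>

definition radius :: real where
  "radius = K / (eigenvalue \<gamma> 0 - sum \<beta> UNIV)"

definition force_bound :: real where
  "force_bound = eigenvalue \<gamma> 0 * radius"

lemma radius_pos: "0 < radius"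
  using gap K by (simp add: radius_def)

lemma force_bound_eq: "sum \<beta> UNIV * radius + K = force_bound"
proof -
  have "(eigenvalue \<gamma> 0 - sum \<beta> UNIV) * radius = K" using gap by (simp add: radius_def)
  then show ?thesis by (simp add: force_bound_def algebra_simps)
qed

lemma force_bound_pos: "0 < force_bound"
  using radius_pos eigenvalue_pos[OF gamma] by (simp add: force_bound_def)

definition max_value :: real where
  "max_value = periodic_forcing.sup_const \<gamma> (2 * force_bound)"

definition hoelder_const :: real where
  "hoelder_const = periodic_forcing.modulus \<gamma> (2 * force_bound)"

abbreviation S :: "((real \<times> real) \<Rightarrow>\<^sub>C real) set" where
  "S \<equiv> candidates \<omega> max_value hoelder_const radius"

definition forcing :: "((real \<times> real) \<Rightarrow>\<^sub>C real) \<Rightarrow> real \<Rightarrow> real \<Rightarrow> real" where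
  "forcing u t x = g t x + f (\<chi> k. u (t - \<tau> k, x))"

lemma forcing_continuous: "continuous_on (UNIV \<times> {0..1}) (\<lambda>(t, x). forcing u t x)"
proof -
  have "continuous_on (UNIV \<times> {0..1}) (\<lambda>p. \<chi> k. u (fst p - \<tau> k, snd p))"
    by (intro continuous_on_vec_lambda continuous_on_compose2[OF continuous_on_apply_bcontfun[of UNIV u]])
       (auto intro!: continuous_intros)
  then have "continuous_on (UNIV \<times> {0..1}) (\<lambda>p. f (\<chi> k. u (fst p - \<tau> k, snd p)))"
    by (rule continuous_on_compose2[OF locally_lipschitz_continuous[OF lipschitz]]) simp
  from continuous_on_add[OF hoelder_continuous[OF hoelder] this] show ?thesis
    by (simp add: forcing_def case_prod_unfold)
qed

lemma forcing_slice: "continuous_on {0..1} (forcing u t)"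
proof -
  have "continuous_on {0..1} (\<lambda>x. (\<lambda>(t, x). forcing u t x) (t, x))"
    by (rule continuous_on_compose2[OF forcing_continuous]) (auto intro!: continuous_intros)
  then show ?thesis by simp
qed

lemma forcing_periodic:
  assumes "u \<in> S" "x \<in> {0..1}"
  shows "forcing u (t + \<omega>) x = forcing u t x"
proof -
  have "u (t + \<omega> - \<tau> k, x) = u (t - \<tau> k, x)" for k
    using candidatesD(1)[OF assms(1), of "t - \<tau> k" x] by (simp add: algebra_simps)
  then show ?thesis using g_periodic assms(2) by (simp add: forcing_def time_periodic_def)
qed

lemma forcing_L2:
  assumes u: "u \<in> S"
  shows "integral {0..1} (\<lambda>x. (forcing u t x)\<^sup>2) \<le> force_bound\<^sup>2"
  unfolding force_bound_eq[symmetric]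
proof (rule weighted_L2_bound[where v = "\<lambda>k x. u (t - \<tau> k, x)"])
  show "\<bar>forcing u t x\<bar> \<le> (\<Sum>k\<in>UNIV. \<beta> k * \<bar>u (t - \<tau> k, x)\<bar>) + K" if "x \<in> {0..1}" for x
    using growth[OF that, of "\<chi> k. u (t - \<tau> k, x)" t] by (simp add: forcing_def add.commute)
qed (use beta K radius_pos forcing_slice bcontfun_slice_continuous candidatesD(5)[OF u] in \<open>auto intro: less_imp_le\<close>)

text \<open>
  By Bessel's inequality, a sine coefficient is at most \<open>sqrt 2\<close> times the \<open>L\<^sup>2\<close> norm; the factor 2
  in the bound is a convenient upper estimate.
\<close>

lemma periodic_forcing_S:
  assumes u: "u \<in> S"
  shows "periodic_forcing \<gamma> \<omega> (2 * force_bound) (forcing u)"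
proof
  fix t n
  have "(sine_coef (forcing u t) n)\<^sup>2 \<le> (\<Sum>m<Suc n. (sine_coef (forcing u t) m)\<^sup>2)"
    by (rule member_le_sum) auto
  also have "\<dots> \<le> 2 * force_bound\<^sup>2"
    using bessel[OF forcing_slice, of u t "Suc n"] forcing_L2[OF u, of t] by linarith
  also have "\<dots> \<le> (2 * force_bound)\<^sup>2" by (simp add: power_mult_distrib)
  finally have "\<bar>sine_coef (forcing u t) n\<bar> \<le> \<bar>2 * force_bound\<bar>" by (simp only: abs_le_square_iff)
  then show "\<bar>sine_coef (forcing u t) n\<bar> \<le> 2 * force_bound" using force_bound_pos by simp
qed (use gamma omega forcing_continuous forcing_periodic[OF u] in auto)

definition solve :: "((real \<times> real) \<Rightarrow>\<^sub>C real) \<Rightarrow> (real \<times> real) \<Rightarrow>\<^sub>C real" where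
  "solve u = Bcontfun (\<lambda>(t, x). periodic_forcing.sol \<gamma> \<omega> (forcing u) t x)"

lemma solve_apply:
  assumes u: "u \<in> S"
  shows "solve u (t, x) = periodic_forcing.sol \<gamma> \<omega> (forcing u) t x"
proof -
  interpret periodic_forcing \<gamma> \<omega> "2 * force_bound" "forcing u" by (rule periodic_forcing_S[OF u])
  have "(\<lambda>(t, x). sol t x) \<in> bcontfun"
    by (rule bcontfun_normI[OF sol_continuous, of sup_const]) (auto simp: sol_bound)
  then show ?thesis by (simp add: solve_def Bcontfun_inverse)
qed

lemma solve_in_S:
  assumes u: "u \<in> S"
  shows "solve u \<in> S"
proof -
  interpret periodic_forcing \<gamma> \<omega> "2 * force_bound" "forcing u" by (rule periodic_forcing_S[OF u])
  have "integral {0..1} (\<lambda>x. (sol t x)\<^sup>2) \<le> (force_bound / eigenvalue \<gamma> 0)\<^sup>2" for t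
    by (rule sol_L2_bound) (use force_bound_pos forcing_L2[OF u] in auto)
  moreover have "force_bound / eigenvalue \<gamma> 0 = radius"
    using eigenvalue_pos[OF gamma, of 0] by (simp add: force_bound_def)
  ultimately have "integral {0..1} (\<lambda>x. (sol t x)\<^sup>2) \<le> radius\<^sup>2" for t by simp
  then show ?thesis
    unfolding candidates_def max_value_def hoelder_const_def
    using sol_periodic sol_periodic_x sol_bound sol_modulus by (auto simp: solve_apply[OF u])
qed

lemma f_lipschitz:
  obtains L where "0 \<le> L" "\<And>\<xi> \<eta>. (\<And>k. \<bar>\<xi> $ k\<bar> \<le> max_value) \<Longrightarrow> (\<And>k. \<bar>\<eta> $ k\<bar> \<le> max_value) \<Longrightarrow>
    \<bar>f \<xi> - f \<eta>\<bar> \<le> L * (\<Sum>k\<in>UNIV. \<bar>\<xi> $ k - \<eta> $ k\<bar>)"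
proof -
  define X :: "(real ^ 'n) set" where "X = cbox (\<chi> k. - max_value) (\<chi> k. max_value)"
  obtain L where L: "L-lipschitz_on X f"
    by (rule lipschitz_on_compact[OF lipschitz, of X]) (auto simp: X_def)
  show ?thesis
  proof (rule that[of L])
    show L0: "0 \<le> L" using L by (rule lipschitz_on_nonneg)
    fix \<xi> \<eta> :: "real ^ 'n"
    assume "\<And>k. \<bar>\<xi> $ k\<bar> \<le> max_value" "\<And>k. \<bar>\<eta> $ k\<bar> \<le> max_value"
    then have "\<xi> \<in> X" "\<eta> \<in> X" by (auto simp: X_def mem_box_cart abs_le_iff minus_le_iff)
    then have "\<bar>f \<xi> - f \<eta>\<bar> \<le> L * norm (\<xi> - \<eta>)"
      using lipschitz_onD[OF L] by (simp add: dist_norm)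
    also have "\<dots> \<le> L * (\<Sum>k\<in>UNIV. \<bar>\<xi> $ k - \<eta> $ k\<bar>)"
      using norm_le_l1_cart[of "\<xi> - \<eta>"] L0 by (intro mult_left_mono) auto
    finally show "\<bar>f \<xi> - f \<eta>\<bar> \<le> L * (\<Sum>k\<in>UNIV. \<bar>\<xi> $ k - \<eta> $ k\<bar>)" .
  qed
qed

text \<open>
  On \<open>S\<close> all arguments of \<open>f\<close> lie in one cube, where \<open>f\<close> is Lipschitz continuous, and the linear solution operator is
  bounded in the maximum norm.
\<close>

lemma solve_continuous: "continuous_on S solve"
proof -
  obtain L where L0: "0 \<le> L" and L: "\<And>\<xi> \<eta>. (\<And>k. \<bar>\<xi> $ k\<bar> \<le> max_value) \<Longrightarrow> (\<And>k. \<bar>\<eta> $ k\<bar> \<le> max_value) \<Longrightarrow>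
    \<bar>f \<xi> - f \<eta>\<bar> \<le> L * (\<Sum>k\<in>UNIV. \<bar>\<xi> $ k - \<eta> $ k\<bar>)"
    by (rule f_lipschitz) blast
  define c where "c = 2 * (L * real CARD('n)) / (\<gamma> * pi\<^sup>2) * (\<Sum>n. 1 / (real (Suc n))\<^sup>2)"
  have est: "dist (solve u) (solve v) \<le> c * dist u v" if u: "u \<in> S" and v: "v \<in> S" for u v
  proof -
    define d where "d = dist u v"
    have d0: "0 \<le> d" by (simp add: d_def)
    have diff: "\<bar>forcing u t x - forcing v t x\<bar> \<le> L * real CARD('n) * d" for t x
    proof -
      have "\<bar>forcing u t x - forcing v t x\<bar> \<le> L * (\<Sum>k\<in>(UNIV::'n set). \<bar>u (t - \<tau> k, x) - v (t - \<tau> k, x)\<bar>)"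
        using L[of "\<chi> k. u (t - \<tau> k, x)" "\<chi> k. v (t - \<tau> k, x)"] candidatesD(3)[OF u] candidatesD(3)[OF v]
        by (simp add: forcing_def)
      also have "\<dots> \<le> L * (\<Sum>k\<in>(UNIV::'n set). d)"
        using L0 dist_bounded[of u _ v] by (intro mult_left_mono sum_mono) (auto simp: d_def dist_real_def)
      finally show ?thesis by (simp add: mult_ac)
    qed
    interpret u: periodic_forcing \<gamma> \<omega> "2 * force_bound" "forcing u" by (rule periodic_forcing_S[OF u])
    interpret v: periodic_forcing \<gamma> \<omega> "2 * force_bound" "forcing v" by (rule periodic_forcing_S[OF v])
    interpret d: periodic_forcing \<gamma> \<omega> "2 * (L * real CARD('n) * d)" "\<lambda>t x. forcing u t x - forcing v t x"
    proof
      show "continuous_on (UNIV \<times> {0..1}) (\<lambda>(t, x). forcing u t x - forcing v t x)"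
        using continuous_on_diff[OF u.cont v.cont] by (simp add: case_prod_unfold)
      show "\<bar>sine_coef (\<lambda>x. forcing u t x - forcing v t x) n\<bar> \<le> 2 * (L * real CARD('n) * d)" for t n
        by (rule sine_coef_bound) (intro continuous_intros forcing_slice, rule diff)
    qed (use gamma omega u.periodic v.periodic in auto)
    have "\<bar>u.sol t x - v.sol t x\<bar> \<le> d.sup_const" for t x
      by (rule sol_difference[OF periodic_forcing_S[OF u] periodic_forcing_S[OF v] d.periodic_forcing_axioms])
    also have "d.sup_const = c * d"
      by (simp add: d.sup_const_def d.weight_def c_def)
    finally have "\<bar>u.sol t x - v.sol t x\<bar> \<le> c * d" for t x .
    then have "dist (solve u p) (solve v p) \<le> c * d" for p
      by (cases p) (simp add: solve_apply u v dist_real_def)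
    then show ?thesis unfolding d_def by (rule dist_bound)
  qed
  have "(max c 0)-lipschitz_on S solve"
  proof (rule lipschitz_onI)
    show "dist (solve u) (solve v) \<le> max c 0 * dist u v" if "u \<in> S" "v \<in> S" for u v
      by (rule order_trans[OF est[OF that]]) (intro mult_right_mono, auto)
  qed simp
  then show ?thesis by (rule lipschitz_on_continuous_on)
qed

text \<open>
  Both constants bound absolute values that belong to the zero forcing.
\<close>

lemma constants_nonneg: "0 \<le> max_value" "0 \<le> hoelder_const"
proof -
  interpret zero: periodic_forcing \<gamma> \<omega> "2 * force_bound" "\<lambda>_ _. 0"
    by unfold_locales (use gamma omega force_bound_pos in \<open>auto simp: sine_coef_def case_prod_unfold\<close>)
  show "0 \<le> max_value"
    using order_trans[OF abs_ge_zero zero.sol_bound] by (simp add: max_value_def)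
  show "0 \<le> hoelder_const"
    using order_trans[OF abs_ge_zero zero.sol_modulus[of 1 0 0 0]] by (simp add: hoelder_const_def)
qed

lemma S_nonempty: "S \<noteq> {}"
proof -
  have "0 \<in> S" using constants_nonneg by (simp add: candidates_def)
  then show ?thesis by blast
qed

theorem exists_periodic_solution:
  "\<exists>u. C12 u \<and> classical_solution \<gamma> \<tau> f g u \<and> time_periodic \<omega> u"
proof -
  have "compact S" by (rule compact_candidates[OF omega constants_nonneg(2)])
  then obtain u where u: "u \<in> S" and fix_u: "solve u = u"
    by (rule schauder_fixed_point[OF _ convex_candidates S_nonempty solve_continuous]) (use solve_in_S in auto)
  interpret periodic_forcing \<gamma> \<omega> "2 * force_bound" "forcing u" by (rule periodic_forcing_S[OF u])
  have sol_u: "sol t x = u (t, x)" for t x using solve_apply[OF u] fix_u by simp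
  obtain L where L0: "0 \<le> L" and L: "\<And>\<xi> \<eta>. (\<And>k. \<bar>\<xi> $ k\<bar> \<le> max_value) \<Longrightarrow> (\<And>k. \<bar>\<eta> $ k\<bar> \<le> max_value) \<Longrightarrow>
    \<bar>f \<xi> - f \<eta>\<bar> \<le> L * (\<Sum>k\<in>UNIV. \<bar>\<xi> $ k - \<eta> $ k\<bar>)"
    by (rule f_lipschitz) blast
  obtain \<alpha> C where a: "0 < \<alpha>" "\<alpha> \<le> 1" and C: "\<And>p q. p \<in> UNIV \<times> {0..1} \<Longrightarrow> q \<in> UNIV \<times> {0..1} \<Longrightarrow>
      dist ((\<lambda>(t, x). g t x) p) ((\<lambda>(t, x). g t x) q) \<le> C * dist p q powr \<alpha>"
    using hoelder unfolding hoelder_continuous_on_def by blast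
  \<comment> \<open>The exponent \<open>\<alpha>\<close> comes from \<open>g\<close>, the exponent \<open>1/2\<close> from the fixed point through the Lipschitz function \<open>f\<close>.
    On \<open>(0, \<omega>]\<close> the higher power is at most a multiple of the lower one.\<close>
  define \<theta> where "\<theta> = min \<alpha> (1 / 2)"
  define M where "M = L * real CARD('n) * hoelder_const"
  define D where "D = \<bar>C\<bar> * \<omega> powr (\<alpha> - \<theta>) + M * \<omega> powr (1 / 2 - \<theta>)"
  have M0: "0 \<le> M" using L0 constants_nonneg(2) by (simp add: M_def)
  have theta: "0 < \<theta>" "\<theta> \<le> 1" "\<theta> \<le> \<alpha>" "\<theta> \<le> 1 / 2" using a by (auto simp: \<theta>_def)
  have split: "s powr r \<le> \<omega> powr (r - \<theta>) * s powr \<theta>" if "0 < s" "s \<le> \<omega>" "\<theta> \<le> r" for s r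
  proof -
    have "s powr r = s powr (r - \<theta>) * s powr \<theta>" by (simp add: powr_add[symmetric])
    also have "\<dots> \<le> \<omega> powr (r - \<theta>) * s powr \<theta>"
      using that by (intro mult_right_mono powr_mono2) auto
    finally show ?thesis .
  qed
  have conv: "uniformly_convergent_on (UNIV \<times> {0..1}) (\<lambda>N (t, x). \<Sum>n<N. dmode n t * sin (freq n * x))"
  proof (rule time_derivative_converges[OF theta(1,2), of D])
    fix t s x :: real
    assume x: "x \<in> {0..1}" and s: "0 < s" "s \<le> \<omega>"
    have "\<bar>g t x - g (t - s) x\<bar> \<le> C * s powr \<alpha>"
      using C[of "(t, x)" "(t - s, x)"] x s by (simp add: dist_Pair_Pair dist_real_def)
    also have "\<dots> \<le> \<bar>C\<bar> * (\<omega> powr (\<alpha> - \<theta>) * s powr \<theta>)"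
      by (rule mult_mono[OF abs_ge_self split[OF s theta(3)]]) auto
    finally have 1: "\<bar>g t x - g (t - s) x\<bar> \<le> \<bar>C\<bar> * (\<omega> powr (\<alpha> - \<theta>) * s powr \<theta>)" .
    have "\<bar>f (\<chi> k. u (t - \<tau> k, x)) - f (\<chi> k. u (t - s - \<tau> k, x))\<bar> \<le>
        L * (\<Sum>k\<in>(UNIV::'n set). \<bar>u (t - \<tau> k, x) - u (t - s - \<tau> k, x)\<bar>)"
      using L[of "\<chi> k. u (t - \<tau> k, x)" "\<chi> k. u (t - s - \<tau> k, x)"] candidatesD(3)[OF u] by simp
    also have "\<dots> \<le> L * (\<Sum>k\<in>(UNIV::'n set). hoelder_const * sqrt s)"
    proof (intro mult_left_mono sum_mono L0)
      fix k
      show "\<bar>u (t - \<tau> k, x) - u (t - s - \<tau> k, x)\<bar> \<le> hoelder_const * sqrt s"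
        using candidatesD(4)[OF u, of "t - \<tau> k" x "t - s - \<tau> k" x] s by simp
    qed
    also have "\<dots> = M * s powr (1 / 2)" using s by (simp add: M_def powr_half_sqrt)
    also have "\<dots> \<le> M * (\<omega> powr (1 / 2 - \<theta>) * s powr \<theta>)"
      by (rule mult_left_mono[OF split[OF s theta(4)] M0])
    finally have "\<bar>f (\<chi> k. u (t - \<tau> k, x)) - f (\<chi> k. u (t - s - \<tau> k, x))\<bar> \<le> M * (\<omega> powr (1 / 2 - \<theta>) * s powr \<theta>)" .
    then have "\<bar>forcing u t x - forcing u (t - s) x\<bar> \<le>
        \<bar>C\<bar> * (\<omega> powr (\<alpha> - \<theta>) * s powr \<theta>) + M * (\<omega> powr (1 / 2 - \<theta>) * s powr \<theta>)"
      using 1 unfolding forcing_def by linarith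
    then show "\<bar>forcing u t x - forcing u (t - s) x\<bar> \<le> D * s powr \<theta>"
      by (simp add: D_def algebra_simps)
  qed
  define w where "w = sol"
  have forcing_w: "forcing u t x = g t x + f (\<chi> k. w (t - \<tau> k) x)" for t x
    by (simp add: forcing_def w_def sol_u)
  have "classical_solution \<gamma> \<tau> (\<lambda>_. 0) (forcing u) w"
    unfolding w_def by (rule sol_is_classical(2)[OF conv])
  then have "classical_solution \<gamma> \<tau> f g w"
    unfolding classical_solution_def forcing_w by simp
  moreover have "C12 w" unfolding w_def by (rule sol_is_classical(1)[OF conv])
  moreover have "time_periodic \<omega> w" by (simp add: w_def time_periodic_def sol_periodic)
  ultimately show ?thesis by blast
qed

end

theorem theorem1p1:
  fixes \<gamma> \<omega> K :: real
    and \<tau> \<beta> :: "'n::finite \<Rightarrow> real"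
    and f :: "real ^ 'n \<Rightarrow> real"
    and g :: "real \<Rightarrow> real \<Rightarrow> real"
  assumes "\<gamma> > 0" and "\<omega> > 0" and "\<And>k. \<tau> k > 0"
    and "locally_lipschitz f"
    and "hoelder_continuous_on (UNIV \<times> {0..1}) (\<lambda>(t, x). g t x)"
    and "time_periodic \<omega> g"
    and "\<And>k. \<beta> k > 0" and "K > 0"
    and "\<And>t x \<xi>. x \<in> {0..1} \<Longrightarrow> \<bar>f \<xi> + g t x\<bar> \<le> (\<Sum>k\<in>UNIV. \<beta> k * \<bar>\<xi> $ k\<bar>) + K"
    and "(\<Sum>k\<in>UNIV. \<beta> k) < \<gamma> * pi ^ 4 + pi ^ 2 - 1"
  shows "\<exists>u. C12 u \<and> classical_solution \<gamma> \<tau> f g u \<and> time_periodic \<omega> u"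
proof -
  interpret delayed_problem \<gamma> \<omega> K \<tau> \<beta> f g
    by unfold_locales (use assms in \<open>simp_all add: eigenvalue_0\<close>)
  show ?thesis by (rule exists_periodic_solution)
qed

end
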